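(* Let $n\ge2$. For any $\mathbf b=(b_1,\dots,b_{n-1})\in\mathbb C^{n-1}$ one has: (a) $sp_{2n}^{(\mathbf b)}\cong sl_n^{(b_1,\dots,b_{n-2})}\ltimes J$, where the first factor is a copy of $sl_n^{(b_1,\dots,b_{n-2})}$ in $sp_{2n}^{(\mathbf b)}$ generated by $u_1,\dots,u_{n-1}$, and $J$ is the Lie ideal of $sp_{2n}^{(\mathbf b)}$ generated by $u_n$. As an $sl_n^{(b_1,\dots,b_{n-2})}$-module, $J$ is isomorphic to $S^2V$, where $V$ is the restriction to $sl_n^{(b_1,\dots,b_{n-2})}\subset sl_n$ of the standard $sl_n$-module $\mathbb C^n$. (b) If all $b_i\neq0$, then there is an isomorphism of Lie algebras $J\cong sl_{n+1}^{(\mathbf b')}$ for some choice of parameters $\mathbf b'\in\mathbb C^{n-1}$, and the Lie algebra $sp_{2n}^{(\mathbf b)}$ is naturally isomorphic to $sl_n^{(b_1,\dots,b_{n-2})}\ltimes sl_{n+1}^{(\mathbf b')}$ (the semidirect product structure being transported from (a) through $J\cong sl_{n+1}^{(\mathbf b')}$).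
   Context: $sl_m^{(c_1,\dots,c_{m-2})}$ is the Lie algebra with generators $u_1,\dots,u_{m-1}$ and relations $[u_i,u_j]=0$ for $|i-j|>1$, $[u_i,[u_i,u_j]]=-2c_{\min(i,j)}u_i$ for $|i-j|=1$; it is identified with the subalgebra of $sl_m(\mathbb C)$ generated by $u_i=e_i+c_{i-1}f_{i-1}$ (with $c_0=0$, $f_0=0$; $e_i=E_{i,i+1}$, $f_i=E_{i+1,i}$). $sp_{2n}^{(\mathbf b)}$ (edge type $C_n$ with long root $\alpha_n$, so $a_{n-1,n}=-2$, $a_{n,n-1}=-1$) is the Lie algebra with generators $u_1,\dots,u_n$ and relations: $[u_i,u_j]=0$ for $|i-j|>1$; $[u_i,[u_i,u_j]]=-2b_{\min(i,j)}u_i$ for $|i-j|=1$, $i,j\le n-1$; $[u_n,[u_n,u_{n-1}]]=-2b_{n-1}u_n$; $(\mathrm{ad}\,u_{n-1})^3(u_n)=0$. *)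

theory Defs
  imports "Jordan_Normal_Form.VS_Connect"
begin

text \<open>
  Complex Lie algebras with explicit carrier, as \<open>HOL-Algebra\<close> modules over
  \<^term>\<open>class_ring :: complex ring\<close> with a bracket. The fields \<open>mult\<close> and \<open>one\<close> inherited
  from the record \<open>module\<close> play no role.
\<close>

record 'a lie_alg = "(complex, 'a) module" +
  lie_bracket :: "'a \<Rightarrow> 'a \<Rightarrow> 'a" (\<open>(\<lbrace>_,/ _\<rbrace>\<index>)\<close>)

locale lie_algebra = vectorspace "class_ring :: complex ring" L
  for L :: "('a, 'b) lie_alg_scheme" (structure) +
  assumes bracket_closed: "x \<in> carrier L \<Longrightarrow> y \<in> carrier L \<Longrightarrow> \<lbrace>x, y\<rbrace> \<in> carrier L"
    and bracket_add_left: "x \<in> carrier L \<Longrightarrow> y \<in> carrier L \<Longrightarrow> z \<in> carrier L \<Longrightarrow>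
      \<lbrace>x \<oplus> y, z\<rbrace> = \<lbrace>x, z\<rbrace> \<oplus> \<lbrace>y, z\<rbrace>"
    and bracket_add_right: "x \<in> carrier L \<Longrightarrow> y \<in> carrier L \<Longrightarrow> z \<in> carrier L \<Longrightarrow>
      \<lbrace>x, y \<oplus> z\<rbrace> = \<lbrace>x, y\<rbrace> \<oplus> \<lbrace>x, z\<rbrace>"
    and bracket_smult_left: "x \<in> carrier L \<Longrightarrow> y \<in> carrier L \<Longrightarrow> \<lbrace>a \<odot> x, y\<rbrace> = a \<odot> \<lbrace>x, y\<rbrace>"
    and bracket_smult_right: "x \<in> carrier L \<Longrightarrow> y \<in> carrier L \<Longrightarrow> \<lbrace>x, a \<odot> y\<rbrace> = a \<odot> \<lbrace>x, y\<rbrace>"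
    and bracket_self: "x \<in> carrier L \<Longrightarrow> \<lbrace>x, x\<rbrace> = \<zero>"
    and jacobi: "x \<in> carrier L \<Longrightarrow> y \<in> carrier L \<Longrightarrow> z \<in> carrier L \<Longrightarrow>
      \<lbrace>x, \<lbrace>y, z\<rbrace>\<rbrace> \<oplus> \<lbrace>y, \<lbrace>z, x\<rbrace>\<rbrace> \<oplus> \<lbrace>z, \<lbrace>x, y\<rbrace>\<rbrace> = \<zero>"

definition lie_hom ::
    "('a, 'c) lie_alg_scheme \<Rightarrow> ('b, 'd) lie_alg_scheme \<Rightarrow> ('a \<Rightarrow> 'b) set" where
  "lie_hom L M = {h \<in> LinearCombinations.module_hom class_ring L M.
     \<forall>x\<in>carrier L. \<forall>y\<in>carrier L. h (\<lbrace>x, y\<rbrace>\<^bsub>L\<^esub>) = \<lbrace>h x, h y\<rbrace>\<^bsub>M\<^esub>}"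

definition lie_iso ::
    "('a, 'c) lie_alg_scheme \<Rightarrow> ('b, 'd) lie_alg_scheme \<Rightarrow> ('a \<Rightarrow> 'b) set" where
  "lie_iso L M = {h \<in> lie_hom L M. bij_betw h (carrier L) (carrier M)}"

definition lie_subalgebra :: "'a set \<Rightarrow> ('a, 'c) lie_alg_scheme \<Rightarrow> bool" where
  "lie_subalgebra S L \<longleftrightarrow> submodule class_ring S L \<and> (\<forall>x\<in>S. \<forall>y\<in>S. \<lbrace>x, y\<rbrace>\<^bsub>L\<^esub> \<in> S)"

definition lie_ideal :: "'a set \<Rightarrow> ('a, 'c) lie_alg_scheme \<Rightarrow> bool" where
  "lie_ideal S L \<longleftrightarrow> submodule class_ring S L \<and> (\<forall>x\<in>carrier L. \<forall>y\<in>S. \<lbrace>x, y\<rbrace>\<^bsub>L\<^esub> \<in> S)"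

definition lie_subalgebra_generated ::
    "('a, 'c) lie_alg_scheme \<Rightarrow> 'a set \<Rightarrow> ('a, 'c) lie_alg_scheme" where
  "lie_subalgebra_generated L X = L\<lparr>carrier := \<Inter>{S. lie_subalgebra S L \<and> X \<subseteq> S}\<rparr>"

definition lie_ideal_generated ::
    "('a, 'c) lie_alg_scheme \<Rightarrow> 'a set \<Rightarrow> ('a, 'c) lie_alg_scheme" where
  "lie_ideal_generated L X = L\<lparr>carrier := \<Inter>{S. lie_ideal S L \<and> X \<subseteq> S}\<rparr>"

locale lie_module = G: lie_algebra G + M: vectorspace "class_ring :: complex ring" M
  for G :: "('g, 'c) lie_alg_scheme" (structure)
    and M :: "(complex, 'm, 'd) module_scheme" (structure)
    and act :: "'g \<Rightarrow> 'm \<Rightarrow> 'm" +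
  assumes act_linear: "x \<in> carrier G \<Longrightarrow> act x \<in> LinearCombinations.module_hom class_ring M M"
    and act_add: "x \<in> carrier G \<Longrightarrow> y \<in> carrier G \<Longrightarrow> m \<in> carrier M \<Longrightarrow>
      act (x \<oplus>\<^bsub>G\<^esub> y) m = act x m \<oplus>\<^bsub>M\<^esub> act y m"
    and act_smult: "x \<in> carrier G \<Longrightarrow> m \<in> carrier M \<Longrightarrow> act (a \<odot>\<^bsub>G\<^esub> x) m = a \<odot>\<^bsub>M\<^esub> act x m"
    and act_bracket: "x \<in> carrier G \<Longrightarrow> y \<in> carrier G \<Longrightarrow> m \<in> carrier M \<Longrightarrow>
      act (\<lbrace>x, y\<rbrace>\<^bsub>G\<^esub>) m = act x (act y m) \<ominus>\<^bsub>M\<^esub> act y (act x m)"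

definition lie_module_iso :: "('g, 'c) lie_alg_scheme \<Rightarrow>
    (complex, 'm, 'd) module_scheme \<Rightarrow> ('g \<Rightarrow> 'm \<Rightarrow> 'm) \<Rightarrow>
    (complex, 'n, 'e) module_scheme \<Rightarrow> ('g \<Rightarrow> 'n \<Rightarrow> 'n) \<Rightarrow> ('m \<Rightarrow> 'n) set" where
  "lie_module_iso G M act N act' = {h \<in> LinearCombinations.module_hom class_ring M N.
     lie_module G M act \<and> lie_module G N act' \<and> bij_betw h (carrier M) (carrier N) \<and>
     (\<forall>x\<in>carrier G. \<forall>m\<in>carrier M. h (act x m) = act' x (h m))}"

locale lie_derivation_action = lie_module G H d + H: lie_algebra H
  for G :: "('g, 'c) lie_alg_scheme" (structure)
    and H :: "('h, 'd) lie_alg_scheme" (structure)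
    and d :: "'g \<Rightarrow> 'h \<Rightarrow> 'h" +
  assumes act_derivation: "x \<in> carrier G \<Longrightarrow> a \<in> carrier H \<Longrightarrow> b \<in> carrier H \<Longrightarrow>
      d x (\<lbrace>a, b\<rbrace>\<^bsub>H\<^esub>) = \<lbrace>d x a, b\<rbrace>\<^bsub>H\<^esub> \<oplus>\<^bsub>H\<^esub> \<lbrace>a, d x b\<rbrace>\<^bsub>H\<^esub>"

definition lie_semidirect :: "('g, 'c) lie_alg_scheme \<Rightarrow> ('h, 'd) lie_alg_scheme \<Rightarrow>
    ('g \<Rightarrow> 'h \<Rightarrow> 'h) \<Rightarrow> ('g \<times> 'h) lie_alg" where
  "lie_semidirect G H d = \<lparr>
     carrier = carrier G \<times> carrier H,
     mult = undefined, one = undefined,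
     zero = (\<zero>\<^bsub>G\<^esub>, \<zero>\<^bsub>H\<^esub>),
     add = (\<lambda>(x, a) (y, b). (x \<oplus>\<^bsub>G\<^esub> y, a \<oplus>\<^bsub>H\<^esub> b)),
     smult = (\<lambda>r (x, a). (r \<odot>\<^bsub>G\<^esub> x, r \<odot>\<^bsub>H\<^esub> a)),
     lie_bracket = (\<lambda>(x, a) (y, b).
       (\<lbrace>x, y\<rbrace>\<^bsub>G\<^esub>, \<lbrace>a, b\<rbrace>\<^bsub>H\<^esub> \<oplus>\<^bsub>H\<^esub> d x b \<ominus>\<^bsub>H\<^esub> d y a))\<rparr>"


section \<open>Lie algebras given by generators and relations\<close>

text \<open>
  The Lie algebra presented by a set of generators \<open>I\<close> and a set of relations \<open>R\<close> is the set
  of all formal Lie expressions in \<open>I\<close> modulo the least congruence that contains \<open>R\<close> and all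
  instances of the axioms of a complex Lie algebra. A relation \<open>s = t\<close> is the pair \<open>(s, t)\<close>.
\<close>

datatype (gens: 'g) lie_term =
  Gen 'g
| Zero
| Add "'g lie_term" "'g lie_term"
| Scale complex "'g lie_term"
| Br "'g lie_term" "'g lie_term"

definition lie_terms :: "'g set \<Rightarrow> 'g lie_term set" where
  "lie_terms I = {t. gens t \<subseteq> I}"

inductive lie_eq :: "'g set \<Rightarrow> ('g lie_term \<times> 'g lie_term) set \<Rightarrow>
    'g lie_term \<Rightarrow> 'g lie_term \<Rightarrow> bool"
  for I :: "'g set" and R :: "('g lie_term \<times> 'g lie_term) set" where
  relation: "(s, t) \<in> R \<Longrightarrow> s \<in> lie_terms I \<Longrightarrow> t \<in> lie_terms I \<Longrightarrow> lie_eq I R s t"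
| refl: "t \<in> lie_terms I \<Longrightarrow> lie_eq I R t t"
| sym: "lie_eq I R s t \<Longrightarrow> lie_eq I R t s"
| trans: "lie_eq I R s t \<Longrightarrow> lie_eq I R t u \<Longrightarrow> lie_eq I R s u"
| Add_cong: "lie_eq I R s s' \<Longrightarrow> lie_eq I R t t' \<Longrightarrow> lie_eq I R (Add s t) (Add s' t')"
| Scale_cong: "lie_eq I R t t' \<Longrightarrow> lie_eq I R (Scale a t) (Scale a t')"
| Br_cong: "lie_eq I R s s' \<Longrightarrow> lie_eq I R t t' \<Longrightarrow> lie_eq I R (Br s t) (Br s' t')"
| Add_assoc: "s \<in> lie_terms I \<Longrightarrow> t \<in> lie_terms I \<Longrightarrow> u \<in> lie_terms I \<Longrightarrow>
    lie_eq I R (Add (Add s t) u) (Add s (Add t u))"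
| Add_commute: "s \<in> lie_terms I \<Longrightarrow> t \<in> lie_terms I \<Longrightarrow> lie_eq I R (Add s t) (Add t s)"
| Add_Zero: "t \<in> lie_terms I \<Longrightarrow> lie_eq I R (Add Zero t) t"
| Add_minus: "t \<in> lie_terms I \<Longrightarrow> lie_eq I R (Add (Scale (-1) t) t) Zero"
| Scale_add_left: "t \<in> lie_terms I \<Longrightarrow>
    lie_eq I R (Scale (a + b) t) (Add (Scale a t) (Scale b t))"
| Scale_add_right: "s \<in> lie_terms I \<Longrightarrow> t \<in> lie_terms I \<Longrightarrow>
    lie_eq I R (Scale a (Add s t)) (Add (Scale a s) (Scale a t))"
| Scale_Scale: "t \<in> lie_terms I \<Longrightarrow> lie_eq I R (Scale (a * b) t) (Scale a (Scale b t))"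
| Scale_one: "t \<in> lie_terms I \<Longrightarrow> lie_eq I R (Scale 1 t) t"
| Br_Add_left: "s \<in> lie_terms I \<Longrightarrow> t \<in> lie_terms I \<Longrightarrow> u \<in> lie_terms I \<Longrightarrow>
    lie_eq I R (Br (Add s t) u) (Add (Br s u) (Br t u))"
| Br_Add_right: "s \<in> lie_terms I \<Longrightarrow> t \<in> lie_terms I \<Longrightarrow> u \<in> lie_terms I \<Longrightarrow>
    lie_eq I R (Br s (Add t u)) (Add (Br s t) (Br s u))"
| Br_Scale_left: "s \<in> lie_terms I \<Longrightarrow> t \<in> lie_terms I \<Longrightarrow>
    lie_eq I R (Br (Scale a s) t) (Scale a (Br s t))"
| Br_Scale_right: "s \<in> lie_terms I \<Longrightarrow> t \<in> lie_terms I \<Longrightarrow>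
    lie_eq I R (Br s (Scale a t)) (Scale a (Br s t))"
| Br_self: "t \<in> lie_terms I \<Longrightarrow> lie_eq I R (Br t t) Zero"
| Jacobi: "s \<in> lie_terms I \<Longrightarrow> t \<in> lie_terms I \<Longrightarrow> u \<in> lie_terms I \<Longrightarrow>
    lie_eq I R (Add (Add (Br s (Br t u)) (Br t (Br u s))) (Br u (Br s t))) Zero"

definition lie_class ::
    "'g set \<Rightarrow> ('g lie_term \<times> 'g lie_term) set \<Rightarrow> 'g lie_term \<Rightarrow> 'g lie_term set" where
  "lie_class I R t = {s. lie_eq I R t s}"

definition lie_presented ::
    "'g set \<Rightarrow> ('g lie_term \<times> 'g lie_term) set \<Rightarrow> 'g lie_term set lie_alg" where
  "lie_presented I R = \<lparr>
     carrier = lie_class I R ` lie_terms I,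
     mult = undefined, one = undefined,
     zero = lie_class I R Zero,
     add = (\<lambda>X Y. \<Union>s\<in>X. \<Union>t\<in>Y. lie_class I R (Add s t)),
     smult = (\<lambda>a X. \<Union>t\<in>X. lie_class I R (Scale a t)),
     lie_bracket = (\<lambda>X Y. \<Union>s\<in>X. \<Union>t\<in>Y. lie_class I R (Br s t))\<rparr>"

primrec lie_eval :: "('a, 'c) lie_alg_scheme \<Rightarrow> ('g \<Rightarrow> 'a) \<Rightarrow> 'g lie_term \<Rightarrow> 'a" where
  "lie_eval M g (Gen i) = g i"
| "lie_eval M g Zero = \<zero>\<^bsub>M\<^esub>"
| "lie_eval M g (Add s t) = lie_eval M g s \<oplus>\<^bsub>M\<^esub> lie_eval M g t"
| "lie_eval M g (Scale a t) = a \<odot>\<^bsub>M\<^esub> lie_eval M g t"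
| "lie_eval M g (Br s t) = \<lbrace>lie_eval M g s, lie_eval M g t\<rbrace>\<^bsub>M\<^esub>"

text \<open>
  The homomorphism from a presented Lie algebra to \<open>M\<close> that sends the generator \<open>i\<close> to \<open>g i\<close>.
  It is well defined if the elements \<open>g i\<close> satisfy the relations, see \<open>lie_lift_hom\<close> below.
\<close>

definition lie_lift :: "('a, 'c) lie_alg_scheme \<Rightarrow> ('g \<Rightarrow> 'a) \<Rightarrow> 'g lie_term set \<Rightarrow> 'a" where
  "lie_lift M g X = the_elem (lie_eval M g ` X)"

lemma lie_terms_simps [simp]:
  "Gen i \<in> lie_terms I \<longleftrightarrow> i \<in> I"
  "Zero \<in> lie_terms I"
  "Add s t \<in> lie_terms I \<longleftrightarrow> s \<in> lie_terms I \<and> t \<in> lie_terms I"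
  "Scale a t \<in> lie_terms I \<longleftrightarrow> t \<in> lie_terms I"
  "Br s t \<in> lie_terms I \<longleftrightarrow> s \<in> lie_terms I \<and> t \<in> lie_terms I"
  by (auto simp: lie_terms_def)

lemma lie_eq_in_terms: "lie_eq I R s t \<Longrightarrow> s \<in> lie_terms I \<and> t \<in> lie_terms I"
  by (induction rule: lie_eq.induct) auto

lemma lie_class_eq_iff:
  "s \<in> lie_terms I \<Longrightarrow> lie_class I R s = lie_class I R t \<longleftrightarrow> lie_eq I R s t"
  unfolding lie_class_def using lie_eq.refl lie_eq.sym lie_eq.trans by blast

lemma lie_class_eqI: "lie_eq I R s t \<Longrightarrow> lie_class I R s = lie_class I R t"
  using lie_class_eq_iff lie_eq_in_terms by blast

lemma lie_presented_simps:
  "carrier (lie_presented I R) = lie_class I R ` lie_terms I"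
  "\<zero>\<^bsub>lie_presented I R\<^esub> = lie_class I R Zero"
  by (simp_all add: lie_presented_def)

lemma lie_presented_add: "s \<in> lie_terms I \<Longrightarrow> t \<in> lie_terms I \<Longrightarrow>
    lie_class I R s \<oplus>\<^bsub>lie_presented I R\<^esub> lie_class I R t = lie_class I R (Add s t)"
  unfolding lie_presented_def lie_class_def
  by simp (blast intro: lie_eq.refl lie_eq.sym lie_eq.trans lie_eq.Add_cong)

lemma lie_presented_smult: "t \<in> lie_terms I \<Longrightarrow>
    a \<odot>\<^bsub>lie_presented I R\<^esub> lie_class I R t = lie_class I R (Scale a t)"
  unfolding lie_presented_def lie_class_def
  by simp (blast intro: lie_eq.refl lie_eq.sym lie_eq.trans lie_eq.Scale_cong)

lemma lie_presented_bracket: "s \<in> lie_terms I \<Longrightarrow> t \<in> lie_terms I \<Longrightarrow>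
    \<lbrace>lie_class I R s, lie_class I R t\<rbrace>\<^bsub>lie_presented I R\<^esub> = lie_class I R (Br s t)"
  unfolding lie_presented_def lie_class_def
  by simp (blast intro: lie_eq.refl lie_eq.sym lie_eq.trans lie_eq.Br_cong)

lemmas lie_presented_ops =
  lie_presented_simps lie_presented_add lie_presented_smult lie_presented_bracket

lemmas lie_class_axioms =
  lie_eq.Add_Zero [THEN lie_class_eqI] lie_eq.Add_minus [THEN lie_class_eqI]
  lie_eq.Scale_add_left [THEN lie_class_eqI] lie_eq.Scale_add_right [THEN lie_class_eqI]
  lie_eq.Scale_Scale [THEN lie_class_eqI] lie_eq.Scale_one [THEN lie_class_eqI]
  lie_eq.Br_Add_left [THEN lie_class_eqI] lie_eq.Br_Add_right [THEN lie_class_eqI]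
  lie_eq.Br_Scale_left [THEN lie_class_eqI] lie_eq.Br_Scale_right [THEN lie_class_eqI]
  lie_eq.Br_self [THEN lie_class_eqI] lie_eq.Jacobi [THEN lie_class_eqI]

lemma vectorspace_class_ringI:
  fixes M :: "('a :: field, 'm, 'd) module_scheme"
  shows "module class_ring M \<Longrightarrow> vectorspace class_ring M"
  using class_field by (simp add: class_field_def vectorspace_def)

lemma lie_algebra_presented: "lie_algebra (lie_presented I R)"
proof -
  let ?L = "lie_presented I R"
  have ag: "abelian_group ?L"
  proof (rule abelian_groupI)
    fix x assume "x \<in> carrier ?L"
    then obtain t where t: "t \<in> lie_terms I" "x = lie_class I R t"
      by (auto simp: lie_presented_ops)
    then show "\<exists>y\<in>carrier ?L. y \<oplus>\<^bsub>?L\<^esub> x = \<zero>\<^bsub>?L\<^esub>"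
      by (intro bexI[of _ "lie_class I R (Scale (-1) t)"])
        (simp_all add: lie_presented_ops lie_class_axioms)
  next
    fix x y assume "x \<in> carrier ?L" "y \<in> carrier ?L"
    then show "x \<oplus>\<^bsub>?L\<^esub> y = y \<oplus>\<^bsub>?L\<^esub> x"
      by (auto simp: lie_presented_ops lie_eq.Add_commute [THEN lie_class_eqI])
  qed (auto simp: lie_presented_ops lie_class_axioms lie_eq.Add_assoc [THEN lie_class_eqI])
  have "module class_ring ?L"
    by (rule moduleI)
      (use ag in \<open>auto simp: lie_presented_ops lie_class_axioms class_cring.is_cring\<close>)
  then have "vectorspace class_ring ?L"
    by (rule vectorspace_class_ringI)
  then show ?thesis
    unfolding lie_algebra_def
    by (auto simp: lie_algebra_axioms_def lie_presented_ops lie_class_axioms)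
qed

lemma (in lie_algebra) lie_eval_closed:
  "g ` I \<subseteq> carrier L \<Longrightarrow> t \<in> lie_terms I \<Longrightarrow> lie_eval L g t \<in> carrier L"
  by (induction t) (auto simp: bracket_closed)

lemma (in lie_algebra) lie_eval_cong:
  assumes g: "g ` I \<subseteq> carrier L"
    and R: "\<And>s t. (s, t) \<in> R \<Longrightarrow> lie_eval L g s = lie_eval L g t"
    and "lie_eq I R s t"
  shows "lie_eval L g s = lie_eval L g t"
  using assms(3)
proof (induction rule: lie_eq.induct)
  case (Add_assoc s t u)
  with lie_eval_closed[OF g] show ?case by (simp add: M.a_assoc)
next
  case (Add_commute s t)
  with lie_eval_closed[OF g] show ?case by (simp add: M.a_comm)
next
  case (Add_minus t)
  with lie_eval_closed[OF g] show ?case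
    using smult_l_distr[of "-1" 1 "lie_eval L g t"] smult_one[of "lie_eval L g t"]
      smult_l_null[of "lie_eval L g t"] by simp
next
  case (Scale_add_left t a b)
  with lie_eval_closed[OF g] show ?case
    using smult_l_distr[of a b "lie_eval L g t"] by simp
next
  case (Scale_Scale t a b)
  with lie_eval_closed[OF g] show ?case
    using smult_assoc1[of a b "lie_eval L g t"] by simp
next
  case (Scale_one t)
  with lie_eval_closed[OF g] show ?case
    using smult_one[of "lie_eval L g t"] by simp
qed (use lie_eval_closed[OF g] R in \<open>auto simp: smult_r_distr bracket_add_left
  bracket_add_right bracket_smult_left bracket_smult_right bracket_self jacobi\<close>)

context lie_algebra
begin

context
  fixes g :: "'g \<Rightarrow> 'a" and I R
  assumes g: "g ` I \<subseteq> carrier L"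
    and R: "\<And>s t. (s, t) \<in> R \<Longrightarrow> lie_eval L g s = lie_eval L g t"
begin

lemma lie_lift_class:
  assumes "t \<in> lie_terms I"
  shows "lie_lift L g (lie_class I R t) = lie_eval L g t"
proof -
  have "lie_eval L g ` lie_class I R t = {lie_eval L g t}"
    using assms lie_eval_cong[OF g R] by (force simp: lie_class_def intro: lie_eq.refl)
  then show ?thesis by (simp add: lie_lift_def)
qed

lemma lie_lift_hom: "lie_lift L g \<in> lie_hom (lie_presented I R) L"
  by (auto simp: lie_hom_def LinearCombinations.module_hom_def lie_presented_ops lie_lift_class
      lie_eval_closed[OF g])

end

end


section \<open>The Lie algebras \<open>sl\<^sub>m\<^sup>(\<^sup>c\<^sup>)\<close> and \<open>sp\<^sub>2\<^sub>n\<^sup>(\<^sup>b\<^sup>)\<close>\<close>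

text \<open>
  Parameter tuples \<open>(c\<^sub>1, c\<^sub>2, \<dots>)\<close> are functions on \<open>nat\<close>, of which only the values at the
  indices that occur in the tuple are used: \<open>1, \<dots>, m - 2\<close> for \<open>sl_alg m c\<close> and
  \<open>1, \<dots>, n - 1\<close> for \<open>sp_alg n b\<close>. In particular \<open>sl_alg n b\<close> ignores \<open>b (n - 1)\<close>.
\<close>

definition sl_relations :: "nat \<Rightarrow> (nat \<Rightarrow> complex) \<Rightarrow> (nat lie_term \<times> nat lie_term) set" where
  "sl_relations m c =
     {(Br (Gen i) (Gen j), Zero) | i j.
        i \<in> {1..m-1} \<and> j \<in> {1..m-1} \<and> \<bar>int i - int j\<bar> > 1} \<union>
     {(Br (Gen i) (Br (Gen i) (Gen j)), Scale (- 2 * c (min i j)) (Gen i)) | i j.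
        i \<in> {1..m-1} \<and> j \<in> {1..m-1} \<and> \<bar>int i - int j\<bar> = 1}"

definition sl_alg :: "nat \<Rightarrow> (nat \<Rightarrow> complex) \<Rightarrow> nat lie_term set lie_alg" where
  "sl_alg m c = lie_presented {1..m-1} (sl_relations m c)"

definition sl_gen :: "nat \<Rightarrow> (nat \<Rightarrow> complex) \<Rightarrow> nat \<Rightarrow> nat lie_term set" where
  "sl_gen m c i = lie_class {1..m-1} (sl_relations m c) (Gen i)"

definition sp_relations :: "nat \<Rightarrow> (nat \<Rightarrow> complex) \<Rightarrow> (nat lie_term \<times> nat lie_term) set" where
  "sp_relations n b =
     {(Br (Gen i) (Gen j), Zero) | i j.
        i \<in> {1..n} \<and> j \<in> {1..n} \<and> \<bar>int i - int j\<bar> > 1} \<union>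
     {(Br (Gen i) (Br (Gen i) (Gen j)), Scale (- 2 * b (min i j)) (Gen i)) | i j.
        i \<in> {1..n-1} \<and> j \<in> {1..n-1} \<and> \<bar>int i - int j\<bar> = 1} \<union>
     {(Br (Gen n) (Br (Gen n) (Gen (n-1))), Scale (- 2 * b (n-1)) (Gen n)),
      (Br (Gen (n-1)) (Br (Gen (n-1)) (Br (Gen (n-1)) (Gen n))), Zero)}"

definition sp_alg :: "nat \<Rightarrow> (nat \<Rightarrow> complex) \<Rightarrow> nat lie_term set lie_alg" where
  "sp_alg n b = lie_presented {1..n} (sp_relations n b)"

definition sp_gen :: "nat \<Rightarrow> (nat \<Rightarrow> complex) \<Rightarrow> nat \<Rightarrow> nat lie_term set" where
  "sp_gen n b i = lie_class {1..n} (sp_relations n b) (Gen i)"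


section \<open>The standard module and its symmetric square\<close>

definition sl_mat :: "nat \<Rightarrow> complex mat lie_alg" where
  "sl_mat n = \<lparr>
     carrier = {A \<in> carrier_mat n n. (\<Sum>i<n. A $$ (i, i)) = 0},
     mult = undefined, one = undefined,
     zero = 0\<^sub>m n n, add = (+), smult = (\<cdot>\<^sub>m),
     lie_bracket = (\<lambda>A B. A * B - B * A)\<rparr>"

text \<open>
  The matrix unit \<open>E\<^sub>i\<^sub>j\<close>, with indices \<open>i, j\<close> starting from 1; matrix entries in
  \<open>Jordan_Normal_Form\<close> are indexed from 0.
\<close>

definition mat_unit :: "nat \<Rightarrow> nat \<Rightarrow> nat \<Rightarrow> complex mat" where
  "mat_unit n i j = mat n n (\<lambda>(r, s). if r + 1 = i \<and> s + 1 = j then 1 else 0)"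

text \<open>
  The matrix \<open>e\<^sub>i + c\<^sub>i\<^sub>-\<^sub>1 f\<^sub>i\<^sub>-\<^sub>1\<close>. For \<open>i = 1\<close> the second summand vanishes whatever the value
  of \<open>c 0\<close>, since \<open>mat_unit n 1 0 = 0\<close>.
\<close>

definition sl_gen_mat :: "nat \<Rightarrow> (nat \<Rightarrow> complex) \<Rightarrow> nat \<Rightarrow> complex mat" where
  "sl_gen_mat n c i = mat_unit n i (i + 1) + c (i - 1) \<cdot>\<^sub>m mat_unit n i (i - 1)"

text \<open>
  The homomorphism \<open>sl_alg n c \<rightarrow> sl_mat n\<close>, \<open>u\<^sub>i \<mapsto> e\<^sub>i + c\<^sub>i\<^sub>-\<^sub>1 f\<^sub>i\<^sub>-\<^sub>1\<close>, by which \<open>sl_alg n c\<close>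
  is regarded as a subalgebra of \<open>sl_mat n\<close>.
\<close>

definition sl_incl :: "nat \<Rightarrow> (nat \<Rightarrow> complex) \<Rightarrow> nat lie_term set \<Rightarrow> complex mat" where
  "sl_incl n c = lie_lift (sl_mat n) (sl_gen_mat n c)"

text \<open>The standard \<open>sl\<^sub>n\<close>-module is \<^term>\<open>module_vec TYPE(complex) n\<close> with action \<open>(*\<^sub>v)\<close>.\<close>

definition std_act :: "nat \<Rightarrow> (nat \<Rightarrow> complex) \<Rightarrow> nat lie_term set \<Rightarrow> complex vec \<Rightarrow> complex vec" where
  "std_act n c x v = sl_incl n c x *\<^sub>v v"

text \<open>
  The tensor square of \<open>V = \<complex>\<^sup>n\<close> is realised on \<open>n \<times> n\<close> matrices by
  \<open>v \<otimes> w = (v\<^sub>i w\<^sub>j)\<^sub>i\<^sub>j\<close>, and \<open>S\<^sup>2V\<close> is its submodule of symmetric tensors. As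
  \<open>x (v \<otimes> w) = x v \<otimes> w + v \<otimes> x w\<close>, an operator with matrix \<open>A\<close> acts on a tensor
  \<open>T\<close> by \<open>A T + T A\<^sup>T\<close>; see \<open>tensor_act_tensor\<close>.
\<close>

definition tensor :: "nat \<Rightarrow> complex vec \<Rightarrow> complex vec \<Rightarrow> complex mat" where
  "tensor n v w = mat n n (\<lambda>(i, j). v $ i * w $ j)"

definition tensor_act :: "complex mat \<Rightarrow> complex mat \<Rightarrow> complex mat" where
  "tensor_act A T = A * T + T * transpose_mat A"

definition sym2 :: "nat \<Rightarrow> (complex, complex mat) module" where
  "sym2 n = (module_mat TYPE(complex) n n)
     \<lparr>carrier := {T \<in> carrier_mat n n. transpose_mat T = T}\<rparr>"

definition sym2_act ::
    "nat \<Rightarrow> (nat \<Rightarrow> complex) \<Rightarrow> nat lie_term set \<Rightarrow> complex mat \<Rightarrow> complex mat" where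
  "sym2_act n c x T = tensor_act (sl_incl n c x) T"

lemma tensor_act_tensor:
  assumes "A \<in> carrier_mat n n" "v \<in> carrier_vec n" "w \<in> carrier_vec n"
  shows "tensor_act A (tensor n v w) = tensor n (A *\<^sub>v v) w + tensor n v (A *\<^sub>v w)"
  using assms
  by (intro eq_matI) (auto simp: tensor_act_def tensor_def scalar_prod_def sum_distrib_left
      sum_distrib_right ac_simps intro!: sum.cong)

lemma tensor_act_add_left:
  "A \<in> carrier_mat n n \<Longrightarrow> B \<in> carrier_mat n n \<Longrightarrow> T \<in> carrier_mat n n \<Longrightarrow>
    tensor_act (A + B) T = tensor_act A T + tensor_act B T"
  by (auto simp: tensor_act_def scalar_prod_def sum.distrib algebra_simps intro!: eq_matI)

lemma tensor_act_add_right: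
  "A \<in> carrier_mat n n \<Longrightarrow> S \<in> carrier_mat n n \<Longrightarrow> T \<in> carrier_mat n n \<Longrightarrow>
    tensor_act A (S + T) = tensor_act A S + tensor_act A T"
  by (auto simp: tensor_act_def scalar_prod_def sum.distrib algebra_simps intro!: eq_matI)

lemma tensor_act_smult:
  "A \<in> carrier_mat n n \<Longrightarrow> T \<in> carrier_mat n n \<Longrightarrow>
    tensor_act (a \<cdot>\<^sub>m A) T = a \<cdot>\<^sub>m tensor_act A T"
  "A \<in> carrier_mat n n \<Longrightarrow> T \<in> carrier_mat n n \<Longrightarrow>
    tensor_act A (a \<cdot>\<^sub>m T) = a \<cdot>\<^sub>m tensor_act A T"
  by (auto simp: tensor_act_def scalar_prod_def sum_distrib_left algebra_simps intro!: eq_matI)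

lemma trace_comm:
  fixes A B :: "complex mat"
  assumes "A \<in> carrier_mat n n" "B \<in> carrier_mat n n"
  shows "(\<Sum>i<n. (A * B) $$ (i, i)) = (\<Sum>i<n. (B * A) $$ (i, i))"
proof -
  have "(\<Sum>i<n. (A * B) $$ (i, i)) = (\<Sum>i<n. \<Sum>k<n. A $$ (i, k) * B $$ (k, i))"
    using assms by (auto simp: scalar_prod_def lessThan_atLeast0 intro!: sum.cong)
  also have "\<dots> = (\<Sum>k<n. \<Sum>i<n. B $$ (k, i) * A $$ (i, k))"
    by (subst sum.swap) (simp add: ac_simps)
  also have "\<dots> = (\<Sum>i<n. (B * A) $$ (i, i))"
    using assms by (auto simp: scalar_prod_def lessThan_atLeast0 intro!: sum.cong)
  finally show ?thesis .
qed

lemma lie_algebra_sl_mat: "lie_algebra (sl_mat n)"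
proof -
  let ?L = "sl_mat n"
  have ag: "abelian_group ?L"
  proof (rule abelian_groupI)
    fix A assume "A \<in> carrier ?L"
    then show "\<exists>B\<in>carrier ?L. B \<oplus>\<^bsub>?L\<^esub> A = \<zero>\<^bsub>?L\<^esub>"
      by (intro bexI[of _ "- A"]) (auto simp: sl_mat_def sum_negf)
  qed (auto simp: sl_mat_def sum.distrib comm_add_mat)
  have "module class_ring ?L"
    by (rule moduleI)
      (use ag in \<open>auto simp: sl_mat_def class_cring.is_cring sum_distrib_left[symmetric]
        add_smult_distrib_right_mat add_smult_distrib_left_mat\<close>)
  then have vs: "vectorspace class_ring ?L"
    by (rule vectorspace_class_ringI)
  have jacobi: "A * (B * C - C * B) - (B * C - C * B) * A + (B * (C * A - A * C) - (C * A - A * C) * B)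
      + (C * (A * B - B * A) - (A * B - B * A) * C) = 0\<^sub>m n n"
    if A: "A \<in> carrier_mat n n" and B: "B \<in> carrier_mat n n" and C: "C \<in> carrier_mat n n"
    for A B C :: "complex mat"
  proof -
    have 1: "X * (Y * Z - Z * Y) - (Y * Z - Z * Y) * X = X * Y * Z - X * Z * Y - (Y * Z * X - Z * Y * X)"
      if X: "X \<in> carrier_mat n n" and Y: "Y \<in> carrier_mat n n" and Z: "Z \<in> carrier_mat n n"
      for X Y Z :: "complex mat"
    proof -
      have "Y * Z \<in> carrier_mat n n" "Z * Y \<in> carrier_mat n n"
        using Y Z by auto
      with X Y Z show ?thesis
        by (simp add: mult_minus_distrib_mat [of X n n _ n] minus_mult_distrib_mat [of _ n n _ X n]
            assoc_mult_mat [of X n n _ n _ n])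
    qed
    show ?thesis
      unfolding 1 [OF A B C] 1 [OF B C A] 1 [OF C A B]
      by (rule eq_matI) (use A B C in \<open>simp_all del: index_mult_mat(1)\<close>)
  qed
  show ?thesis
    unfolding lie_algebra_def
  proof (intro conjI vs, unfold_locales)
    fix A B C assume "A \<in> carrier ?L" and "B \<in> carrier ?L" and "C \<in> carrier ?L"
    then show "\<lbrace>A, \<lbrace>B, C\<rbrace>\<^bsub>?L\<^esub>\<rbrace>\<^bsub>?L\<^esub> \<oplus>\<^bsub>?L\<^esub> \<lbrace>B, \<lbrace>C, A\<rbrace>\<^bsub>?L\<^esub>\<rbrace>\<^bsub>?L\<^esub> \<oplus>\<^bsub>?L\<^esub> \<lbrace>C, \<lbrace>A, B\<rbrace>\<^bsub>?L\<^esub>\<rbrace>\<^bsub>?L\<^esub> = \<zero>\<^bsub>?L\<^esub>"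
      using jacobi by (simp add: sl_mat_def)
  qed (auto simp: sl_mat_def sum_subtractf trace_comm[of _ n]
     add_mult_distrib_mat[of _ n n] mult_add_distrib_mat[of _ n n] mult_smult_distrib[of _ n n] 
     mult_smult_assoc_mat[of _ n n] right_diff_distrib
     simp del: index_mult_mat(1) intro!: eq_matI)
qed

text \<open>
  With \<open>row_mat n c i j\<close> the matrix whose \<open>i\<close>-th row is the \<open>j\<close>-th row of \<open>sl_gen_mat n c j\<close>,
  the following lemmas reduce the relations of \<open>sl_alg\<close> to products of such matrices.
\<close>

definition gen_row :: "(nat \<Rightarrow> complex) \<Rightarrow> nat \<Rightarrow> nat \<Rightarrow> complex" where
  "gen_row c j k = (if k = j + 1 then 1 else if k + 1 = j then c k else 0)"

definition row_mat :: "nat \<Rightarrow> (nat \<Rightarrow> complex) \<Rightarrow> nat \<Rightarrow> nat \<Rightarrow> complex mat" where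
  "row_mat n c i j = mat n n (\<lambda>(r, s). if r + 1 = i then gen_row c j (s + 1) else 0)"

lemma row_mat_carrier [simp]:
  "row_mat n c i j \<in> carrier_mat n n"
  "dim_row (row_mat n c i j) = n" "dim_col (row_mat n c i j) = n"
  by (simp_all add: row_mat_def)

lemma sl_gen_mat_row_mat: "sl_gen_mat n c i = row_mat n c i i"
  by (rule eq_matI) (auto simp: sl_gen_mat_def mat_unit_def row_mat_def gen_row_def)

lemma row_mat_mult:
  assumes "k \<in> {1..n}"
  shows "row_mat n c i j * row_mat n c k l = gen_row c j k \<cdot>\<^sub>m row_mat n c i l"
proof (rule eq_matI)
  fix r s assume "r < dim_row (gen_row c j k \<cdot>\<^sub>m row_mat n c i l)"
    "s < dim_col (gen_row c j k \<cdot>\<^sub>m row_mat n c i l)"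
  then have rs: "r < n" "s < n" by auto
  obtain k' where k: "k = Suc k'" "k' < n" using assms by (cases k) auto
  have "(row_mat n c i j * row_mat n c k l) $$ (r, s) =
      (\<Sum>t<n. if t = k' then (if r + 1 = i then gen_row c j k * gen_row c l (s + 1) else 0) else 0)"
    using rs k
    by (simp add: row_mat_def scalar_prod_def lessThan_atLeast0 del: sum.delta sum.delta')
      (rule impI, rule sum.cong, auto)
  also have "\<dots> = (if r + 1 = i then gen_row c j k * gen_row c l (s + 1) else 0)"
    using k by simp
  also have "\<dots> = (gen_row c j k \<cdot>\<^sub>m row_mat n c i l) $$ (r, s)"
    using rs by (simp add: row_mat_def)
  finally show "(row_mat n c i j * row_mat n c k l) $$ (r, s) = (gen_row c j k \<cdot>\<^sub>m row_mat n c i l) $$ (r, s)" .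
qed (auto simp: row_mat_def)

lemma sl_gen_mat_relations:
  assumes "(s, t) \<in> sl_relations n c"
  shows "lie_eval (sl_mat n) (sl_gen_mat n c) s = lie_eval (sl_mat n) (sl_gen_mat n c) t"
proof -
  consider (far) i j where "s = Br (Gen i) (Gen j)" "t = Zero" "i \<in> {1..n}" "j \<in> {1..n}"
      "\<bar>int i - int j\<bar> > 1"
    | (near) i j where "s = Br (Gen i) (Br (Gen i) (Gen j))"
        "t = Scale (- 2 * c (min i j)) (Gen i)" "i \<in> {1..n}" "j \<in> {1..n}" "\<bar>int i - int j\<bar> = 1"
    using assms unfolding sl_relations_def by auto
  then show ?thesis
  proof cases
    case far
    then have "gen_row c i j = 0" "gen_row c j i = 0"
      by (auto simp: gen_row_def)
    with far show ?thesis
      by (auto simp: sl_mat_def sl_gen_mat_row_mat row_mat_mult intro!: eq_matI)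
  next
    case near
    have 0: "gen_row c i i = 0" by (simp add: gen_row_def)
    have 1: "gen_row c i j * gen_row c j i = c (min i j)"
      using near by (auto simp: gen_row_def min_def)
    have "lie_eval (sl_mat n) (sl_gen_mat n c) s =
      - (2 * (gen_row c i j * gen_row c j i)) \<cdot>\<^sub>m row_mat n c i i"
      using near 0
      by (simp add: sl_mat_def sl_gen_mat_row_mat row_mat_mult
        mult_minus_distrib_mat [of _ n n _ n] minus_mult_distrib_mat [of _ n n _ _ n]
        mult_smult_distrib [of _ n n _ n] mult_smult_assoc_mat [of _ n n _ n])
       (auto intro!: eq_matI)
    then show ?thesis
      using near 1 by (simp add: sl_mat_def sl_gen_mat_row_mat)
  qed
qed

lemma sl_gen_mat_closed: "sl_gen_mat n c ` {1..n-1} \<subseteq> carrier (sl_mat n)"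
  by (auto simp: sl_mat_def sl_gen_mat_row_mat row_mat_def gen_row_def intro!: sum.neutral)

lemma sl_incl_hom: "sl_incl n c \<in> lie_hom (sl_alg n c) (sl_mat n)"
  unfolding sl_incl_def sl_alg_def
  by (rule lie_algebra.lie_lift_hom [OF lie_algebra_sl_mat sl_gen_mat_closed sl_gen_mat_relations])

lemma sl_incl_gen: "i \<in> {1..n-1} \<Longrightarrow> sl_incl n c (sl_gen n c i) = sl_gen_mat n c i"
  unfolding sl_incl_def sl_gen_def
  using lie_algebra.lie_lift_class
    [OF lie_algebra_sl_mat sl_gen_mat_closed sl_gen_mat_relations, where t = "Gen i"] by simp

lemma sl_incl_carrier: "x \<in> carrier (sl_alg n c) \<Longrightarrow> sl_incl n c x \<in> carrier_mat n n"
  using sl_incl_hom [of n c] by (auto simp: lie_hom_def LinearCombinations.module_hom_def sl_mat_def)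

lemma sym2_act_tensor:
  assumes "x \<in> carrier (sl_alg n c)" "v \<in> carrier_vec n" "w \<in> carrier_vec n"
  shows "sym2_act n c x (tensor n v w + tensor n w v) =
    (tensor n (std_act n c x v) w + tensor n w (std_act n c x v)) +
    (tensor n v (std_act n c x w) + tensor n (std_act n c x w) v)"
proof -
  have [simp]: "sl_incl n c x \<in> carrier_mat n n"
    using assms(1) by (rule sl_incl_carrier)
  have [simp]: "tensor n u u' \<in> carrier_mat n n" for u u'
    by (simp add: tensor_def)
  have "sym2_act n c x (tensor n v w + tensor n w v) =
      tensor n (std_act n c x v) w + tensor n v (std_act n c x w) +
      (tensor n (std_act n c x w) v + tensor n w (std_act n c x v))"
    using assms unfolding sym2_act_def std_act_def
    by (simp add: tensor_act_add_right [of _ n] tensor_act_tensor)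
  then show ?thesis
    by (simp only:) (rule eq_matI, auto simp: tensor_def)
qed

lemma transpose_smult: "(a \<cdot>\<^sub>m A)\<^sup>T = a \<cdot>\<^sub>m A\<^sup>T"
  by (rule eq_matI) auto

lemma sym2_module: "vectorspace class_ring (sym2 n)"
proof (rule vectorspace_class_ringI, rule moduleI)
  show "abelian_group (sym2 n)"
  proof (rule abelian_groupI)
    fix T assume "T \<in> carrier (sym2 n)"
    then show "\<exists>U\<in>carrier (sym2 n). U \<oplus>\<^bsub>sym2 n\<^esub> T = \<zero>\<^bsub>sym2 n\<^esub>"
      by (intro bexI[of _ "- T"]) (auto simp: sym2_def module_mat_simps transpose_uminus)
  qed (auto simp: sym2_def module_mat_simps transpose_add comm_add_mat)
qed (auto simp: sym2_def module_mat_simps class_cring.is_cring add_smult_distrib_right_mat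
    add_smult_distrib_left_mat transpose_smult)

lemma sl_incl_ops:
  assumes "x \<in> carrier (sl_alg n c)" "y \<in> carrier (sl_alg n c)"
  shows "sl_incl n c (x \<oplus>\<^bsub>sl_alg n c\<^esub> y) = sl_incl n c x + sl_incl n c y"
    and "sl_incl n c (a \<odot>\<^bsub>sl_alg n c\<^esub> x) = a \<cdot>\<^sub>m sl_incl n c x"
    and "sl_incl n c (\<lbrace>x, y\<rbrace>\<^bsub>sl_alg n c\<^esub>) =
      sl_incl n c x * sl_incl n c y - sl_incl n c y * sl_incl n c x"
  using sl_incl_hom [of n c] assms
  by (auto simp: lie_hom_def LinearCombinations.module_hom_def sl_mat_def)

lemma a_minus_eqI:
  assumes "vectorspace K M" "z \<in> carrier M" "y \<in> carrier M" "x = z \<oplus>\<^bsub>M\<^esub> y"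
  shows "z = x \<ominus>\<^bsub>M\<^esub> y"
proof -
  interpret vectorspace K M by fact
  show ?thesis using assms(2-) by (simp add: M.minus_eq M.a_assoc M.r_neg)
qed

lemma lie_module_std: "lie_module (sl_alg n c) (module_vec TYPE(complex) n) (std_act n c)"
proof -
  let ?G = "sl_alg n c" and ?M = "module_vec TYPE(complex) n"
  interpret G: lie_algebra ?G by (simp add: sl_alg_def lie_algebra_presented)
  have vs: "vectorspace class_ring ?M" by (rule vec_vs)
  show ?thesis
  proof (intro lie_module.intro lie_module_axioms.intro vs G.lie_algebra_axioms)
    fix x y m assume x: "x \<in> carrier ?G" "y \<in> carrier ?G" "m \<in> carrier ?M"
    then show "std_act n c (\<lbrace>x, y\<rbrace>\<^bsub>?G\<^esub>) m =
        std_act n c x (std_act n c y m) \<ominus>\<^bsub>?M\<^esub> std_act n c y (std_act n c x m)"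
      using sl_incl_carrier [OF x(1)] sl_incl_carrier [OF x(2)]
      by (intro a_minus_eqI [OF vs])
        (auto simp: module_vec_simps std_act_def sl_incl_ops minus_mult_distrib_mat_vec [of _ n n])
  next
    fix x assume x: "x \<in> carrier ?G"
    show "std_act n c x \<in> LinearCombinations.module_hom class_ring ?M ?M"
      using sl_incl_carrier [OF x]
      by (auto simp: LinearCombinations.module_hom_def module_vec_simps std_act_def
        mult_add_distrib_mat_vec [of _ n n] mult_mat_vec [of _ n n])
  next
    fix x m a assume x: "x \<in> carrier ?G" and "m \<in> carrier ?M"
    then show "std_act n c (a \<odot>\<^bsub>?G\<^esub> x) m = a \<odot>\<^bsub>?M\<^esub> std_act n c x m"
      using sl_incl_carrier [OF x]
      by (auto simp: module_vec_simps std_act_def sl_incl_ops intro!: eq_vecI)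
  qed (simp add: module_vec_simps std_act_def sl_incl_ops sl_incl_carrier
      add_mult_distrib_mat_vec [of _ n n])
qed

lemma tensor_act_bracket:
  assumes A: "A \<in> carrier_mat n n" and B: "B \<in> carrier_mat n n" and T: "T \<in> carrier_mat n n"
  shows "tensor_act A (tensor_act B T) =
    tensor_act (A * B - B * A) T + tensor_act B (tensor_act A T)"
proof -
  have carr: "X * Y \<in> carrier_mat n n" if "X \<in> carrier_mat n n" "Y \<in> carrier_mat n n"
    for X Y :: "complex mat"
    using that by auto
  have At: "A\<^sup>T \<in> carrier_mat n n" and Bt: "B\<^sup>T \<in> carrier_mat n n" using A B by auto
  show ?thesis
    unfolding tensor_act_def
    using A B T At Bt
    by (simp add: transpose_minus [of _ n n] transpose_mult [of _ n n _ n] carr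
        mult_add_distrib_mat [of _ n n _ n] add_mult_distrib_mat [of _ n n _ _ n]
        mult_minus_distrib_mat [of _ n n _ n] minus_mult_distrib_mat [of _ n n _ _ n]
        assoc_mult_mat [of _ n n _ n _ n])
      (rule eq_matI, auto simp del: index_mult_mat(1))
qed

lemma lie_module_sym2: "lie_module (sl_alg n c) (sym2 n) (sym2_act n c)"
proof -
  let ?G = "sl_alg n c" and ?M = "sym2 n"
  interpret G: lie_algebra ?G by (simp add: sl_alg_def lie_algebra_presented)
  have vs: "vectorspace class_ring ?M" by (rule sym2_module)
  have closed: "tensor_act A T \<in> carrier_mat n n \<and> (tensor_act A T)\<^sup>T = tensor_act A T"
    if "A \<in> carrier_mat n n" "T \<in> carrier_mat n n" "T\<^sup>T = T" for A T
    using that by (auto simp: tensor_act_def transpose_add [of _ n n] transpose_mult [of _ n n _ n]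
      comm_add_mat [of _ n n])
  note simps = sym2_def module_mat_simps sym2_act_def sl_incl_ops sl_incl_carrier closed
  show ?thesis
  proof (intro lie_module.intro lie_module_axioms.intro vs G.lie_algebra_axioms)
    fix x y m assume x: "x \<in> carrier ?G" "y \<in> carrier ?G" "m \<in> carrier ?M"
    then have m: "m \<in> carrier_mat n n" "m\<^sup>T = m"
      by (simp_all add: sym2_def)
    let ?X = "sl_incl n c x" and ?Y = "sl_incl n c y"
    have X: "?X \<in> carrier_mat n n" and Y: "?Y \<in> carrier_mat n n"
      using x by (simp_all add: sl_incl_carrier)
    then have "?X * ?Y - ?Y * ?X \<in> carrier_mat n n"
      by (intro minus_carrier_mat mult_carrier_mat)
    with m X Y x show "sym2_act n c (\<lbrace>x, y\<rbrace>\<^bsub>?G\<^esub>) m =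
        sym2_act n c x (sym2_act n c y m) \<ominus>\<^bsub>?M\<^esub> sym2_act n c y (sym2_act n c x m)"
      by (intro a_minus_eqI [OF vs]) (simp_all add: simps tensor_act_bracket [OF X Y m(1)])
  next
    fix x assume "x \<in> carrier ?G"
    then show "sym2_act n c x \<in> LinearCombinations.module_hom class_ring ?M ?M"
      by (auto simp: LinearCombinations.module_hom_def simps tensor_act_add_right [of _ n] tensor_act_smult [of _ n])
  next
    fix x y m assume "x \<in> carrier ?G" "y \<in> carrier ?G" "m \<in> carrier ?M"
    then show "sym2_act n c (x \<oplus>\<^bsub>?G\<^esub> y) m = sym2_act n c x m \<oplus>\<^bsub>?M\<^esub> sym2_act n c y m"
      using sl_incl_carrier by (auto simp: simps tensor_act_add_left [of _ n])
  next
    fix x m a assume "x \<in> carrier ?G" "m \<in> carrier ?M"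
    then show "sym2_act n c (a \<odot>\<^bsub>?G\<^esub> x) m = a \<odot>\<^bsub>?M\<^esub> sym2_act n c x m"
      using sl_incl_carrier by (auto simp: simps tensor_act_smult [of _ n])
  qed
qed

end

theory Submission
  imports Defs
begin

text \<open>
  Write \<open>V = \<complex>\<^sup>n\<close> with basis \<open>e\<^sub>1, \<dots>, e\<^sub>n\<close>; then \<open>u\<^sub>i e\<^sub>j = h\<^sub>i\<^sub>j e\<^sub>i\<close> for the tridiagonal array
  \<open>h = gen_row b\<close>. By downward recursion one obtains from \<open>u\<^sub>n\<close> elements \<open>y\<^sub>j\<^sub>k\<close> of \<open>sp\<^sub>2\<^sub>n\<^sup>(\<^sup>b\<^sup>)\<close> that
  behave like \<open>e\<^sub>j e\<^sub>k \<in> S\<^sup>2V\<close>: the Serre type relations give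
  \<open>[u\<^sub>i, y\<^sub>j\<^sub>k] = h\<^sub>i\<^sub>j y\<^sub>i\<^sub>k + h\<^sub>i\<^sub>k y\<^sub>j\<^sub>i\<close>, so that the \<open>y\<^sub>j\<^sub>k\<close> span the ideal \<open>J\<close>. They are linearly
  independent, because \<open>sp\<^sub>2\<^sub>n\<^sup>(\<^sup>b\<^sup>)\<close> acts on \<open>V \<oplus> V\<^sup>*\<close> in such a way that \<open>y\<^sub>j\<^sub>k\<close> has \<open>e\<^sub>j e\<^sub>k\<close> as its
  upper right block. The bracket that \<open>J\<close> induces on \<open>S\<^sup>2V\<close> is \<open>S \<Omega> T - T \<Omega> S\<close> for the
  alternating form \<open>\<Omega>\<close> that is invariant under \<open>u\<^sub>1, \<dots>, u\<^sub>n\<^sub>-\<^sub>1\<close>. The homomorphism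
  \<open>sp\<^sub>2\<^sub>n\<^sup>(\<^sup>b\<^sup>) \<rightarrow> sl\<^sub>n\<^sup>(\<^sup>b\<^sup>)\<close> that kills \<open>u\<^sub>n\<close> splits off the first factor.

  If all \<open>b\<^sub>i\<close> are nonzero then so are all \<open>\<Omega>\<^sub>i\<^sub>,\<^sub>i\<^sub>+\<^sub>1\<close>. The elements \<open>y\<^sub>i\<^sub>i\<close> satisfy the relations of
  \<open>sl\<^sub>n\<^sub>+\<^sub>1\<close> with parameters \<open>- \<Omega>\<^sub>i\<^sub>,\<^sub>i\<^sub>+\<^sub>1\<^sup>2\<close>, and the recursion above with \<open>h = \<Omega>\<close>, now started from the
  generators \<open>u'\<^sub>1, \<dots>, u'\<^sub>n\<close> of that Lie algebra, shows that it is spanned by the right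
  number of elements. Hence \<open>u'\<^sub>i \<mapsto> y\<^sub>i\<^sub>i\<close> is an isomorphism onto \<open>J\<close>.
\<close>

section \<open>Lie algebras, ideals and homomorphisms\<close>

context lie_algebra
begin

lemma smult_add_left: "x \<in> carrier L \<Longrightarrow> (a + b) \<odot> x = a \<odot> x \<oplus> b \<odot> x"
  using smult_l_distr[of a b x] by simp

lemma smult_smult: "x \<in> carrier L \<Longrightarrow> a \<odot> (b \<odot> x) = (a * b) \<odot> x"
  using smult_assoc1[of a b x] by simp

lemma smult_1 [simp]: "x \<in> carrier L \<Longrightarrow> 1 \<odot> x = x"
  using smult_one[of x] by simp

lemma smult_0 [simp]: "x \<in> carrier L \<Longrightarrow> 0 \<odot> x = \<zero>"
  using smult_l_null[of x] by simp

lemma smult_zero [simp]: "a \<odot> \<zero> = \<zero>"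
  using smult_r_null[of a] by simp

lemma smult_carrier [simp]: "x \<in> carrier L \<Longrightarrow> a \<odot> x \<in> carrier L"
  by simp

lemma neg_eq_smult: "x \<in> carrier L \<Longrightarrow> \<ominus> x = (-1) \<odot> x"
  using smult_minus_1[of x] by (simp add: class_ring_simps)

lemma smult_add_right: "x \<in> carrier L \<Longrightarrow> y \<in> carrier L \<Longrightarrow> a \<odot> (x \<oplus> y) = a \<odot> x \<oplus> a \<odot> y"
  by (simp add: smult_r_distr)

lemma smult_cancel: 
  assumes "a \<odot> x = a \<odot> y" "a \<noteq> 0" "x \<in> carrier L" "y \<in> carrier L"
  shows "x = y"
proof -
  have "x = inverse a \<odot> (a \<odot> x)" using assms(2,3) by (simp add: smult_smult)
  also have "\<dots> = y" unfolding assms(1) using assms(2,4) by (simp add: smult_smult)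
  finally show ?thesis .
qed

declare bracket_closed [simp]

lemma bracket_zero_left [simp]: "x \<in> carrier L \<Longrightarrow> \<lbrace>\<zero>, x\<rbrace> = \<zero>"
  using bracket_smult_left[of "\<zero>" x 0] by simp

lemma bracket_zero_right [simp]: "x \<in> carrier L \<Longrightarrow> \<lbrace>x, \<zero>\<rbrace> = \<zero>"
  using bracket_smult_right[of x "\<zero>" 0] by simp

lemma bracket_antisym:
  assumes "x \<in> carrier L" "y \<in> carrier L"
  shows "\<lbrace>x, y\<rbrace> = (-1) \<odot> \<lbrace>y, x\<rbrace>"
proof -
  have "\<zero> = \<lbrace>x \<oplus> y, x \<oplus> y\<rbrace>" using assms by (simp add: bracket_self)
  also have "\<dots> = \<lbrace>x, y\<rbrace> \<oplus> \<lbrace>y, x\<rbrace>"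
    using assms by (simp add: bracket_add_left bracket_add_right bracket_self [of x] bracket_self [of y]
      M.a_comm)
  finally have "\<lbrace>x, y\<rbrace> \<oplus> \<lbrace>y, x\<rbrace> = \<zero>" ..
  then have "\<lbrace>x, y\<rbrace> = \<ominus> \<lbrace>y, x\<rbrace>"
    using assms by (simp add: M.minus_equality)
  then show ?thesis using assms by (simp add: neg_eq_smult)
qed

lemma bracket_leibniz:
  assumes "x \<in> carrier L" "y \<in> carrier L" "z \<in> carrier L"
  shows "\<lbrace>x, \<lbrace>y, z\<rbrace>\<rbrace> = \<lbrace>\<lbrace>x, y\<rbrace>, z\<rbrace> \<oplus> \<lbrace>y, \<lbrace>x, z\<rbrace>\<rbrace>"
proof -
  have 1: "\<lbrace>y, \<lbrace>z, x\<rbrace>\<rbrace> = \<ominus> \<lbrace>y, \<lbrace>x, z\<rbrace>\<rbrace>"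
    using assms by (subst bracket_antisym[of z x]) (simp_all add: bracket_smult_right neg_eq_smult)
  have 2: "\<lbrace>z, \<lbrace>x, y\<rbrace>\<rbrace> = \<ominus> \<lbrace>\<lbrace>x, y\<rbrace>, z\<rbrace>"
    using assms by (subst bracket_antisym[of z]) (simp_all add: neg_eq_smult)
  have "\<lbrace>x, \<lbrace>y, z\<rbrace>\<rbrace> \<oplus> \<ominus> (\<lbrace>y, \<lbrace>x, z\<rbrace>\<rbrace> \<oplus> \<lbrace>\<lbrace>x, y\<rbrace>, z\<rbrace>) = \<zero>"
    using jacobi[OF assms] assms unfolding 1 2 by (simp add: M.minus_add M.a_assoc)
  then have "\<lbrace>x, \<lbrace>y, z\<rbrace>\<rbrace> = \<ominus> (\<ominus> (\<lbrace>y, \<lbrace>x, z\<rbrace>\<rbrace> \<oplus> \<lbrace>\<lbrace>x, y\<rbrace>, z\<rbrace>))"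
    using assms by (intro M.minus_equality [symmetric]) simp_all
  then show ?thesis
    using assms by (simp add: M.a_comm)
qed

lemma bracket_commute:
  assumes "\<lbrace>x, y\<rbrace> = \<zero>" "x \<in> carrier L" "y \<in> carrier L" "z \<in> carrier L"
  shows "\<lbrace>x, \<lbrace>y, z\<rbrace>\<rbrace> = \<lbrace>y, \<lbrace>x, z\<rbrace>\<rbrace>"
  using assms by (simp add: bracket_leibniz [of x y z])

text \<open>Expanding ad [a, [a, c]] with the Leibniz rule turns the Serre relation into the
  operator identity (ad a)^2 ad c - 2 ad a ad c ad a + ad c (ad a)^2 = \<gamma> ad a, written here
  without subtraction. The Serre lemmas that follow evaluate it at special vectors.\<close>

lemma serre_apply:
  assumes "\<lbrace>a, \<lbrace>a, c\<rbrace>\<rbrace> = \<gamma> \<odot> a" and [simp]: "a \<in> carrier L" "c \<in> carrier L" "z \<in> carrier L"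
  shows "\<lbrace>a, \<lbrace>a, \<lbrace>c, z\<rbrace>\<rbrace>\<rbrace> \<oplus> \<lbrace>c, \<lbrace>a, \<lbrace>a, z\<rbrace>\<rbrace>\<rbrace> = 2 \<odot> \<lbrace>a, \<lbrace>c, \<lbrace>a, z\<rbrace>\<rbrace>\<rbrace> \<oplus> \<gamma> \<odot> \<lbrace>a, z\<rbrace>"
proof -
  have "\<lbrace>a, \<lbrace>a, \<lbrace>c, z\<rbrace>\<rbrace>\<rbrace> = \<lbrace>a, \<lbrace>\<lbrace>a, c\<rbrace>, z\<rbrace>\<rbrace> \<oplus> \<lbrace>a, \<lbrace>c, \<lbrace>a, z\<rbrace>\<rbrace>\<rbrace>"
    by (subst bracket_leibniz[of a c z]) (simp_all add: bracket_add_right)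
  moreover have "\<lbrace>a, \<lbrace>\<lbrace>a, c\<rbrace>, z\<rbrace>\<rbrace> = \<gamma> \<odot> \<lbrace>a, z\<rbrace> \<oplus> \<lbrace>\<lbrace>a, c\<rbrace>, \<lbrace>a, z\<rbrace>\<rbrace>"
    by (subst bracket_leibniz[of a "\<lbrace>a, c\<rbrace>" z]) (simp_all add: assms(1) bracket_smult_left)
  moreover have "\<lbrace>a, \<lbrace>c, \<lbrace>a, z\<rbrace>\<rbrace>\<rbrace> = \<lbrace>\<lbrace>a, c\<rbrace>, \<lbrace>a, z\<rbrace>\<rbrace> \<oplus> \<lbrace>c, \<lbrace>a, \<lbrace>a, z\<rbrace>\<rbrace>\<rbrace>"
    by (rule bracket_leibniz) simp_all
  moreover have "2 \<odot> w = w \<oplus> w" if "w \<in> carrier L" for w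
    using smult_add_left[of w 1 1] that by simp
  ultimately show ?thesis by (simp add: M.a_ac)
qed

text \<open>In \<open>serre_apply\<close> every other term contains the factor [a, z].\<close>

lemma serre_kill:
  assumes "\<lbrace>a, \<lbrace>a, c\<rbrace>\<rbrace> = \<gamma> \<odot> a" "\<lbrace>a, z\<rbrace> = \<zero>"
    and [simp]: "a \<in> carrier L" "c \<in> carrier L" "z \<in> carrier L"
  shows "\<lbrace>a, \<lbrace>a, \<lbrace>c, z\<rbrace>\<rbrace>\<rbrace> = \<zero>"
  using serre_apply[OF assms(1,3-5)] assms(2) by simp

lemma add_eq_imp_smult_eq:
  assumes "w = 2 \<odot> x \<oplus> \<gamma> \<odot> y" and [simp]: "x \<in> carrier L" "y \<in> carrier L"
  shows "2 \<odot> x = w \<oplus> (- \<gamma>) \<odot> y"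
  by (simp add: assms(1) M.a_assoc flip: smult_add_left)

text \<open>The term with [c, z] drops out and the identity is solved for the mixed word a c a z.
  This is how the action of \<open>u (Suc j)\<close> on e_j e_k will be found.\<close>

lemma serre_middle:
  assumes "\<lbrace>a, \<lbrace>a, c\<rbrace>\<rbrace> = \<gamma> \<odot> a" "\<lbrace>c, z\<rbrace> = \<zero>"
    and [simp]: "a \<in> carrier L" "c \<in> carrier L" "z \<in> carrier L"
  shows "2 \<odot> \<lbrace>a, \<lbrace>c, \<lbrace>a, z\<rbrace>\<rbrace>\<rbrace> = \<lbrace>c, \<lbrace>a, \<lbrace>a, z\<rbrace>\<rbrace>\<rbrace> \<oplus> (- \<gamma>) \<odot> \<lbrace>a, z\<rbrace>"
  using serre_apply[OF assms(1,3-5)] assms(2) by (intro add_eq_imp_smult_eq) simp_all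

lemma serre_square:
  assumes "\<lbrace>c, \<lbrace>c, d\<rbrace>\<rbrace> = \<gamma> \<odot> c" "\<lbrace>d, z\<rbrace> = \<zero>" "\<lbrace>d, \<lbrace>c, z\<rbrace>\<rbrace> = t \<odot> z"
    and [simp]: "c \<in> carrier L" "d \<in> carrier L" "z \<in> carrier L"
  shows "\<lbrace>d, \<lbrace>c, \<lbrace>c, z\<rbrace>\<rbrace>\<rbrace> = (2 * t + \<gamma>) \<odot> \<lbrace>c, z\<rbrace>"
  using serre_apply[OF assms(1,4-6)] assms(2,3)
  by (simp add: bracket_smult_right smult_add_left smult_smult)

text \<open>Evaluating the relation at z and at [c, z] gives the linear system X = 2 Y + \<gamma> W,
  Y = 2 X + \<gamma> W for the words X = c a c c z, Y = c c a c z, W = c c z. Eliminating Y leaves 3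
  X = -3 \<gamma> W.\<close>

lemma serre_square_middle:
  assumes "\<lbrace>c, \<lbrace>c, a\<rbrace>\<rbrace> = \<gamma> \<odot> c" "\<lbrace>a, z\<rbrace> = \<zero>" "\<lbrace>c, \<lbrace>c, \<lbrace>c, z\<rbrace>\<rbrace>\<rbrace> = \<zero>"
    and [simp]: "a \<in> carrier L" "c \<in> carrier L" "z \<in> carrier L"
  shows "\<lbrace>c, \<lbrace>a, \<lbrace>c, \<lbrace>c, z\<rbrace>\<rbrace>\<rbrace>\<rbrace> = (- \<gamma>) \<odot> \<lbrace>c, \<lbrace>c, z\<rbrace>\<rbrace>"
proof -
  define X where "X = \<lbrace>c, \<lbrace>a, \<lbrace>c, \<lbrace>c, z\<rbrace>\<rbrace>\<rbrace>\<rbrace>"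
  define Y where "Y = \<lbrace>c, \<lbrace>c, \<lbrace>a, \<lbrace>c, z\<rbrace>\<rbrace>\<rbrace>\<rbrace>"
  define W where "W = \<lbrace>c, \<lbrace>c, z\<rbrace>\<rbrace>"
  have [simp]: "X \<in> carrier L" "Y \<in> carrier L" "W \<in> carrier L" by (simp_all add: X_def Y_def W_def)
  have "\<lbrace>a, \<lbrace>c, \<lbrace>c, z\<rbrace>\<rbrace>\<rbrace> = 2 \<odot> \<lbrace>c, \<lbrace>a, \<lbrace>c, z\<rbrace>\<rbrace>\<rbrace> \<oplus> \<gamma> \<odot> \<lbrace>c, z\<rbrace>"
    using serre_apply[OF assms(1), of z] assms(2) by simp
  then have X: "X = 2 \<odot> Y \<oplus> \<gamma> \<odot> W"
    unfolding X_def Y_def W_def by (simp add: bracket_add_right bracket_smult_right)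
  have Y: "Y = 2 \<odot> X \<oplus> \<gamma> \<odot> W"
    using serre_apply[OF assms(1), of "\<lbrace>c, z\<rbrace>"] assms(3) unfolding X_def Y_def W_def by simp
  have "X = 2 \<odot> (2 \<odot> X \<oplus> \<gamma> \<odot> W) \<oplus> \<gamma> \<odot> W" using X Y by simp
  also have "\<dots> = 4 \<odot> X \<oplus> (3 * \<gamma>) \<odot> W"
    by (simp add: smult_add_right smult_smult M.a_assoc flip: smult_add_left)
  finally have e: "X = 4 \<odot> X \<oplus> (3 * \<gamma>) \<odot> W" .
  have c: "w \<oplus> (-1) \<odot> w = \<zero>" if "w \<in> carrier L" for w
    using that by (simp add: M.r_neg flip: neg_eq_smult)
  \<comment> \<open>To pass from \<open>e\<close> to 3 X = -3 \<gamma> W without subtraction,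
    cancelling summands are inserted first and \<open>e\<close> is then used from right to
    left.\<close>
  have "3 \<odot> X = 4 \<odot> X \<oplus> (-1) \<odot> X \<oplus> ((3 * \<gamma>) \<odot> W \<oplus> (-1) \<odot> ((3 * \<gamma>) \<odot> W))"
    by (simp add: c flip: smult_add_left)
  also have "\<dots> = (4 \<odot> X \<oplus> (3 * \<gamma>) \<odot> W) \<oplus> (-1) \<odot> X \<oplus> 3 \<odot> ((- \<gamma>) \<odot> W)"
    by (simp add: smult_smult M.a_ac)
  also have "\<dots> = 3 \<odot> ((- \<gamma>) \<odot> W)"
    by (simp add: c flip: e)
  finally have "X = (- \<gamma>) \<odot> W" by (rule smult_cancel) simp_all
  then show ?thesis unfolding X_def W_def .
qed

text \<open>Two applications of \<open>serre_kill\<close>, at z and at [a, [c, z]], give a a c z = 0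
  and a a c a c z = 0. The relation at [c, z] writes a a c c z through a c a c z and a c z, and one
  more \<open>a\<close> kills both.\<close>

lemma serre_cube:
  assumes "\<lbrace>a, \<lbrace>a, c\<rbrace>\<rbrace> = \<gamma> \<odot> a" "\<lbrace>a, z\<rbrace> = \<zero>"
    and [simp]: "a \<in> carrier L" "c \<in> carrier L" "z \<in> carrier L"
  shows "\<lbrace>a, \<lbrace>a, \<lbrace>a, \<lbrace>c, \<lbrace>c, z\<rbrace>\<rbrace>\<rbrace>\<rbrace>\<rbrace> = \<zero>"
proof -
  have 0: "\<lbrace>a, \<lbrace>a, \<lbrace>c, z\<rbrace>\<rbrace>\<rbrace> = \<zero>" by (rule serre_kill) fact+
  then have 1: "\<lbrace>a, \<lbrace>a, \<lbrace>c, \<lbrace>a, \<lbrace>c, z\<rbrace>\<rbrace>\<rbrace>\<rbrace>\<rbrace> = \<zero>"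
    by (intro serre_kill [OF assms(1), of "\<lbrace>a, \<lbrace>c, z\<rbrace>\<rbrace>"]) simp_all
  have "\<lbrace>a, \<lbrace>a, \<lbrace>c, \<lbrace>c, z\<rbrace>\<rbrace>\<rbrace>\<rbrace> = 2 \<odot> \<lbrace>a, \<lbrace>c, \<lbrace>a, \<lbrace>c, z\<rbrace>\<rbrace>\<rbrace>\<rbrace> \<oplus> \<gamma> \<odot> \<lbrace>a, \<lbrace>c, z\<rbrace>\<rbrace>"
    using serre_apply[OF assms(1), of "\<lbrace>c, z\<rbrace>"] 0 by simp
  then show ?thesis
    using 0 1 by (simp add: bracket_add_right bracket_smult_right)
qed

end

section \<open>Homomorphisms, subalgebras and ideals\<close>

lemma lie_homI:
  assumes "\<And>x. x \<in> carrier L \<Longrightarrow> h x \<in> carrier M"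
    and "\<And>x y. x \<in> carrier L \<Longrightarrow> y \<in> carrier L \<Longrightarrow> h (x \<oplus>\<^bsub>L\<^esub> y) = h x \<oplus>\<^bsub>M\<^esub> h y"
    and "\<And>a x. x \<in> carrier L \<Longrightarrow> h (a \<odot>\<^bsub>L\<^esub> x) = a \<odot>\<^bsub>M\<^esub> h x"
    and "\<And>x y. x \<in> carrier L \<Longrightarrow> y \<in> carrier L \<Longrightarrow> h (\<lbrace>x, y\<rbrace>\<^bsub>L\<^esub>) = \<lbrace>h x, h y\<rbrace>\<^bsub>M\<^esub>"
  shows "h \<in> lie_hom L M"
  using assms by (simp add: lie_hom_def LinearCombinations.module_hom_def)

lemma lie_homD:
  assumes "h \<in> lie_hom L M" "x \<in> carrier L"
  shows "h x \<in> carrier M" "h (a \<odot>\<^bsub>L\<^esub> x) = a \<odot>\<^bsub>M\<^esub> h x"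
    and "y \<in> carrier L \<Longrightarrow> h (x \<oplus>\<^bsub>L\<^esub> y) = h x \<oplus>\<^bsub>M\<^esub> h y"
    and "y \<in> carrier L \<Longrightarrow> h (\<lbrace>x, y\<rbrace>\<^bsub>L\<^esub>) = \<lbrace>h x, h y\<rbrace>\<^bsub>M\<^esub>"
  using assms by (auto simp: lie_hom_def LinearCombinations.module_hom_def)

lemma lie_hom_zero:
  assumes "lie_algebra L" "lie_algebra M" "h \<in> lie_hom L M"
  shows "h \<zero>\<^bsub>L\<^esub> = \<zero>\<^bsub>M\<^esub>"
proof -
  interpret L: lie_algebra L by fact
  interpret M: lie_algebra M by fact
  have "h (0 \<odot>\<^bsub>L\<^esub> \<zero>\<^bsub>L\<^esub>) = 0 \<odot>\<^bsub>M\<^esub> h \<zero>\<^bsub>L\<^esub>" by (rule lie_homD [OF assms(3)]) simp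
  then show ?thesis using lie_homD(1) [OF assms(3), of "\<zero>\<^bsub>L\<^esub>"] by simp
qed

lemma lie_hom_comp:
  "g \<in> lie_hom L M \<Longrightarrow> h \<in> lie_hom M N \<Longrightarrow> (\<lambda>x. h (g x)) \<in> lie_hom L N"
  by (intro lie_homI) (simp_all add: lie_homD)

lemma lie_iso_inv_into:
  assumes "lie_algebra L" "h \<in> lie_iso L M"
  shows "inv_into (carrier L) h \<in> lie_iso M L"
proof -
  interpret lie_algebra L by fact
  have hom: "h \<in> lie_hom L M" and bij: "bij_betw h (carrier L) (carrier M)"
    using assms(2) by (auto simp: lie_iso_def)
  let ?g = "inv_into (carrier L) h"
  have g: "?g y \<in> carrier L" "h (?g y) = y" if "y \<in> carrier M" for y
    using bij that by (auto simp: bij_betw_def inv_into_into f_inv_into_f)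
  have gI: "?g y = x" if "x \<in> carrier L" "h x = y" for x y
    using bij that by (auto simp: bij_betw_def inv_into_f_f)
  have "?g \<in> lie_hom M L"
    by (rule lie_homI) (auto simp: g lie_homD [OF hom] intro!: gI)
  then show ?thesis using bij by (simp add: lie_iso_def bij_betw_inv_into)
qed

lemma lie_iso_comp:
  "g \<in> lie_iso L M \<Longrightarrow> h \<in> lie_iso M N \<Longrightarrow> (\<lambda>x. h (g x)) \<in> lie_iso L N"
  using bij_betw_trans [of g "carrier L" "carrier M" h "carrier N"]
  by (auto simp: lie_iso_def lie_hom_comp comp_def)

context lie_algebra
begin

lemma submoduleI:
  assumes "S \<subseteq> carrier L" "\<zero> \<in> S" "\<And>x y. x \<in> S \<Longrightarrow> y \<in> S \<Longrightarrow> x \<oplus> y \<in> S"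
    "\<And>a x. x \<in> S \<Longrightarrow> a \<odot> x \<in> S"
  shows "submodule class_ring S L"
  using assms by unfold_locales auto

lemma submoduleD:
  assumes "submodule class_ring S L"
  shows "S \<subseteq> carrier L" "\<zero> \<in> S" "x \<in> S \<Longrightarrow> y \<in> S \<Longrightarrow> x \<oplus> y \<in> S" "x \<in> S \<Longrightarrow> a \<odot> x \<in> S"
  using assms by (auto simp: submodule_def)

lemma lie_ideal_subalgebra: "lie_ideal S L \<Longrightarrow> lie_subalgebra S L"
  by (auto simp: lie_ideal_def lie_subalgebra_def dest: submoduleD(1))

lemma lie_ideal_bracket_right:
  assumes "lie_ideal S L" "x \<in> S" "y \<in> carrier L"
  shows "\<lbrace>x, y\<rbrace> \<in> S"
proof -
  have S: "submodule class_ring S L" using assms(1) by (simp add: lie_ideal_def)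
  then show ?thesis
    using assms bracket_antisym [of x y] submoduleD [OF S] by (auto simp: lie_ideal_def)
qed

lemma lie_algebra_restrict:
  assumes "lie_subalgebra S L"
  shows "lie_algebra (L\<lparr>carrier := S\<rparr>)"
proof -
  have sub: "submodule class_ring S L" and S: "S \<subseteq> carrier L"
    using assms by (auto simp: lie_subalgebra_def dest: submoduleD(1))
  have "vectorspace class_ring (L\<lparr>carrier := S\<rparr>)"
    by (intro vectorspace_class_ringI submodule_is_module sub)
  moreover have "\<lbrace>x, y\<rbrace> \<in> S" if "x \<in> S" "y \<in> S" for x y
    using assms that by (auto simp: lie_subalgebra_def)
  ultimately show ?thesis
    unfolding lie_algebra_def
    by (intro conjI lie_algebra_axioms.intro) (use S in \<open>auto simp: subset_iff bracket_add_left
      bracket_add_right bracket_smult_left bracket_smult_right bracket_self jacobi\<close>)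
qed

text \<open>By the Jacobi identity the elements that map S into itself are closed under the bracket.
  For presented Lie algebras this reduces the ideal property to brackets with generators.\<close>

lemma lie_subalgebra_normalizer:
  assumes "submodule class_ring S L"
  shows "lie_subalgebra {x \<in> carrier L. \<forall>y\<in>S. \<lbrace>x, y\<rbrace> \<in> S} L"
proof -
  note S = submoduleD [OF assms]
  have "\<lbrace>\<lbrace>x, y\<rbrace>, z\<rbrace> \<in> S" if "x \<in> carrier L" "y \<in> carrier L" "z \<in> S"
    "\<forall>y\<in>S. \<lbrace>x, y\<rbrace> \<in> S" "\<forall>z\<in>S. \<lbrace>y, z\<rbrace> \<in> S" for x y z
  proof -
    have [simp]: "z \<in> carrier L" using S that by auto
    have "\<lbrace>\<lbrace>x, y\<rbrace>, z\<rbrace> = \<lbrace>x, \<lbrace>y, z\<rbrace>\<rbrace> \<oplus> (-1) \<odot> \<lbrace>y, \<lbrace>x, z\<rbrace>\<rbrace>"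
      using that by (simp add: bracket_leibniz [of x y z] M.a_assoc M.r_neg flip: neg_eq_smult)
    then show ?thesis using that S by simp
  qed
  then show ?thesis unfolding lie_subalgebra_def
    by (intro conjI submoduleI)
      (use S in \<open>auto simp: subset_iff bracket_add_left bracket_smult_left\<close>)
qed

lemma lie_ideal_generated_eq:
  assumes "lie_ideal S L" "X \<subseteq> S" "\<And>T. lie_ideal T L \<Longrightarrow> X \<subseteq> T \<Longrightarrow> S \<subseteq> T"
  shows "lie_ideal_generated L X = L\<lparr>carrier := S\<rparr>"
  using assms unfolding lie_ideal_generated_def
    by (intro arg_cong [where f = "\<lambda>S. L\<lparr>carrier := S\<rparr>"]) blast

lemma lie_subalgebra_generated_eq:
  assumes "lie_subalgebra S L" "X \<subseteq> S" "\<And>T. lie_subalgebra T L \<Longrightarrow> X \<subseteq> T \<Longrightarrow> S \<subseteq> T"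
  shows "lie_subalgebra_generated L X = L\<lparr>carrier := S\<rparr>"
  using assms unfolding lie_subalgebra_generated_def
    by (intro arg_cong [where f = "\<lambda>S. L\<lparr>carrier := S\<rparr>"]) blast

lemma lie_subalgebra_image:
  assumes "lie_algebra G" "h \<in> lie_hom G L"
  shows "lie_subalgebra (h ` carrier G) L"
proof -
  interpret G: lie_algebra G by fact
  note h = lie_homD [OF assms(2)]
  show ?thesis unfolding lie_subalgebra_def
    by (intro conjI submoduleI)
      (auto simp: h lie_hom_zero [OF G.lie_algebra_axioms lie_algebra_axioms assms(2), symmetric]
        simp flip: h(2-4))
qed

lemma lie_subalgebra_vimage:
  assumes "lie_algebra M" "h \<in> lie_hom L M" "lie_subalgebra S M"
  shows "lie_subalgebra {x \<in> carrier L. h x \<in> S} L"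
proof -
  interpret M: lie_algebra M by fact
  have S: "submodule class_ring S M" using assms(3) by (simp add: lie_subalgebra_def)
  show ?thesis using assms(3) M.submoduleD [OF S] unfolding lie_subalgebra_def
    by (intro conjI submoduleI)
      (auto simp: lie_homD [OF assms(2)] lie_hom_zero [OF lie_algebra_axioms assms(1,2)])
qed

lemma lie_subalgebra_equalizer:
  assumes "lie_algebra M" "g \<in> lie_hom L M" "h \<in> lie_hom L M"
  shows "lie_subalgebra {x \<in> carrier L. g x = h x} L"
  unfolding lie_subalgebra_def
  by (intro conjI submoduleI)
    (auto simp: lie_homD [OF assms(2)] lie_homD [OF assms(3)]
      lie_hom_zero [OF lie_algebra_axioms assms(1,2)] lie_hom_zero [OF lie_algebra_axioms assms(1,3)])

end

section \<open>Induction and uniqueness of homomorphisms for presented Lie algebras\<close>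

definition lie_pres_gen :: "'g set \<Rightarrow> ('g lie_term \<times> 'g lie_term) set \<Rightarrow> 'g \<Rightarrow> 'g lie_term set" where
  "lie_pres_gen I R i = lie_class I R (Gen i)"

lemma lie_pres_gen_carrier [simp]: "i \<in> I \<Longrightarrow> lie_pres_gen I R i \<in> carrier (lie_presented I R)"
  by (simp add: lie_pres_gen_def lie_presented_ops)

text \<open>Evaluation at the generators is the quotient map, so relations and inductions on terms
  can be read inside the presented algebra.\<close>

lemma lie_eval_pres_gen:
  "t \<in> lie_terms I \<Longrightarrow> lie_eval (lie_presented I R) (lie_pres_gen I R) t = lie_class I R t"
  by (induction t) (simp_all add: lie_presented_ops lie_pres_gen_def)

lemma lie_pres_gen_relation:
  assumes "(s, t) \<in> R" "s \<in> lie_terms I" "t \<in> lie_terms I"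
  shows "lie_eval (lie_presented I R) (lie_pres_gen I R) s = lie_eval (lie_presented I R) (lie_pres_gen I R) t"
  using assms by (simp add: lie_eval_pres_gen lie_class_eqI lie_eq.relation)

lemma lie_presented_generated:
  assumes "lie_subalgebra S (lie_presented I R)" "\<And>i. i \<in> I \<Longrightarrow> lie_pres_gen I R i \<in> S"
  shows "carrier (lie_presented I R) \<subseteq> S"
proof -
  interpret lie_algebra "lie_presented I R" by (rule lie_algebra_presented)
  have S: "submodule class_ring S (lie_presented I R)" 
    and br: "\<And>x y. x \<in> S \<Longrightarrow> y \<in> S \<Longrightarrow> \<lbrace>x, y\<rbrace>\<^bsub>lie_presented I R\<^esub> \<in> S"
    using assms(1) by (auto simp: lie_subalgebra_def)
  have "lie_eval (lie_presented I R) (lie_pres_gen I R) t \<in> S" if "t \<in> lie_terms I" for t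
    using that by (induction t) (simp_all add: assms(2) submoduleD [OF S] br)
  then show ?thesis by (auto simp: lie_presented_simps(1) lie_eval_pres_gen)
qed

text \<open>The normalizer of S is a subalgebra; as soon as it contains the generators it is
  everything.\<close>

lemma lie_presented_idealI:
  assumes "submodule class_ring S (lie_presented I R)"
    and "\<And>i x. i \<in> I \<Longrightarrow> x \<in> S \<Longrightarrow> \<lbrace>lie_pres_gen I R i, x\<rbrace>\<^bsub>lie_presented I R\<^esub> \<in> S"
  shows "lie_ideal S (lie_presented I R)"
  using lie_presented_generated [OF lie_algebra.lie_subalgebra_normalizer
    [OF lie_algebra_presented assms(1)]] assms
  by (auto simp: lie_ideal_def)

lemma lie_presented_hom_eqI:
  assumes "lie_algebra M" "g \<in> lie_hom (lie_presented I R) M" "h \<in> lie_hom (lie_presented I R) M"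
    and "\<And>i. i \<in> I \<Longrightarrow> g (lie_pres_gen I R i) = h (lie_pres_gen I R i)"
    and "x \<in> carrier (lie_presented I R)"
  shows "g x = h x"
  using lie_presented_generated [OF lie_algebra.lie_subalgebra_equalizer
    [OF lie_algebra_presented assms(1-3)]] assms(4,5) by auto

lemma (in lie_algebra) lie_lift_gen:
  assumes "g ` I \<subseteq> carrier L" "\<And>s t. (s, t) \<in> R \<Longrightarrow> lie_eval L g s = lie_eval L g t" "i \<in> I"
  shows "lie_lift L g (lie_pres_gen I R i) = g i"
  using lie_lift_class [OF assms(1,2), where t = "Gen i"] assms(3) by (simp add: lie_pres_gen_def)

section \<open>Elements that multiply like symmetric tensors\<close>

text \<open>
  The elements \<open>y j k\<close> stand for \<open>e\<^sub>j e\<^sub>k \<in> S\<^sup>2V\<close>, and \<open>u i\<close> for the operator \<open>e\<^sub>j \<mapsto> h i j e\<^sub>i\<close> on \<open>V\<close>.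
  There are two instances: \<open>m = n - 1\<close> for \<open>sp\<^sub>2\<^sub>n\<close>, and \<open>m = n\<close> with \<open>y i i = u i\<close> for \<open>sl\<^sub>n\<^sub>+\<^sub>1\<close>.
\<close>

locale sym_elements = lie_algebra L for L :: "('a, 'b) lie_alg_scheme" (structure) +
  fixes m n :: nat and h :: "nat \<Rightarrow> nat \<Rightarrow> complex" and u :: "nat \<Rightarrow> 'a" and y :: "nat \<Rightarrow> nat \<Rightarrow> 'a"
  assumes m_le: "m \<le> n" and le_m: "n \<le> Suc m"
    and u_closed [simp]: "1 \<le> i \<Longrightarrow> i \<le> m \<Longrightarrow> u i \<in> carrier L"
    and y_closed [simp]: "1 \<le> j \<Longrightarrow> j \<le> n \<Longrightarrow> 1 \<le> k \<Longrightarrow> k \<le> n \<Longrightarrow> y j k \<in> carrier L"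
    and y_sym: "y j k = y k j"
    and h_far: "i \<noteq> Suc j \<Longrightarrow> j \<noteq> Suc i \<Longrightarrow> h i j = 0"
    and h_Suc: "1 \<le> i \<Longrightarrow> i < n \<Longrightarrow> h i (Suc i) \<noteq> 0"
    and u_far: "1 \<le> i \<Longrightarrow> i \<le> m \<Longrightarrow> 1 \<le> j \<Longrightarrow> j \<le> m \<Longrightarrow> i \<noteq> Suc j \<Longrightarrow> j \<noteq> Suc i \<Longrightarrow> \<lbrace>u i, u j\<rbrace> = \<zero>"
    and serre: "1 \<le> i \<Longrightarrow> i \<le> m \<Longrightarrow> 1 \<le> j \<Longrightarrow> j \<le> m \<Longrightarrow> i = Suc j \<or> j = Suc i \<Longrightarrow>
      \<lbrace>u i, \<lbrace>u i, u j\<rbrace>\<rbrace> = (- 2 * (h i j * h j i)) \<odot> u i"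
    and u_diag_far: "1 \<le> i \<Longrightarrow> i \<le> m \<Longrightarrow> 1 \<le> k \<Longrightarrow> k \<le> n \<Longrightarrow> i \<noteq> Suc k \<Longrightarrow> k \<noteq> Suc i \<Longrightarrow>
      \<lbrace>u i, y k k\<rbrace> = \<zero>"
    and u_diag_below: "1 \<le> k \<Longrightarrow> k < n \<Longrightarrow>
      \<lbrace>u k, y (Suc k) (Suc k)\<rbrace> = (2 * h k (Suc k)) \<odot> y k (Suc k)"
    and u_diag_above: "1 \<le> k \<Longrightarrow> Suc k \<le> m \<Longrightarrow>
      \<lbrace>u (Suc k), y k k\<rbrace> = (2 * h (Suc k) k) \<odot> y k (Suc k)"
    and u_next_lower: "1 \<le> k \<Longrightarrow> k < n \<Longrightarrow> \<lbrace>u k, y k (Suc k)\<rbrace> = h k (Suc k) \<odot> y k k"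
    and u_next_upper: "1 \<le> k \<Longrightarrow> Suc k \<le> m \<Longrightarrow>
      \<lbrace>u (Suc k), y k (Suc k)\<rbrace> = h (Suc k) k \<odot> y (Suc k) (Suc k)"
    and u_step: "1 \<le> j \<Longrightarrow> Suc j < k \<Longrightarrow> k \<le> n \<Longrightarrow> \<lbrace>u j, y (Suc j) k\<rbrace> = h j (Suc j) \<odot> y j k"
begin

text \<open>Since c is nonzero it can be cancelled, so a claim about \<open>y j k\<close> follows
  from one about the bracket of \<open>u j\<close> with \<open>y (Suc j) k\<close>. The downward
  inductions on j below rest on this.\<close>

lemma y_descend:
  assumes "1 \<le> j" "j < k" "k \<le> n"
  obtains c where "c \<noteq> 0" "\<lbrace>u j, y (Suc j) k\<rbrace> = c \<odot> y j k"
proof (cases "k = Suc j")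
  case True
  then show ?thesis using assms h_Suc [of j]
    by (intro that [of "2 * h j (Suc j)"]) (simp_all add: u_diag_below)
next
  case False
  then show ?thesis using assms h_Suc [of j] by (intro that [of "h j (Suc j)"]) (simp_all add: u_step)
qed

text \<open>The operators that lead from e_k e_k down to e_j e_k have indices at least j, hence
  commute with \<open>u i\<close>; the vanishing is inherited from the diagonal.\<close>

lemma u_y_low:
  assumes "1 \<le> i" "Suc i < j" "j \<le> k" "k \<le> n"
  shows "\<lbrace>u i, y j k\<rbrace> = \<zero>"
  using assms(3,2)
proof (induction j rule: inc_induct)
  case base
  then show ?case using assms m_le le_m by (intro u_diag_far) auto
next
  case (step j)
  obtain c where c: "c \<noteq> 0" "\<lbrace>u j, y (Suc j) k\<rbrace> = c \<odot> y j k"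
    using y_descend [of j k] step.hyps step.prems assms by auto
  have [simp]: "u i \<in> carrier L" "u j \<in> carrier L" "y j k \<in> carrier L" "y (Suc j) k \<in> carrier L"
    using step.hyps step.prems assms m_le le_m by auto
  have "c \<odot> \<lbrace>u i, y j k\<rbrace> = \<lbrace>u i, \<lbrace>u j, y (Suc j) k\<rbrace>\<rbrace>"
    by (simp add: c bracket_smult_right)
  also have "\<dots> = \<lbrace>u j, \<lbrace>u i, y (Suc j) k\<rbrace>\<rbrace>"
    using step.hyps step.prems assms m_le le_m by (intro bracket_commute u_far) auto
  also have "\<dots> = c \<odot> \<zero>" using step by simp
  finally show ?case by (rule smult_cancel) (simp_all add: c)
qed

text \<open>Up to a nonzero factor \<open>y j k\<close> is u_j u_{j+1} y_{j+2,k}, and u_j kills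
  y_{j+2,k}, so \<open>serre_kill\<close> applies.\<close>

lemma u_y_same:
  assumes "1 \<le> j" "Suc j < k" "k \<le> n"
  shows "\<lbrace>u j, y j k\<rbrace> = \<zero>"
proof -
  obtain c where c: "c \<noteq> 0" "\<lbrace>u j, y (Suc j) k\<rbrace> = c \<odot> y j k"
    using y_descend [of j k] assms by auto
  obtain d where d: "d \<noteq> 0" "\<lbrace>u (Suc j), y (Suc (Suc j)) k\<rbrace> = d \<odot> y (Suc j) k"
    using y_descend [of "Suc j" k] assms by auto
  have [simp]: "u j \<in> carrier L" "u (Suc j) \<in> carrier L" "y j k \<in> carrier L" "y (Suc j) k \<in> carrier L"
    "y (Suc (Suc j)) k \<in> carrier L"
    using assms m_le le_m by auto
  have "(d * c) \<odot> \<lbrace>u j, y j k\<rbrace> = \<lbrace>u j, \<lbrace>u j, \<lbrace>u (Suc j), y (Suc (Suc j)) k\<rbrace>\<rbrace>\<rbrace>"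
    by (simp add: c d bracket_smult_right smult_smult)
  also have "\<dots> = (d * c) \<odot> \<zero>" unfolding smult_zero
    using assms m_le le_m by (intro serre_kill [OF serre] u_y_low) auto
  finally show ?thesis by (rule smult_cancel) (simp_all add: c d)
qed

lemma u_y_succ:
  assumes "1 \<le> j" "Suc (Suc j) \<le> k" "k \<le> n"
  shows "\<lbrace>u (Suc j), y j k\<rbrace> = h (Suc j) j \<odot> y (Suc j) k \<oplus> h (Suc j) k \<odot> y j (Suc j)"
proof -
  let ?a = "u (Suc j)" and ?c = "u j" and ?z = "y (Suc (Suc j)) k"
    and ?g = "h j (Suc j)" and ?g' = "h (Suc j) (Suc (Suc j))"
  have [simp]: "?c \<in> carrier L" "?a \<in> carrier L" "y j k \<in> carrier L" "y (Suc j) k \<in> carrier L"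
    "?z \<in> carrier L" "y (Suc j) (Suc j) \<in> carrier L" "y j (Suc j) \<in> carrier L"
    using assms m_le le_m by auto
  have g: "?g \<noteq> 0" "?g' \<noteq> 0" using assms h_Suc [of j] h_Suc [of "Suc j"] by auto
  have ca: "\<lbrace>?c, y (Suc j) k\<rbrace> = ?g \<odot> y j k" using assms by (simp add: u_step)
  \<comment> \<open>\<open>serre_middle\<close> applies because \<open>?c\<close> = u_j kills
    \<open>?z\<close>, both of whose indices exceed j + 1.\<close>
  have "2 \<odot> \<lbrace>?a, \<lbrace>?c, \<lbrace>?a, ?z\<rbrace>\<rbrace>\<rbrace> =
      \<lbrace>?c, \<lbrace>?a, \<lbrace>?a, ?z\<rbrace>\<rbrace>\<rbrace> \<oplus> (- (- 2 * (h (Suc j) j * ?g))) \<odot> \<lbrace>?a, ?z\<rbrace>"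
    using assms m_le le_m by (intro serre_middle [OF serre] u_y_low) auto
  then have eq: "2 \<odot> \<lbrace>?a, \<lbrace>?c, \<lbrace>?a, ?z\<rbrace>\<rbrace>\<rbrace> =
      \<lbrace>?c, \<lbrace>?a, \<lbrace>?a, ?z\<rbrace>\<rbrace>\<rbrace> \<oplus> (2 * h (Suc j) j * ?g) \<odot> \<lbrace>?a, ?z\<rbrace>" by (simp add: mult.assoc)
  show ?thesis
  \<comment> \<open>If k = j + 2 then \<open>?z\<close> is diagonal: [a, z] carries a factor 2, and
    the surviving [a, [a, z]] yields the second summand. For larger k both [a, [a, z]] and
    \<open>h (Suc j) k\<close> vanish.\<close>
  proof (cases "k = Suc (Suc j)")
    case True
    have az: "\<lbrace>?a, ?z\<rbrace> = (2 * ?g') \<odot> y (Suc j) k"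
      using assms u_diag_below [of "Suc j"] True by simp
    have aaz: "\<lbrace>?a, y (Suc j) k\<rbrace> = ?g' \<odot> y (Suc j) (Suc j)"
      using assms u_next_lower [of "Suc j"] True by simp
    have caaz: "\<lbrace>?c, y (Suc j) (Suc j)\<rbrace> = (2 * ?g) \<odot> y j (Suc j)"
      using assms u_diag_below [of j] by simp
    have "(4 * ?g' * ?g) \<odot> \<lbrace>?a, y j k\<rbrace> = 2 \<odot> \<lbrace>?a, \<lbrace>?c, \<lbrace>?a, ?z\<rbrace>\<rbrace>\<rbrace>"
      by (simp add: az ca bracket_smult_right smult_smult mult.assoc)
    also have "\<dots> = (4 * ?g' * ?g) \<odot> (?g' \<odot> y j (Suc j) \<oplus> h (Suc j) j \<odot> y (Suc j) k)"
      unfolding eq by (simp add: az aaz caaz bracket_smult_right smult_smult smult_add_right mult_ac)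
    finally have "\<lbrace>?a, y j k\<rbrace> = ?g' \<odot> y j (Suc j) \<oplus> h (Suc j) j \<odot> y (Suc j) k"
      by (rule smult_cancel) (simp_all add: g)
    then show ?thesis using True [symmetric] by (simp add: M.a_comm)
  next
    case False
    have az: "\<lbrace>?a, ?z\<rbrace> = ?g' \<odot> y (Suc j) k"
      using assms u_step [of "Suc j" k] False by simp
    have aaz: "\<lbrace>?a, y (Suc j) k\<rbrace> = \<zero>"
      using assms u_y_same [of "Suc j" k] False by simp
    have "(2 * ?g' * ?g) \<odot> \<lbrace>?a, y j k\<rbrace> = 2 \<odot> \<lbrace>?a, \<lbrace>?c, \<lbrace>?a, ?z\<rbrace>\<rbrace>\<rbrace>"
      by (simp add: az ca bracket_smult_right smult_smult mult.assoc)
    also have "\<dots> = (2 * ?g' * ?g) \<odot> (h (Suc j) j \<odot> y (Suc j) k)"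
      unfolding eq by (simp add: az aaz bracket_smult_right smult_smult mult_ac)
    finally have "\<lbrace>?a, y j k\<rbrace> = h (Suc j) j \<odot> y (Suc j) k"
      by (rule smult_cancel) (simp_all add: g)
    moreover have "h (Suc j) k = 0" using False assms by (intro h_far) auto
    ultimately show ?thesis by simp
  qed
qed

text \<open>Downward induction on j, starting at the diagonal. The position of i relative to j
  decides which earlier lemma applies; only for i > j + 1 is the induction hypothesis needed, and
  there u_i commutes with u_j.\<close>

lemma u_y_le:
  assumes i: "1 \<le> i" "i \<le> m" and "1 \<le> j" "j \<le> k" and k: "k \<le> n"
  shows "\<lbrace>u i, y j k\<rbrace> = h i j \<odot> y i k \<oplus> h i k \<odot> y j i"
  using assms(4,3)
proof (induction j rule: inc_induct)
  case base
  have [simp]: "y i k \<in> carrier L" using assms m_le by auto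
  have eq: "h i k \<odot> y i k \<oplus> h i k \<odot> y k i = (2 * h i k) \<odot> y i k"
    by (simp add: y_sym [of k i] flip: smult_add_left)
  consider "i = Suc k" | "k = Suc i" | "i \<noteq> Suc k" "k \<noteq> Suc i" by blast
  then show ?case
  proof cases
    case 1
    then show ?thesis unfolding eq using assms base by (simp add: u_diag_above y_sym [of "Suc k" k])
  next
    case 2
    then show ?thesis unfolding eq using assms base by (simp add: u_diag_below)
  next
    case 3
    then have "h i k = 0" by (intro h_far)
    with 3 show ?thesis unfolding eq using assms base by (simp add: u_diag_far)
  qed
next
  case (step j)
  have j: "1 \<le> j" "j < k" "j < n" "j \<le> m" using step.hyps step.prems assms le_m by auto
  have [simp]: "u i \<in> carrier L" "u j \<in> carrier L" "y j k \<in> carrier L" "y (Suc j) k \<in> carrier L"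
    "y i k \<in> carrier L" "y j i \<in> carrier L" "y (Suc j) i \<in> carrier L"
    using assms j m_le by auto
  consider "Suc i = j" | "Suc i < j" | "i = j" "k = Suc j" | "i = j" "Suc j < k"
    | "i = Suc j" "k = Suc j" | "i = Suc j" "Suc (Suc j) \<le> k" | "Suc j < i" using j by linarith
  then show ?case
  proof cases
    case 1
    moreover have "h i k = 0" using 1 j by (intro h_far) auto
    ultimately show ?thesis using assms j u_step [of i k] by auto
  next
    case 2
    then have "h i k = 0" "h i j = 0" using j by (auto intro!: h_far)
    then show ?thesis using 2 u_y_low [of i j k] assms j by simp
  next
    case 3
    have "h i j = 0" using 3 by (intro h_far) auto
    then show ?thesis using 3 u_next_lower [of j] j by simp
  next
    case 4
    have "h i j = 0" "h i k = 0" using 4 by (auto intro!: h_far)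
    then show ?thesis using 4 u_y_same [of j k] assms j by simp
  next
    case 5
    have "h i k = 0" using 5 by (intro h_far) auto
    then show ?thesis using 5 u_next_upper [of j] assms j by simp
  next
    case 6
    then show ?thesis using u_y_succ [of j k] assms j by simp
  next
    case 7
    have hij: "h i j = 0" using 7 by (intro h_far) auto
    let ?g = "h j (Suc j)"
    have g: "?g \<noteq> 0" using h_Suc [of j] j by simp
    have IH: "\<lbrace>u i, y (Suc j) k\<rbrace> = h i (Suc j) \<odot> y i k \<oplus> h i k \<odot> y (Suc j) i"
      using step.IH by simp
    have comm: "\<lbrace>u i, \<lbrace>u j, y (Suc j) k\<rbrace>\<rbrace> = \<lbrace>u j, \<lbrace>u i, y (Suc j) k\<rbrace>\<rbrace>"
      using 7 assms j by (intro bracket_commute u_far) auto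
    have ji: "\<lbrace>u j, y (Suc j) i\<rbrace> = ?g \<odot> y j i"
      using 7 assms j m_le by (intro u_step) auto
    show ?thesis
    proof (cases "k = Suc j")
      case True
      have "(2 * ?g) \<odot> \<lbrace>u i, y j k\<rbrace> = \<lbrace>u i, \<lbrace>u j, y (Suc j) k\<rbrace>\<rbrace>"
        using True j u_diag_below [of j] by (simp add: bracket_smult_right)
      also have "\<dots> = (2 * ?g) \<odot> (h i k \<odot> y j i)"
        using True unfolding comm IH
        by (simp add: y_sym [of i "Suc j"] bracket_add_right bracket_smult_right ji smult_smult
            mult_ac flip: smult_add_left)
      finally have "\<lbrace>u i, y j k\<rbrace> = h i k \<odot> y j i" by (rule smult_cancel) (simp_all add: g)
      then show ?thesis by (simp add: hij)
    next
      case False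
      \<comment> \<open>The e_i e_k term of the induction hypothesis must disappear: either its
        coefficient is zero, or i = j + 2 and u_j kills \<open>y i k\<close>.\<close>
      have 1: "h i (Suc j) \<odot> \<lbrace>u j, y i k\<rbrace> = \<zero>"
      proof (cases "i = Suc (Suc j)")
        case True
        then show ?thesis using False u_y_low [of j i k] assms j by simp
      next
        case False
        then have "h i (Suc j) = 0" using 7 by (intro h_far) auto
        then show ?thesis by simp
      qed
      have "?g \<odot> \<lbrace>u i, y j k\<rbrace> = \<lbrace>u i, \<lbrace>u j, y (Suc j) k\<rbrace>\<rbrace>"
        using False j assms u_step [of j k] by (simp add: bracket_smult_right)
      also have "\<dots> = ?g \<odot> (h i k \<odot> y j i)"
        unfolding comm IH
        by (simp add: bracket_add_right bracket_smult_right 1 ji smult_smult mult_ac)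
      finally have "\<lbrace>u i, y j k\<rbrace> = h i k \<odot> y j i" by (rule smult_cancel) (simp_all add: g)
      then show ?thesis by (simp add: hij)
    qed
  qed
qed

text \<open>This is the derivation rule for u_i on a product e_j e_k, so the span of the
  \<open>y j k\<close> is stable under u_1, ..., u_m. The case j > k is the previous lemma read
  through the symmetry of y.\<close>

theorem u_y:
  assumes "1 \<le> i" "i \<le> m" "1 \<le> j" "j \<le> n" "1 \<le> k" "k \<le> n"
  shows "\<lbrace>u i, y j k\<rbrace> = h i j \<odot> y i k \<oplus> h i k \<odot> y j i"
proof (cases "j \<le> k")
  case True
  then show ?thesis using assms by (simp add: u_y_le)
next
  case False
  have "i \<le> n" using assms m_le by simp
  with False show ?thesis
    using assms u_y_le [of i k j] unfolding y_sym [of k j] y_sym [of k i] y_sym [of j i]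
    by (simp add: M.a_comm)
qed

end

section \<open>Construction of the off-diagonal elements from the diagonal ones\<close>

context lie_algebra
begin

text \<open>
  \<open>sym_col h u Y k d\<close> is the element \<open>e\<^sub>k\<^sub>-\<^sub>d e\<^sub>k\<close>, obtained from \<open>Y k = e\<^sub>k e\<^sub>k\<close> by applying
  \<open>u (k - 1), \<dots>, u (k - d)\<close>. The factor 2 comes from \<open>u\<^sub>k\<^sub>-\<^sub>1 (e\<^sub>k e\<^sub>k) = 2 h e\<^sub>k\<^sub>-\<^sub>1 e\<^sub>k\<close>.
\<close>

primrec sym_col :: "(nat \<Rightarrow> nat \<Rightarrow> complex) \<Rightarrow> (nat \<Rightarrow> 'a) \<Rightarrow> (nat \<Rightarrow> 'a) \<Rightarrow> nat \<Rightarrow> nat \<Rightarrow> 'a" where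
  "sym_col h u Y k 0 = Y k"
| "sym_col h u Y k (Suc d) = inverse ((if d = 0 then 2 else 1) * h (k - Suc d) (k - d)) \<odot>
     \<lbrace>u (k - Suc d), sym_col h u Y k d\<rbrace>"

definition sym_elt :: "(nat \<Rightarrow> nat \<Rightarrow> complex) \<Rightarrow> (nat \<Rightarrow> 'a) \<Rightarrow> (nat \<Rightarrow> 'a) \<Rightarrow> nat \<Rightarrow> nat \<Rightarrow> 'a" where
  "sym_elt h u Y j k = sym_col h u Y (max j k) (max j k - min j k)"

lemma sym_elt_commute: "sym_elt h u Y j k = sym_elt h u Y k j"
  by (simp add: sym_elt_def max.commute min.commute)

lemma sym_elt_diag [simp]: "sym_elt h u Y k k = Y k"
  by (simp add: sym_elt_def)

lemma sym_col_closed: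
  assumes "\<And>i. 1 \<le> i \<Longrightarrow> i < n \<Longrightarrow> u i \<in> carrier L" "\<And>k. 1 \<le> k \<Longrightarrow> k \<le> n \<Longrightarrow> Y k \<in> carrier L"
  shows "d < k \<Longrightarrow> k \<le> n \<Longrightarrow> sym_col h u Y k d \<in> carrier L"
  by (induction d) (auto simp: assms)

lemma sym_elt_closed:
  assumes "\<And>i. 1 \<le> i \<Longrightarrow> i < n \<Longrightarrow> u i \<in> carrier L" "\<And>k. 1 \<le> k \<Longrightarrow> k \<le> n \<Longrightarrow> Y k \<in> carrier L"
    and "1 \<le> j" "j \<le> n" "1 \<le> k" "k \<le> n"
  shows "sym_elt h u Y j k \<in> carrier L"
  unfolding sym_elt_def by (rule sym_col_closed [where n = n]) (use assms in auto)

lemma sym_elt_Suc: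
  assumes "\<And>i. 1 \<le> i \<Longrightarrow> i < n \<Longrightarrow> u i \<in> carrier L" "\<And>k. 1 \<le> k \<Longrightarrow> k \<le> n \<Longrightarrow> Y k \<in> carrier L"
    and "1 \<le> j" "j < k" "k \<le> n" "h j (Suc j) \<noteq> 0"
  shows "\<lbrace>u j, sym_elt h u Y (Suc j) k\<rbrace> = ((if k = Suc j then 2 else 1) * h j (Suc j)) \<odot> sym_elt h u Y j k"
proof -
  define d where "d = k - Suc j"
  define c :: complex where "c = (if k = Suc j then 2 else 1)"
  have d: "k - j = Suc d" "k - Suc d = j" "k - d = Suc j" "d = 0 \<longleftrightarrow> k = Suc j" "c \<noteq> 0"
    using assms(4) by (auto simp: d_def c_def)
  have 1: "sym_elt h u Y (Suc j) k = sym_col h u Y k d" using assms by (simp add: sym_elt_def d_def)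
  have 2: "sym_elt h u Y j k = inverse (c * h j (Suc j)) \<odot> \<lbrace>u j, sym_col h u Y k d\<rbrace>"
    using assms d by (simp add: sym_elt_def c_def)
  have "\<lbrace>u j, sym_col h u Y k d\<rbrace> \<in> carrier L"
    by (intro bracket_closed assms(1) sym_col_closed [where n = n]) (use assms d_def in auto)
  then show ?thesis
    using assms(6) d(5) unfolding 1 2 c_def [symmetric]
    by (simp add: smult_smult del: inverse_mult_distrib)
qed

text \<open>Reduces \<open>sym_elements\<close> to conditions on the diagonal family Y. The
  descending brackets hold by construction; \<open>above\<close>, \<open>lower\<close> and
  \<open>upper\<close> are the conditions on \<open>y k (Suc k)\<close> after this element has been
  eliminated through u_k Y_{k+1} = 2 h y_{k,k+1}.\<close>

lemma sym_elements_sym_elt: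
  assumes "m \<le> n" "n \<le> Suc m"
    and "\<And>i. 1 \<le> i \<Longrightarrow> i \<le> m \<Longrightarrow> u i \<in> carrier L"
    and Y: "\<And>k. 1 \<le> k \<Longrightarrow> k \<le> n \<Longrightarrow> Y k \<in> carrier L"
    and "\<And>i j. i \<noteq> Suc j \<Longrightarrow> j \<noteq> Suc i \<Longrightarrow> h i j = 0"
    and h_Suc: "\<And>i. 1 \<le> i \<Longrightarrow> i < n \<Longrightarrow> h i (Suc i) \<noteq> 0"
    and "\<And>i j. 1 \<le> i \<Longrightarrow> i \<le> m \<Longrightarrow> 1 \<le> j \<Longrightarrow> j \<le> m \<Longrightarrow> i \<noteq> Suc j \<Longrightarrow> j \<noteq> Suc i \<Longrightarrow> \<lbrace>u i, u j\<rbrace> = \<zero>"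
    and "\<And>i j. 1 \<le> i \<Longrightarrow> i \<le> m \<Longrightarrow> 1 \<le> j \<Longrightarrow> j \<le> m \<Longrightarrow> i = Suc j \<or> j = Suc i \<Longrightarrow>
      \<lbrace>u i, \<lbrace>u i, u j\<rbrace>\<rbrace> = (- 2 * (h i j * h j i)) \<odot> u i"
    and "\<And>i k. 1 \<le> i \<Longrightarrow> i \<le> m \<Longrightarrow> 1 \<le> k \<Longrightarrow> k \<le> n \<Longrightarrow> i \<noteq> Suc k \<Longrightarrow> k \<noteq> Suc i \<Longrightarrow>
      \<lbrace>u i, Y k\<rbrace> = \<zero>"
    and above: "\<And>k. 1 \<le> k \<Longrightarrow> Suc k \<le> m \<Longrightarrow>
      h k (Suc k) \<odot> \<lbrace>u (Suc k), Y k\<rbrace> = h (Suc k) k \<odot> \<lbrace>u k, Y (Suc k)\<rbrace>"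
    and lower: "\<And>k. 1 \<le> k \<Longrightarrow> k < n \<Longrightarrow> 
      \<lbrace>u k, \<lbrace>u k, Y (Suc k)\<rbrace>\<rbrace> = (2 * h k (Suc k) * h k (Suc k)) \<odot> Y k"
    and upper: "\<And>k. 1 \<le> k \<Longrightarrow> Suc k \<le> m \<Longrightarrow>
      \<lbrace>u (Suc k), \<lbrace>u k, Y (Suc k)\<rbrace>\<rbrace> = (2 * h k (Suc k) * h (Suc k) k) \<odot> Y (Suc k)"
  shows "sym_elements L m n h u (sym_elt h u Y)"
proof -
  let ?y = "sym_elt h u Y"
  have u: "u i \<in> carrier L" if "1 \<le> i" "i < n" for i using assms that by auto
  have y: "?y j k \<in> carrier L" if "1 \<le> j" "j \<le> n" "1 \<le> k" "k \<le> n" for j k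
    using that by (intro sym_elt_closed [of n] u assms)
  have step: "\<lbrace>u j, ?y (Suc j) k\<rbrace> = ((if k = Suc j then 2 else 1) * h j (Suc j)) \<odot> ?y j k"
    if "1 \<le> j" "j < k" "k \<le> n" for j k
    by (rule sym_elt_Suc [of n]) (use u Y h_Suc that in auto)
  have below: "\<lbrace>u k, Y (Suc k)\<rbrace> = (2 * h k (Suc k)) \<odot> ?y k (Suc k)" if "1 \<le> k" "k < n" for k
    using step [of k "Suc k"] that by simp
  show ?thesis
  proof (unfold_locales; (rule sym_elt_commute | simp only: sym_elt_diag)?)
    fix j k assume "1 \<le> j" "Suc j < k" "k \<le> n"
    then show "\<lbrace>u j, ?y (Suc j) k\<rbrace> = h j (Suc j) \<odot> ?y j k"
      using step [of j k] by simp
  next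
    fix k assume k: "1 \<le> k" "Suc k \<le> m"
    then have [simp]: "?y k (Suc k) \<in> carrier L" "u (Suc k) \<in> carrier L" "Y k \<in> carrier L" "Y (Suc k) \<in> carrier L"
      and ne: "h k (Suc k) \<noteq> 0" using assms y by auto
    have "h k (Suc k) \<odot> \<lbrace>u (Suc k), Y k\<rbrace> = h k (Suc k) \<odot> ((2 * h (Suc k) k) \<odot> ?y k (Suc k))"
      using k assms(1) by (simp add: above below smult_smult mult_ac)
    then show "\<lbrace>u (Suc k), Y k\<rbrace> = (2 * h (Suc k) k) \<odot> ?y k (Suc k)"
      by (rule smult_cancel) (simp_all add: ne)
    have "(2 * h k (Suc k)) \<odot> \<lbrace>u (Suc k), ?y k (Suc k)\<rbrace> = (2 * h k (Suc k)) \<odot> (h (Suc k) k \<odot> Y (Suc k))"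
      using upper [of k] k assms(1) by (simp add: below bracket_smult_right smult_smult)
    then show "\<lbrace>u (Suc k), ?y k (Suc k)\<rbrace> = h (Suc k) k \<odot> Y (Suc k)"
      by (rule smult_cancel) (simp_all add: ne)
  next
    fix k assume k: "1 \<le> k" "k < n"
    then have [simp]: "?y k (Suc k) \<in> carrier L" "u k \<in> carrier L" "Y k \<in> carrier L" "Y (Suc k) \<in> carrier L"
      and ne: "h k (Suc k) \<noteq> 0" using assms y u by auto
    show "\<lbrace>u k, Y (Suc k)\<rbrace> = (2 * h k (Suc k)) \<odot> ?y k (Suc k)" using k by (rule below)
    have "(2 * h k (Suc k)) \<odot> \<lbrace>u k, ?y k (Suc k)\<rbrace> = (2 * h k (Suc k)) \<odot> (h k (Suc k) \<odot> Y k)"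
      using lower [of k] k assms(1) by (simp add: below bracket_smult_right smult_smult)
    then show "\<lbrace>u k, ?y k (Suc k)\<rbrace> = h k (Suc k) \<odot> Y k"
      by (rule smult_cancel) (simp_all add: ne)
  qed (use assms y in auto)
qed

end

section \<open>The diagonal elements in the symplectic Lie algebra\<close>

locale sp_elements = lie_algebra L for L :: "('a, 'b) lie_alg_scheme" (structure) +
  fixes n :: nat and b :: "nat \<Rightarrow> complex" and u :: "nat \<Rightarrow> 'a"
  assumes n_ge: "2 \<le> n"
    and u_closed [simp]: "1 \<le> i \<Longrightarrow> i \<le> n \<Longrightarrow> u i \<in> carrier L"
    and u_far: "1 \<le> i \<Longrightarrow> i \<le> n \<Longrightarrow> 1 \<le> j \<Longrightarrow> j \<le> n \<Longrightarrow> i \<noteq> Suc j \<Longrightarrow> j \<noteq> Suc i \<Longrightarrow> \<lbrace>u i, u j\<rbrace> = \<zero>"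
    and serre_upper: "1 \<le> i \<Longrightarrow> Suc i < n \<Longrightarrow> \<lbrace>u i, \<lbrace>u i, u (Suc i)\<rbrace>\<rbrace> = (- 2 * b i) \<odot> u i"
    and serre_lower: "1 \<le> i \<Longrightarrow> Suc i \<le> n \<Longrightarrow> \<lbrace>u (Suc i), \<lbrace>u (Suc i), u i\<rbrace>\<rbrace> = (- 2 * b i) \<odot> u (Suc i)"
    and serre_long: "\<lbrace>u (n - 1), \<lbrace>u (n - 1), \<lbrace>u (n - 1), u n\<rbrace>\<rbrace>\<rbrace> = \<zero>"
begin

text \<open>\<open>diag k\<close> is \<open>e\<^sub>k e\<^sub>k = u\<^sub>k (u\<^sub>k (e\<^sub>k\<^sub>+\<^sub>1 e\<^sub>k\<^sub>+\<^sub>1)) / 2\<close>, starting from \<open>e\<^sub>n e\<^sub>n = u\<^sub>n\<close>.\<close>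

primrec diag_from_top :: "nat \<Rightarrow> 'a" where
  "diag_from_top 0 = u n"
| "diag_from_top (Suc d) = inverse 2 \<odot> \<lbrace>u (n - Suc d), \<lbrace>u (n - Suc d), diag_from_top d\<rbrace>\<rbrace>"

definition diag :: "nat \<Rightarrow> 'a" where
  "diag k = diag_from_top (n - k)"

lemma diag_top [simp]: "diag n = u n"
  by (simp add: diag_def)

lemma diag_rec: "k < n \<Longrightarrow> diag k = inverse 2 \<odot> \<lbrace>u k, \<lbrace>u k, diag (Suc k)\<rbrace>\<rbrace>"
  using diag_from_top.simps(2) [of "n - Suc k"]
    by (simp add: diag_def Suc_diff_Suc del: diag_from_top.simps)

lemma diag_closed [simp]:
  assumes "1 \<le> k" "k \<le> n"
  shows "diag k \<in> carrier L"
  using assms(2,1) by (induction k rule: inc_induct) (use n_ge in \<open>auto simp: diag_rec\<close>)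

text \<open>The four facts support one another and are proved by one strong induction that descends
  from k = n. The vanishing at k refers back to both k + 1 and k + 2.\<close>

lemma diag_facts:
  assumes "1 \<le> k" "k \<le> n"
  shows "(\<forall>i. 1 \<le> i \<longrightarrow> i < n \<longrightarrow> i \<noteq> Suc k \<longrightarrow> k \<noteq> Suc i \<longrightarrow> \<lbrace>u i, diag k\<rbrace> = \<zero>) \<and>
    (\<forall>i\<ge>1. k = Suc i \<longrightarrow> \<lbrace>u i, \<lbrace>u i, \<lbrace>u i, diag k\<rbrace>\<rbrace>\<rbrace> = \<zero>) \<and>
    (\<forall>i\<ge>1. k = Suc i \<longrightarrow> k < n \<longrightarrow> \<lbrace>u k, \<lbrace>u i, diag k\<rbrace>\<rbrace> = (2 * b i) \<odot> diag k) \<and>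
    (Suc k < n \<longrightarrow> \<lbrace>u (Suc k), diag k\<rbrace> = b k \<odot> \<lbrace>u k, diag (Suc k)\<rbrace>)"
  using assms
proof (induction "n - k" arbitrary: k rule: less_induct)
  case less
  show ?case
  proof (cases "k = n")
    case True
    then have dk: "diag k = u n" by simp
    \<comment> \<open>At k = n the cubic identity is the relation of the double edge; for smaller k
      it will follow from the quadratic Serre relations.\<close>
    show ?thesis unfolding dk using True n_ge serre_long by (auto intro!: u_far)
  next
    case False
    let ?z = "diag (Suc k)" and ?c = "u k"
    have k: "1 \<le> k" "k < n" using less.prems False by auto
    have rec: "diag k = inverse 2 \<odot> \<lbrace>?c, \<lbrace>?c, ?z\<rbrace>\<rbrace>" using k by (rule_tac diag_rec)
    have [simp]: "?c \<in> carrier L" "?z \<in> carrier L" using k by auto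
    have far: "\<lbrace>u i, ?z\<rbrace> = \<zero>" if "1 \<le> i" "i < n" "i \<noteq> Suc (Suc k)" "i \<noteq> k" for i
      using less.hyps [of "Suc k"] k that by auto
    have cube: "\<lbrace>?c, \<lbrace>?c, \<lbrace>?c, ?z\<rbrace>\<rbrace>\<rbrace> = \<zero>"
      using less.hyps [of "Suc k"] k by auto
    have d0: "\<lbrace>u i, diag k\<rbrace> = \<zero>" if i: "1 \<le> i" "i < n" "i \<noteq> Suc k" "k \<noteq> Suc i" for i
    proof -
      have [simp]: "u i \<in> carrier L" using i by simp
      have "\<lbrace>u i, \<lbrace>?c, \<lbrace>?c, ?z\<rbrace>\<rbrace>\<rbrace> = \<zero>"
      proof (cases "i = k")
        case True
        then show ?thesis using cube by simp
      next
        case False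
        have "\<lbrace>u i, ?c\<rbrace> = \<zero>" using i k by (intro u_far) auto
        then have comm: "\<lbrace>u i, \<lbrace>?c, \<lbrace>?c, ?z\<rbrace>\<rbrace>\<rbrace> = \<lbrace>?c, \<lbrace>?c, \<lbrace>u i, ?z\<rbrace>\<rbrace>\<rbrace>"
          by (simp add: bracket_commute [of "u i" ?c "\<lbrace>?c, ?z\<rbrace>"] bracket_commute [of "u i" ?c ?z])
        show ?thesis
        \<comment> \<open>For i = k + 2 the bracket of u_i with \<open>?z\<close> need not vanish:
          it is b_{k+1} u_{k+1} \<open>?w\<close> with \<open>?w\<close> = e_{k+2} e_{k+2}. As u_k
          kills \<open>?w\<close>, \<open>serre_kill\<close> finishes this case.\<close>
        proof (cases "i = Suc (Suc k)")
          case True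
          let ?w = "diag (Suc (Suc k))"
          have [simp]: "u (Suc k) \<in> carrier L" "?w \<in> carrier L" using True i by simp_all
          have "\<lbrace>?c, ?w\<rbrace> = \<zero>"
            using less.hyps [of "Suc (Suc k)"] True i k by auto
          then have "\<lbrace>?c, \<lbrace>?c, \<lbrace>u (Suc k), ?w\<rbrace>\<rbrace>\<rbrace> = \<zero>"
            using True i k by (intro serre_kill [OF serre_upper]) auto
          moreover have "\<lbrace>u i, ?z\<rbrace> = b (Suc k) \<odot> \<lbrace>u (Suc k), ?w\<rbrace>"
            using less.hyps [of "Suc k"] True i k by auto
          ultimately show ?thesis unfolding comm by (simp add: bracket_smult_right)
        next
          case False
          with \<open>i \<noteq> k\<close> show ?thesis unfolding comm using far i by simp
        qed
      qed
      then show ?thesis unfolding rec by (simp add: bracket_smult_right)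
    qed
    have d2: "\<lbrace>u i, \<lbrace>u i, \<lbrace>u i, diag k\<rbrace>\<rbrace>\<rbrace> = \<zero>" if "1 \<le> i" "k = Suc i" for i
    proof -
      have "\<lbrace>u i, \<lbrace>u i, \<lbrace>u i, \<lbrace>?c, \<lbrace>?c, ?z\<rbrace>\<rbrace>\<rbrace>\<rbrace>\<rbrace> = \<zero>"
        unfolding \<open>k = Suc i\<close>
        using that k far by (intro serre_cube [OF serre_upper]) auto
      then show ?thesis unfolding rec using that k by (simp add: bracket_smult_right)
    qed
    \<comment> \<open>\<open>serre_square_middle\<close> with c = u_k and a = u_{k-1}; here \<gamma>
      = -2 b_{k-1}.\<close>
    have d3: "\<lbrace>?c, \<lbrace>u i, diag k\<rbrace>\<rbrace> = (2 * b i) \<odot> diag k" if "1 \<le> i" "k = Suc i" for i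
    proof -
      have "\<lbrace>?c, \<lbrace>u i, \<lbrace>?c, \<lbrace>?c, ?z\<rbrace>\<rbrace>\<rbrace>\<rbrace> = (- (- 2 * b i)) \<odot> \<lbrace>?c, \<lbrace>?c, ?z\<rbrace>\<rbrace>"
        using that k far cube serre_lower [of i] by (intro serre_square_middle) auto
      then show ?thesis unfolding rec using that k by (simp add: bracket_smult_right smult_smult)
    qed
    \<comment> \<open>The third fact at k + 1 supplies t = 2 b_k in \<open>serre_square\<close>.
      With \<gamma> = -2 b_k the coefficient 2 t + \<gamma> is 2 b_k, and the one half in
      \<open>diag\<close> leaves b_k.\<close>
    have d1: "\<lbrace>u (Suc k), diag k\<rbrace> = b k \<odot> \<lbrace>?c, ?z\<rbrace>" if "Suc k < n"
    proof -
      have "\<lbrace>u (Suc k), \<lbrace>?c, \<lbrace>?c, ?z\<rbrace>\<rbrace>\<rbrace> = (2 * (2 * b k) + (- 2 * b k)) \<odot> \<lbrace>?c, ?z\<rbrace>"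
        using that k less.hyps [of "Suc k"] far by (intro serre_square [OF serre_upper]) auto
      then show ?thesis unfolding rec using that k by (simp add: bracket_smult_right smult_smult)
    qed
    from d0 d1 d2 d3 show ?thesis by blast
  qed
qed

end

lemma gen_row_mult: "i = Suc j \<or> j = Suc i \<Longrightarrow> gen_row b i j * gen_row b j i = b (min i j)"
  by (auto simp: gen_row_def)

text \<open>Only u_1, ..., u_{n-1} act as operators on V, since u_n is the tensor e_n e_n. The
  conditions on the diagonal come from \<open>diag_facts\<close> and from the recursion for
  \<open>diag\<close>.\<close>

sublocale sp_elements \<subseteq> sym_elements L "n - 1" n "gen_row b" u "sym_elt (gen_row b) u diag"
proof (rule sym_elements_sym_elt)
  fix i j assume "1 \<le> i" "i \<le> n - 1" "1 \<le> j" "j \<le> n - 1" "i = Suc j \<or> j = Suc i"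
  then show "\<lbrace>u i, \<lbrace>u i, u j\<rbrace>\<rbrace> = (- 2 * (gen_row b i j * gen_row b j i)) \<odot> u i"
    using serre_upper [of i] serre_lower [of j] by (auto simp: gen_row_mult)
next
  fix k assume "1 \<le> k" "k < n"
  then show "\<lbrace>u k, \<lbrace>u k, diag (Suc k)\<rbrace>\<rbrace> = (2 * gen_row b k (Suc k) * gen_row b k (Suc k)) \<odot> diag k"
    by (simp add: diag_rec gen_row_def smult_smult)
next
  fix k assume k: "1 \<le> k" "Suc k \<le> n - 1"
  then have [simp]: "diag (Suc k) \<in> carrier L" "diag k \<in> carrier L" "u k \<in> carrier L" "u (Suc k) \<in> carrier L" by auto
  show "gen_row b k (Suc k) \<odot> \<lbrace>u (Suc k), diag k\<rbrace> = gen_row b (Suc k) k \<odot> \<lbrace>u k, diag (Suc k)\<rbrace>"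
    using k diag_facts [of k] by (simp add: gen_row_def)
  show "\<lbrace>u (Suc k), \<lbrace>u k, diag (Suc k)\<rbrace>\<rbrace> =
      (2 * gen_row b k (Suc k) * gen_row b (Suc k) k) \<odot> diag (Suc k)"
    using k diag_facts [of "Suc k"] by (simp add: gen_row_def)
next
  fix i k assume "1 \<le> i" "i \<le> n - 1" "1 \<le> k" "k \<le> n" "i \<noteq> Suc k" "k \<noteq> Suc i"
  then show "\<lbrace>u i, diag k\<rbrace> = \<zero>" using diag_facts [of k] n_ge by auto
qed (auto simp: u_far gen_row_def)

section \<open>Coordinates in the symmetric square\<close>

text \<open>
  The tensor \<open>(e\<^sub>j \<otimes> e\<^sub>k + e\<^sub>k \<otimes> e\<^sub>j) / 2\<close>, with indices \<open>j, k\<close> starting from 1.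
\<close>

definition esym :: "nat \<Rightarrow> nat \<Rightarrow> nat \<Rightarrow> complex mat" where
  "esym n j k = mat n n (\<lambda>(r, s). (of_bool (r + 1 = j \<and> s + 1 = k) + of_bool (r + 1 = k \<and> s + 1 = j)) / 2)"

text \<open>The matrix of e_j \<mapsto> g_j e_i. The generators of sl_n and the operators attached
  to the tensors e_i e_i both have this shape.\<close>

definition unit_row :: "nat \<Rightarrow> nat \<Rightarrow> (nat \<Rightarrow> complex) \<Rightarrow> complex mat" where
  "unit_row n i g = mat n n (\<lambda>(r, s). if r + 1 = i then g (s + 1) else 0)"

lemma esym_carrier [simp]: "esym n j k \<in> carrier_mat n n" "dim_row (esym n j k) = n" "dim_col (esym n j k) = n"
  by (simp_all add: esym_def)

lemma esym_index: "r < n \<Longrightarrow> s < n \<Longrightarrow>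
    esym n j k $$ (r, s) = (of_bool (r + 1 = j \<and> s + 1 = k) + of_bool (r + 1 = k \<and> s + 1 = j)) / 2"
  by (simp add: esym_def)

lemma esym_transpose [simp]: "(esym n j k)\<^sup>T = esym n j k"
  by (rule eq_matI) (simp_all add: esym_index conj_commute add.commute)

lemma esym_commute: "esym n j k = esym n k j"
  by (rule eq_matI) (simp_all add: esym_index add.commute)

lemma esym_sym2 [simp]: "esym n j k \<in> carrier (sym2 n)"
  by (simp add: sym2_def)

lemma unit_row_carrier [simp]: "unit_row n i g \<in> carrier_mat n n"
  "dim_row (unit_row n i g) = n" "dim_col (unit_row n i g) = n"
  by (simp_all add: unit_row_def)

lemma sl_gen_mat_unit_row: "sl_gen_mat n c i = unit_row n i (gen_row c i)"
  by (simp add: sl_gen_mat_row_mat row_mat_def unit_row_def)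

lemma tensor_act_sym_index:
  assumes "A \<in> carrier_mat n n" "T \<in> carrier_mat n n" "T\<^sup>T = T" "r < n" "s < n"
  shows "tensor_act A T $$ (r, s) = (A * T) $$ (r, s) + (A * T) $$ (s, r)"
proof -
  have "T * A\<^sup>T = (A * T)\<^sup>T" using assms by (simp add: transpose_mult [of _ n n _ n])
  then show ?thesis using assms by (simp add: tensor_act_def)
qed

lemma unit_row_esym:
  assumes "1 \<le> j" "j \<le> n" "1 \<le> k" "k \<le> n" "r < n" "s < n"
  shows "(unit_row n i g * esym n j k) $$ (r, s) =
    (if r + 1 = i then (g j * of_bool (s + 1 = k) + g k * of_bool (s + 1 = j)) / 2 else 0)"
proof -
  obtain j' k' where jk: "j = Suc j'" "k = Suc k'" "j' < n" "k' < n"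
    using assms by (cases j; cases k) auto
  have "(unit_row n i g * esym n j k) $$ (r, s) =
      (\<Sum>t<n. (if r + 1 = i then g (t + 1) else 0) * esym n j k $$ (t, s))"
    using assms by (simp add: unit_row_def scalar_prod_def lessThan_atLeast0)
  also have "\<dots> = (\<Sum>t<n. (if t = j' then (if r + 1 = i \<and> s = k' then g j / 2 else 0) else 0) +
      (if t = k' then (if r + 1 = i \<and> s = j' then g k / 2 else 0) else 0))"
    using assms jk by (intro sum.cong) (auto simp: esym_index)
  also have "\<dots> = (if r + 1 = i then (g j * of_bool (s + 1 = k) + g k * of_bool (s + 1 = j)) / 2 else 0)"
    using jk by (simp add: sum.distrib)
  finally show ?thesis .
qed

text \<open>The matrix counterpart of \<open>u_y\<close>: it lets relations among the
  \<open>y j k\<close> be compared with relations among the \<open>esym n j k\<close>.\<close>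

lemma tensor_act_unit_row:
  assumes "1 \<le> j" "j \<le> n" "1 \<le> k" "k \<le> n"
  shows "tensor_act (unit_row n i g) (esym n j k) = g j \<cdot>\<^sub>m esym n i k + g k \<cdot>\<^sub>m esym n j i"
proof (rule eq_matI)
  fix r s assume "r < dim_row (g j \<cdot>\<^sub>m esym n i k + g k \<cdot>\<^sub>m esym n j i)"
    "s < dim_col (g j \<cdot>\<^sub>m esym n i k + g k \<cdot>\<^sub>m esym n j i)"
  then have rs: "r < n" "s < n" by auto
  then have "tensor_act (unit_row n i g) (esym n j k) $$ (r, s) =
      (unit_row n i g * esym n j k) $$ (r, s) + (unit_row n i g * esym n j k) $$ (s, r)"
    by (intro tensor_act_sym_index) auto
  also have "\<dots> = (g j \<cdot>\<^sub>m esym n i k + g k \<cdot>\<^sub>m esym n j i) $$ (r, s)"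
    unfolding unit_row_esym [OF assms rs] unit_row_esym [OF assms rs(2,1)]
    using rs by (auto simp: esym_index field_simps)
  finally show "tensor_act (unit_row n i g) (esym n j k) $$ (r, s) =
    (g j \<cdot>\<^sub>m esym n i k + g k \<cdot>\<^sub>m esym n j i) $$ (r, s)" .
qed (simp_all add: tensor_act_def)

text \<open>A linear map with these values on the \<open>y j k\<close> makes them independent apart
  from y_{jk} = y_{kj}, and so identifies their span with the symmetric square.\<close>

locale sym_coordinates = lie_algebra L for L :: "('a, 'b) lie_alg_scheme" (structure) +
  fixes n :: nat and y :: "nat \<Rightarrow> nat \<Rightarrow> 'a" and \<psi> :: "'a \<Rightarrow> complex mat"
  assumes basis_closed [simp]: "1 \<le> j \<Longrightarrow> j \<le> n \<Longrightarrow> 1 \<le> k \<Longrightarrow> k \<le> n \<Longrightarrow> y j k \<in> carrier L"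
    and basis_sym: "y j k = y k j"
    and coord_closed [simp]: "x \<in> carrier L \<Longrightarrow> \<psi> x \<in> carrier_mat n n"
    and coord_add: "x \<in> carrier L \<Longrightarrow> z \<in> carrier L \<Longrightarrow> \<psi> (x \<oplus> z) = \<psi> x + \<psi> z"
    and coord_smult: "x \<in> carrier L \<Longrightarrow> \<psi> (a \<odot> x) = a \<cdot>\<^sub>m \<psi> x"
    and coord_basis: "1 \<le> j \<Longrightarrow> j \<le> n \<Longrightarrow> 1 \<le> k \<Longrightarrow> k \<le> n \<Longrightarrow> \<psi> (y j k) = esym n j k"
begin

lemma coord_zero: "\<psi> \<zero> = 0\<^sub>m n n"
proof -
  have "\<psi> \<zero> = 0 \<cdot>\<^sub>m \<psi> \<zero>" using coord_smult [of "\<zero>" 0] by simp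
  also have "\<dots> = 0\<^sub>m n n"
    using coord_closed [of "\<zero>"] by (intro eq_matI) (auto simp del: coord_closed)
  finally show ?thesis .
qed

text \<open>The section of \<psi>. The sum runs over ordered pairs, so an off-diagonal
  \<open>y j k\<close> is counted twice, in agreement with the one half in \<open>esym\<close>.
  \<open>Suc\<close> passes from matrix indices to indices of y.\<close>

definition sym_comb :: "complex mat \<Rightarrow> 'a" where
  "sym_comb T = (\<Oplus>p\<in>{..<n} \<times> {..<n}. T $$ p \<odot> y (Suc (fst p)) (Suc (snd p)))"

lemma term_closed [simp]: "p \<in> {..<n} \<times> {..<n} \<Longrightarrow> y (Suc (fst p)) (Suc (snd p)) \<in> carrier L"
  by auto

lemma sym_comb_in_submodule:
  assumes "submodule class_ring S L" "\<And>j k. 1 \<le> j \<Longrightarrow> j \<le> n \<Longrightarrow> 1 \<le> k \<Longrightarrow> k \<le> n \<Longrightarrow> y j k \<in> S"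
  shows "sym_comb T \<in> S"
proof -
  note S = submoduleD [OF assms(1)]
  have "(\<Oplus>p\<in>A. T $$ p \<odot> y (Suc (fst p)) (Suc (snd p))) \<in> S" if "finite A" "A \<subseteq> {..<n} \<times> {..<n}" for A
    using that
  proof (induction A)
    case (insert p A)
    have "T $$ p \<odot> y (Suc (fst p)) (Suc (snd p)) \<in> S"
      using insert.prems by (intro S(4) assms(2)) auto
    moreover have "(\<lambda>p. T $$ p \<odot> y (Suc (fst p)) (Suc (snd p))) \<in> A \<rightarrow> carrier L"
      using insert.prems by (intro Pi_I smult_carrier term_closed) auto
    ultimately show ?case using insert S(1,3) by (subst M.finsum_insert) auto
  qed (simp add: S)
  then show ?thesis by (simp add: sym_comb_def)
qed

lemma sym_comb_closed [simp]: "sym_comb T \<in> carrier L"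
  by (rule sym_comb_in_submodule) (auto intro!: submoduleI)

lemma sym_comb_add:
  assumes "S \<in> carrier_mat n n" "T \<in> carrier_mat n n"
  shows "sym_comb (S + T) = sym_comb S \<oplus> sym_comb T"
proof -
  have "sym_comb (S + T) = (\<Oplus>p\<in>{..<n} \<times> {..<n}. S $$ p \<odot> y (Suc (fst p)) (Suc (snd p)) \<oplus>
      T $$ p \<odot> y (Suc (fst p)) (Suc (snd p)))"
    unfolding sym_comb_def using assms
    by (intro M.finsum_cong' Pi_I) (auto simp: smult_add_left)
  also have "\<dots> = sym_comb S \<oplus> sym_comb T"
    unfolding sym_comb_def by (intro M.finsum_addf Pi_I smult_carrier term_closed)
  finally show ?thesis .
qed

lemma sym_comb_smult:
  assumes "T \<in> carrier_mat n n"
  shows "sym_comb (a \<cdot>\<^sub>m T) = a \<odot> sym_comb T"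
proof -
  have "sym_comb (a \<cdot>\<^sub>m T) = (\<Oplus>p\<in>{..<n} \<times> {..<n}. a \<odot> (T $$ p \<odot> y (Suc (fst p)) (Suc (snd p))))"
    unfolding sym_comb_def using assms
    by (intro M.finsum_cong' Pi_I) (auto simp: smult_smult)
  also have "\<dots> = a \<odot> sym_comb T"
    unfolding sym_comb_def by (intro finsum_smult [symmetric] Pi_I) auto
  finally show ?thesis .
qed

lemma sym_comb_esym:
  assumes "1 \<le> j" "j \<le> n" "1 \<le> k" "k \<le> n"
  shows "sym_comb (esym n j k) = y j k"
proof -
  let ?A = "{..<n} \<times> {..<n}" and ?f = "\<lambda>p. inverse 2 \<odot> y (Suc (fst p)) (Suc (snd p))"
  obtain j' k' where jk: "j = Suc j'" "k = Suc k'" "j' < n" "k' < n"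
    using assms by (cases j; cases k) auto
  have f: "?f \<in> ?A \<rightarrow> carrier L" by (intro Pi_I smult_carrier term_closed)
  have f': "(\<lambda>p. if q = p then ?f p else \<zero>) \<in> ?A \<rightarrow> carrier L" for q using f by auto
  have "sym_comb (esym n j k) =
      (\<Oplus>p\<in>?A. (if (j', k') = p then ?f p else \<zero>) \<oplus> (if (k', j') = p then ?f p else \<zero>))"
    unfolding sym_comb_def
  proof (intro M.finsum_cong' Pi_I)
    fix p assume p: "p \<in> ?A"
    have e: "esym n j k $$ p = (of_bool ((j', k') = p) + of_bool ((k', j') = p)) / 2"
      using p jk by (cases p) (simp add: esym_index eq_commute [of j'] eq_commute [of k'])
    show "esym n j k $$ p \<odot> y (Suc (fst p)) (Suc (snd p)) =
        (if (j', k') = p then ?f p else \<zero>) \<oplus> (if (k', j') = p then ?f p else \<zero>)"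
      unfolding e using term_closed [OF p]
      by (cases "(j', k') = p"; cases "(k', j') = p") (simp_all flip: smult_add_left)
  qed (use f in auto)
  also have "\<dots> = inverse 2 \<odot> y j k \<oplus> inverse 2 \<odot> y k j"
    using jk f f' by (simp add: M.finsum_addf M.finsum_singleton)
  also have "\<dots> = y j k" using assms by (simp add: basis_sym [of k j] flip: smult_add_left)
  finally show ?thesis .
qed

lemma coord_finsum:
  assumes "finite A" "F \<in> A \<rightarrow> carrier L" "r < n" "s < n"
  shows "\<psi> (finsum L F A) $$ (r, s) = (\<Sum>p\<in>A. \<psi> (F p) $$ (r, s))"
  using assms(1,2)
proof (induction A)
  case empty
  then show ?case using assms by (simp add: coord_zero)
next
  case (insert p A)
  then have "finsum L F A \<in> carrier L" by (intro M.finsum_closed) auto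
  moreover from this have "dim_row (\<psi> (finsum L F A)) = n" "dim_col (\<psi> (finsum L F A)) = n"
    using coord_closed by blast+
  ultimately show ?case using insert assms by (auto simp: coord_add)
qed

lemma coord_sym_comb:
  assumes "T \<in> carrier (sym2 n)"
  shows "\<psi> (sym_comb T) = T"
proof (rule eq_matI)
  have T: "T \<in> carrier_mat n n" "T\<^sup>T = T" using assms by (auto simp: sym2_def)
  fix r s assume "r < dim_row T" "s < dim_col T"
  then have rs: "r < n" "s < n" using T by auto
  have "T $$ (s, r) = T\<^sup>T $$ (r, s)" using T(1) rs by auto
  then have sym: "T $$ (s, r) = T $$ (r, s)" using T by simp
  have "\<psi> (sym_comb T) $$ (r, s) =
      (\<Sum>p\<in>{..<n} \<times> {..<n}. \<psi> (T $$ p \<odot> y (Suc (fst p)) (Suc (snd p))) $$ (r, s))"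
    unfolding sym_comb_def using rs by (intro coord_finsum Pi_I smult_carrier term_closed) auto
  also have "\<dots> = (\<Sum>(i, j)\<in>{..<n} \<times> {..<n}. T $$ (i, j) * esym n (Suc i) (Suc j) $$ (r, s))"
    using rs by (intro sum.cong) (auto simp: coord_smult coord_basis)
  \<comment> \<open>The entry (r, s) collects one half from the pair (r, s) and one half from (s,
    r); symmetry of T makes them add up.\<close>
  also have "\<dots> = (\<Sum>i<n. \<Sum>j<n. (if s = j then (if r = i then T $$ (r, s) / 2 else 0) else 0) +
      (if r = j then (if s = i then T $$ (s, r) / 2 else 0) else 0))"
    unfolding sum.cartesian_product [symmetric] using rs
    by (intro sum.cong) (auto simp: esym_index)
  also have "\<dots> = T $$ (r, s)" using rs by (simp add: sum.distrib sym)
  finally show "\<psi> (sym_comb T) $$ (r, s) = T $$ (r, s)" .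
qed (use assms coord_closed [of "sym_comb T"] in \<open>auto simp: sym2_def simp del: coord_closed\<close>)

text \<open>The span of the \<open>y j k\<close>, encoded as the elements recovered from their
  coordinates. Bijectivity of \<psi> is then immediate; that it is the smallest submodule containing
  the \<open>y j k\<close> is shown in \<open>sym_span_least\<close>.\<close>

definition sym_span :: "'a set" where
  "sym_span = {x \<in> carrier L. \<psi> x \<in> carrier (sym2 n) \<and> sym_comb (\<psi> x) = x}"

lemma sym_span_eq: "sym_span = sym_comb ` carrier (sym2 n)"
  by (force simp: sym_span_def coord_sym_comb)

lemma sym_span_submodule: "submodule class_ring sym_span L"
proof (rule submoduleI)
  have "sym_comb (0 \<cdot>\<^sub>m 0\<^sub>m n n) = \<zero>" by (subst sym_comb_smult) simp_all
  moreover have "0 \<cdot>\<^sub>m 0\<^sub>m n n = (0\<^sub>m n n :: complex mat)" by (rule eq_matI) auto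
  ultimately show "\<zero> \<in> sym_span" by (simp add: sym_span_def coord_zero sym2_def)
qed (auto simp: sym_span_def sym2_def coord_add coord_smult sym_comb_add sym_comb_smult
    transpose_add [of _ n n] transpose_smult)

lemma basis_in_sym_span: "1 \<le> j \<Longrightarrow> j \<le> n \<Longrightarrow> 1 \<le> k \<Longrightarrow> k \<le> n \<Longrightarrow> y j k \<in> sym_span"
  by (simp add: sym_span_def coord_basis sym_comb_esym)

lemma sym_span_least:
  assumes "submodule class_ring S L" "\<And>j k. 1 \<le> j \<Longrightarrow> j \<le> n \<Longrightarrow> 1 \<le> k \<Longrightarrow> k \<le> n \<Longrightarrow> y j k \<in> S"
  shows "sym_span \<subseteq> S"
  unfolding sym_span_eq using sym_comb_in_submodule [OF assms] by auto

lemma coord_bij: "bij_betw \<psi> sym_span (carrier (sym2 n))"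
  by (rule bij_betw_byWitness [where f' = sym_comb]) (auto simp: sym_span_def coord_sym_comb)

lemma bracket_sym_span:
  assumes "x \<in> carrier L" "\<And>j k. 1 \<le> j \<Longrightarrow> j \<le> n \<Longrightarrow> 1 \<le> k \<Longrightarrow> k \<le> n \<Longrightarrow> \<lbrace>x, y j k\<rbrace> \<in> sym_span"
    and "z \<in> sym_span"
  shows "\<lbrace>x, z\<rbrace> \<in> sym_span"
proof -
  note S = submoduleD [OF sym_span_submodule]
  have "submodule class_ring {z \<in> carrier L. \<lbrace>x, z\<rbrace> \<in> sym_span} L"
    using assms(1) by (intro submoduleI) (auto simp: S bracket_add_right bracket_smult_right)
  from sym_span_least [OF this] assms show ?thesis by auto
qed

end

section \<open>The matrix model\<close>

text \<open>
  An alternating form \<open>\<Omega>\<close> is invariant under \<open>u\<^sub>i\<close> iff \<open>\<Omega>(e\<^sub>i, -)\<close> is a multiple of the row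
  \<open>gen_row b i\<close>; comparing coefficients leads to
  \<open>\<Omega>\<^sub>i\<^sub>,\<^sub>i\<^sub>+\<^sub>1 = - b\<^sub>i \<Omega>\<^sub>i\<^sub>+\<^sub>1\<^sub>,\<^sub>i\<^sub>+\<^sub>2\<close>, a recursion without denominators. The scaling
  \<open>\<Omega>\<^sub>n\<^sub>-\<^sub>1\<^sub>,\<^sub>n = - b\<^sub>n\<^sub>-\<^sub>1\<close> is the one demanded by \<open>[u\<^sub>n, [u\<^sub>n, u\<^sub>n\<^sub>-\<^sub>1]] = - 2 b\<^sub>n\<^sub>-\<^sub>1 u\<^sub>n\<close>.
\<close>

definition form_entry :: "nat \<Rightarrow> (nat \<Rightarrow> complex) \<Rightarrow> nat \<Rightarrow> complex" where
  "form_entry n b i = (\<Prod>k=i..<n. - b k)"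

definition form_coeff :: "nat \<Rightarrow> (nat \<Rightarrow> complex) \<Rightarrow> nat \<Rightarrow> nat \<Rightarrow> complex" where
  "form_coeff n b i j = (if j = Suc i then form_entry n b i else if i = Suc j then - form_entry n b j else 0)"

definition form_mat :: "nat \<Rightarrow> (nat \<Rightarrow> complex) \<Rightarrow> complex mat" where
  "form_mat n b = mat n n (\<lambda>(r, s). form_coeff n b (r + 1) (s + 1))"

lemma form_entry_rec: "i < n \<Longrightarrow> form_entry n b i = - b i * form_entry n b (Suc i)"
  by (simp add: form_entry_def prod.atLeast_Suc_lessThan)

lemma form_coeff_antisym: "form_coeff n b j i = - form_coeff n b i j"
  by (simp add: form_coeff_def)

lemma form_mat_carrier [simp]: "form_mat n b \<in> carrier_mat n n"
  "dim_row (form_mat n b) = n" "dim_col (form_mat n b) = n"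
  by (simp_all add: form_mat_def)

lemma form_mat_transpose: "(form_mat n b)\<^sup>T = - form_mat n b"
  by (rule eq_matI) (simp_all add: form_mat_def form_coeff_antisym [symmetric])

text \<open>The tensor e_i e_i, combined with \<Omega>, acts on V by e_j \<mapsto> \<Omega>_{ij}
  e_i. Hence it obeys the same rule on the symmetric square as the generators u_i, with \<Omega> in
  place of \<open>gen_row b\<close>.\<close>

lemma esym_diag_form: "1 \<le> i \<Longrightarrow> i \<le> n \<Longrightarrow> esym n i i * form_mat n b = unit_row n i (form_coeff n b i)"
proof (rule eq_matI)
  fix r s assume i: "1 \<le> i" "i \<le> n" and "r < dim_row (unit_row n i (form_coeff n b i))"
    "s < dim_col (unit_row n i (form_coeff n b i))"
  then have rs: "r < n" "s < n" by auto
  obtain i' where i': "i = Suc i'" "i' < n" using i by (cases i) auto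
  have "(esym n i i * form_mat n b) $$ (r, s) =
      (\<Sum>t<n. esym n i i $$ (r, t) * form_coeff n b (t + 1) (s + 1))"
    using rs by (simp add: form_mat_def scalar_prod_def lessThan_atLeast0)
  also have "\<dots> = (\<Sum>t<n. if t = i' then (if r = i' then form_coeff n b (t + 1) (s + 1) else 0) else 0)"
    using rs i' by (intro sum.cong) (auto simp: esym_index)
  also have "\<dots> = unit_row n i (form_coeff n b i) $$ (r, s)"
    using rs i' by (simp add: unit_row_def)
  finally show "(esym n i i * form_mat n b) $$ (r, s) = unit_row n i (form_coeff n b i) $$ (r, s)" .
qed simp_all

text \<open>Infinitesimal invariance \<Omega>(A x, y) + \<Omega>(x, A y) = 0, for \<Omega> with
  matrix \<open>form_mat n b\<close>.\<close>

definition form_invariant :: "nat \<Rightarrow> (nat \<Rightarrow> complex) \<Rightarrow> complex mat \<Rightarrow> bool" where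
  "form_invariant n b A \<longleftrightarrow> A \<in> carrier_mat n n \<and> form_mat n b * A = - (A\<^sup>T * form_mat n b)"

lemma form_mult_unit_row:
  assumes "r < n" "s < n" "1 \<le> i" "i \<le> n"
  shows "(form_mat n b * unit_row n i g) $$ (r, s) = form_coeff n b (r + 1) i * g (s + 1)"
proof -
  obtain i' where i': "i = Suc i'" "i' < n" using assms by (cases i) auto
  have "(form_mat n b * unit_row n i g) $$ (r, s) =
      (\<Sum>t<n. if t = i' then form_coeff n b (r + 1) i * g (s + 1) else 0)"
    using assms i' by (simp add: form_mat_def unit_row_def scalar_prod_def lessThan_atLeast0
      del: sum.delta sum.delta')
      (rule sum.cong, auto)
  then show ?thesis using i' by simp
qed

lemma form_invariant_gen:
  assumes "1 \<le> i" "i < n"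
  shows "form_invariant n b (sl_gen_mat n b i)"
proof -
  let ?A = "unit_row n i (gen_row b i)" and ?W = "form_mat n b"
  \<comment> \<open>Column i of \<Omega> is proportional to the row of u_i, by the recursion for
    \<open>form_entry\<close>. So \<Omega> u_i is a symmetric matrix, which for alternating \<Omega>
    is the invariance.\<close>
  have key: "form_coeff n b k i = - form_entry n b i * gen_row b i k" if "1 \<le> k" "k \<le> n" for k
    using that assms form_entry_rec [of k n b] by (auto simp: form_coeff_def gen_row_def)
  have "?A\<^sup>T * ?W = - (?W * ?A)\<^sup>T"
  proof -
    have "(?W * ?A)\<^sup>T = ?A\<^sup>T * (- ?W)" by (simp add: transpose_mult [of _ n n _ n] form_mat_transpose)
    also have "\<dots> = - (?A\<^sup>T * ?W)" by (rule uminus_mult_right_mat) simp_all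
    finally show ?thesis by simp
  qed
  then have "- (?A\<^sup>T * ?W) = (?W * ?A)\<^sup>T" by simp
  also have "\<dots> = ?W * ?A"
  proof (rule eq_matI)
    fix r s assume "r < dim_row (?W * ?A)" "s < dim_col (?W * ?A)"
    then have rs: "r < n" "s < n" by auto
    have "(?W * ?A)\<^sup>T $$ (r, s) = (?W * ?A) $$ (s, r)" using rs by simp
    also have "\<dots> = form_coeff n b (s + 1) i * gen_row b i (r + 1)"
      using rs assms by (intro form_mult_unit_row) auto
    also have "\<dots> = form_coeff n b (r + 1) i * gen_row b i (s + 1)"
      using rs by (simp add: key)
    also have "\<dots> = (?W * ?A) $$ (r, s)"
      using rs assms by (intro form_mult_unit_row [symmetric]) auto
    finally show "(?W * ?A)\<^sup>T $$ (r, s) = (?W * ?A) $$ (r, s)" .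
  qed simp_all
  finally show ?thesis by (simp add: form_invariant_def sl_gen_mat_unit_row)
qed

lemma form_invariant_zero: "form_invariant n b (0\<^sub>m n n)"
  by (auto simp: form_invariant_def intro!: eq_matI)

lemma form_invariant_smult: "form_invariant n b A \<Longrightarrow> form_invariant n b (a \<cdot>\<^sub>m A)"
  by (auto simp: form_invariant_def transpose_smult mult_smult_distrib [of _ n n]
      mult_smult_assoc_mat [of _ n n] intro!: eq_matI)

lemma form_invariant_add: "form_invariant n b A \<Longrightarrow> form_invariant n b B \<Longrightarrow> form_invariant n b (A + B)"
  by (auto simp: form_invariant_def transpose_add [of _ n n] mult_add_distrib_mat [of _ n n _ n]
      add_mult_distrib_mat [of _ n n _ _ n] simp del: index_mult_mat(1) intro!: eq_matI)

lemma form_invariant_bracket: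
  assumes "form_invariant n b A" "form_invariant n b B"
  shows "form_invariant n b (A * B - B * A)"
proof -
  let ?W = "form_mat n b"
  have A: "A \<in> carrier_mat n n" "A\<^sup>T \<in> carrier_mat n n"
    and B: "B \<in> carrier_mat n n" "B\<^sup>T \<in> carrier_mat n n"
    and WA: "?W * A = - (A\<^sup>T * ?W)" and WB: "?W * B = - (B\<^sup>T * ?W)"
    using assms by (auto simp: form_invariant_def)
  have *: "?W * (X * Y) = X\<^sup>T * (Y\<^sup>T * ?W)"
    if X: "X \<in> carrier_mat n n" "?W * X = - (X\<^sup>T * ?W)"
      and Y: "Y \<in> carrier_mat n n" "?W * Y = - (Y\<^sup>T * ?W)"
    for X Y
  proof -
    have XT: "X\<^sup>T \<in> carrier_mat n n" and YT: "Y\<^sup>T \<in> carrier_mat n n" using X Y by auto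
    have "?W * (X * Y) = ?W * X * Y" using X(1) Y(1) by (simp add: assoc_mult_mat [of _ n n _ n _ n])
    also have "\<dots> = - (X\<^sup>T * ?W * Y)" unfolding X(2) using XT Y by simp
    also have "\<dots> = - (X\<^sup>T * (?W * Y))" using XT Y by (simp add: assoc_mult_mat [of _ n n _ n _ n])
    also have "\<dots> = X\<^sup>T * (Y\<^sup>T * ?W)" unfolding Y(2) using XT YT by simp
    finally show ?thesis .
  qed
  have "?W * (A * B - B * A) = A\<^sup>T * (B\<^sup>T * ?W) - B\<^sup>T * (A\<^sup>T * ?W)"
    using A B by (simp add: mult_minus_distrib_mat [of _ n n _ n] * WA WB)
  also have "\<dots> = - ((A * B - B * A)\<^sup>T * ?W)"
    using A B by (simp add: transpose_minus [of _ n n] transpose_mult [of _ n n _ n]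
      minus_mult_distrib_mat [of _ n n _ _ n] assoc_mult_mat [of _ n n _ n _ n])
     (rule eq_matI, auto simp del: index_mult_mat(1))
  finally show ?thesis using A B
    by (simp add: form_invariant_def mult_carrier_mat [of _ n n _ n] minus_carrier_mat [of _ n n])
qed

text \<open>For symmetric S one has (S \<Omega>)^T = - \<Omega> S, so both sides of the invariance
  equal \<Omega> S \<Omega>.\<close>

lemma form_invariant_sym:
  assumes "S \<in> carrier (sym2 n)"
  shows "form_invariant n b (S * form_mat n b)"
proof -
  let ?W = "form_mat n b"
  have S: "S \<in> carrier_mat n n" "S\<^sup>T = S" using assms by (auto simp: sym2_def)
  have "(S * ?W)\<^sup>T = - (?W * S)"
    using S by (simp add: transpose_mult [of _ n n _ n] form_mat_transpose)
  then have "- ((S * ?W)\<^sup>T * ?W) = ?W * S * ?W" using S by simp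
  then show ?thesis using S by (simp add: form_invariant_def assoc_mult_mat [of _ n n _ n _ n])
qed

text \<open>The map T \<mapsto> T \<Omega> intertwines the action of A on tensors with the
  commutator by A, provided A preserves \<Omega>. This makes the upper left block of
  \<open>sp_rep\<close> compatible with brackets.\<close>

lemma tensor_act_form:
  assumes "form_invariant n b A" "T \<in> carrier_mat n n"
  shows "tensor_act A T * form_mat n b = A * (T * form_mat n b) - T * form_mat n b * A"
proof -
  let ?W = "form_mat n b"
  have A: "A \<in> carrier_mat n n" "A\<^sup>T \<in> carrier_mat n n" and WA: "?W * A = - (A\<^sup>T * ?W)"
    using assms by (auto simp: form_invariant_def)
  have "T * ?W * A = T * (?W * A)" using A assms by (simp add: assoc_mult_mat [of _ n n _ n _ n])
  also have "\<dots> = - (T * (A\<^sup>T * ?W))" unfolding WA using A assms by simp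
  finally have 1: "T * ?W * A = - (T * (A\<^sup>T * ?W))" .
  show ?thesis unfolding 1 tensor_act_def using A assms(2)
    by (simp add: add_mult_distrib_mat [of _ n n _ _ n] assoc_mult_mat [of _ n n _ n _ n])
      (rule eq_matI, auto simp del: index_mult_mat(1))
qed

text \<open>
  The action of \<open>A + S \<in> sl\<^sub>n \<ltimes> S\<^sup>2V\<close> on \<open>V \<oplus> V\<^sup>*\<close>, for \<open>A\<close> preserving \<open>\<Omega>\<close>.
\<close>

definition sp_rep :: "nat \<Rightarrow> (nat \<Rightarrow> complex) \<Rightarrow> complex mat \<Rightarrow> complex mat \<Rightarrow> complex mat" where
  "sp_rep n b A S = four_block_mat (A + S * form_mat n b) S (0\<^sub>m n n) (- A\<^sup>T)"

section \<open>Brackets of the block matrices\<close>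

lemma minus_four_block_mat:
  fixes A1 :: "'a :: ab_group_add mat"
  assumes "A1 \<in> carrier_mat n n" "B1 \<in> carrier_mat n n" "C1 \<in> carrier_mat n n" "D1 \<in> carrier_mat n n"
    "A2 \<in> carrier_mat n n" "B2 \<in> carrier_mat n n" "C2 \<in> carrier_mat n n" "D2 \<in> carrier_mat n n"
  shows "four_block_mat A1 B1 C1 D1 - four_block_mat A2 B2 C2 D2 =
    four_block_mat (A1 - A2) (B1 - B2) (C1 - C2) (D1 - D2)"
  using assms by (intro eq_matI) auto

text \<open>The block matrices multiply like the semidirect product in which tensors have bracket S
  \<Omega> T - T \<Omega> S; this bracket is \<open>tensor_act (S * form_mat n b) T\<close>.\<close>

lemma sp_rep_bracket:
  assumes "form_invariant n b A" "S \<in> carrier (sym2 n)" "form_invariant n b B" "T \<in> carrier (sym2 n)"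
  shows "sp_rep n b A S * sp_rep n b B T - sp_rep n b B T * sp_rep n b A S =
    sp_rep n b (A * B - B * A) (tensor_act (A + S * form_mat n b) T - tensor_act B S)"
proof -
  let ?W = "form_mat n b"
  define X Y where "X = S * ?W" and "Y = T * ?W"
  \<comment> \<open>The upper left block P, the full action on V, again preserves \<Omega>, so
    \<open>tensor_act_form\<close> can be used for P itself.\<close>
  define P where "P = A + X"
  have A: "A \<in> carrier_mat n n" "A\<^sup>T \<in> carrier_mat n n"
    and B: "B \<in> carrier_mat n n" "B\<^sup>T \<in> carrier_mat n n"
    and S: "S \<in> carrier_mat n n" "S\<^sup>T = S" and T: "T \<in> carrier_mat n n" "T\<^sup>T = T"
    using assms by (auto simp: form_invariant_def sym2_def)
  have X: "X \<in> carrier_mat n n"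
    and Y: "Y \<in> carrier_mat n n" and P: "P \<in> carrier_mat n n" "P\<^sup>T \<in> carrier_mat n n"
    using A S T by (auto simp: X_def Y_def P_def)
  have BY: "B + Y \<in> carrier_mat n n" using B Y by simp
  have inv: "form_invariant n b P"
    unfolding P_def X_def by (intro form_invariant_add form_invariant_sym assms)
  have tcl: "tensor_act P T \<in> carrier_mat n n" "tensor_act B S \<in> carrier_mat n n"
    using P B S T by (auto simp: tensor_act_def)
  have b1: "P * (B + Y) - (B + Y) * P = (A * B - B * A) + (tensor_act P T - tensor_act B S) * ?W"
  proof -
    have "(tensor_act P T - tensor_act B S) * ?W = tensor_act P T * ?W - tensor_act B S * ?W"
      using tcl by (simp add: minus_mult_distrib_mat [of _ n n _ _ n])
    also have "\<dots> = (P * Y - Y * P) - (B * X - X * B)"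
      unfolding tensor_act_form [OF inv T(1)] tensor_act_form [OF assms(3) S(1)] X_def Y_def ..
    finally have 1: "(tensor_act P T - tensor_act B S) * ?W = (P * Y - Y * P) - (B * X - X * B)" .
    have PB: "P * B = A * B + X * B" "B * P = B * A + B * X"
      unfolding P_def using A B X
      by (simp_all add: add_mult_distrib_mat [of _ n n _ _ n] mult_add_distrib_mat [of _ n n _ n])
    have PY: "P * (B + Y) = P * B + P * Y" "(B + Y) * P = B * P + Y * P"
      using P B Y by (simp_all add: add_mult_distrib_mat [of _ n n _ _ n] mult_add_distrib_mat [of _ n n _ n])
    show ?thesis unfolding 1 PY PB
      by (rule eq_matI) (use A B X Y P in \<open>auto simp del: index_mult_mat(1)\<close>)
  qed
  \<comment> \<open>Transposing P produces - \<Omega> S; multiplied by T this is the term - Y S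
    coming from the other product.\<close>
  have b2: "P * T + S * (- B\<^sup>T) - ((B + Y) * S + T * (- A\<^sup>T)) = tensor_act P T - tensor_act B S"
  proof -
    have "P\<^sup>T = A\<^sup>T - ?W * S"
      unfolding P_def X_def using A S
      by (simp add: transpose_add [of _ n n] transpose_mult [of _ n n _ n] form_mat_transpose)
        (rule eq_matI, auto simp del: index_mult_mat(1))
    then have "T * P\<^sup>T = T * A\<^sup>T - Y * S"
      unfolding Y_def using A S T
      by (simp add: mult_minus_distrib_mat [of _ n n _ n] assoc_mult_mat [of _ n n _ n _ n]
        mult_carrier_mat [of _ n n _ n])
    moreover have "(B + Y) * S = B * S + Y * S" using B Y S
      by (simp add: add_mult_distrib_mat [of _ n n _ _ n])
    ultimately show ?thesis unfolding tensor_act_def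
      using A B S T P Y by (simp only: uminus_mult_right_mat carrier_matD)
       (rule eq_matI, auto simp del: index_mult_mat(1))
  qed
  have b4: "(- A\<^sup>T) * (- B\<^sup>T) - (- B\<^sup>T) * (- A\<^sup>T) = - (A * B - B * A)\<^sup>T"
    using A B by (simp add: transpose_minus [of _ n n] transpose_mult [of _ n n _ n])
      (rule eq_matI, auto simp del: index_mult_mat(1))
  have m: "sp_rep n b A S * sp_rep n b B T =
      four_block_mat (P * (B + Y)) (P * T + S * (- B\<^sup>T)) (0\<^sub>m n n) ((- A\<^sup>T) * (- B\<^sup>T))"
    unfolding sp_rep_def X_def [symmetric] Y_def [symmetric] P_def [symmetric]
    using mult_four_block_mat [OF P(1) S(1) zero_carrier_mat [of n n] _ BY T(1) zero_carrier_mat [of n n], of "- A\<^sup>T" "- B\<^sup>T"]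
      A B S T P BY by (simp add: left_mult_zero_mat [of _ n n]
        del: uminus_mult_right_mat uminus_mult_left_mat)
  have m': "sp_rep n b B T * sp_rep n b A S =
      four_block_mat ((B + Y) * P) ((B + Y) * S + T * (- A\<^sup>T)) (0\<^sub>m n n) ((- B\<^sup>T) * (- A\<^sup>T))"
    unfolding sp_rep_def X_def [symmetric] Y_def [symmetric] P_def [symmetric]
    using mult_four_block_mat [OF BY T(1) zero_carrier_mat [of n n] _ P(1) S(1) zero_carrier_mat [of n n], of "- B\<^sup>T" "- A\<^sup>T"]
      A B S T P BY by (simp add: left_mult_zero_mat [of _ n n]
        del: uminus_mult_right_mat uminus_mult_left_mat)
  have "sp_rep n b A S * sp_rep n b B T - sp_rep n b B T * sp_rep n b A S =
    four_block_mat (P * (B + Y) - (B + Y) * P) (P * T + S * (- B\<^sup>T) - ((B + Y) * S + T * (- A\<^sup>T)))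
      (0\<^sub>m n n - 0\<^sub>m n n) ((- A\<^sup>T) * (- B\<^sup>T) - (- B\<^sup>T) * (- A\<^sup>T))"
    unfolding m m' by (rule minus_four_block_mat) (use A B S T P BY in auto)
  also have "\<dots> = sp_rep n b (A * B - B * A) (tensor_act P T - tensor_act B S)"
    unfolding b1 b2 b4 sp_rep_def by (simp add: minus_r_inv_mat [OF zero_carrier_mat])
  finally show ?thesis unfolding P_def X_def .
qed

lemma square_mat_zero_simps [simp]:
  fixes A :: "complex mat"
  assumes "A \<in> carrier_mat n n"
  shows "A * 0\<^sub>m n n = 0\<^sub>m n n" "0\<^sub>m n n * A = 0\<^sub>m n n" "A - 0\<^sub>m n n = A" "0\<^sub>m n n - A = (-1) \<cdot>\<^sub>m A"
    "A + 0\<^sub>m n n = A" "0\<^sub>m n n + A = A"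
  using assms by (auto intro!: eq_matI)

lemma smult_zero_mat [simp]: "a \<cdot>\<^sub>m 0\<^sub>m n n = (0\<^sub>m n n :: complex mat)"
  by (rule eq_matI) auto

lemma smult_smult_times: "a \<cdot>\<^sub>m (c \<cdot>\<^sub>m A) = (a * c) \<cdot>\<^sub>m (A :: complex mat)"
  by (rule eq_matI) auto

lemma zero_smult_esym [simp]: "0 \<cdot>\<^sub>m esym n j k = 0\<^sub>m n n" "1 \<cdot>\<^sub>m esym n j k = esym n j k"
  by (auto intro!: eq_matI)

lemma sl_mat_ops:
  "\<zero>\<^bsub>sl_mat n\<^esub> = 0\<^sub>m n n" "x \<oplus>\<^bsub>sl_mat n\<^esub> y = x + y" "a \<odot>\<^bsub>sl_mat n\<^esub> x = a \<cdot>\<^sub>m x"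
  "\<lbrace>x, y\<rbrace>\<^bsub>sl_mat n\<^esub> = x * y - y * x"
  by (simp_all add: sl_mat_def)

lemma zero_sym2 [simp]: "0\<^sub>m n n \<in> carrier (sym2 n)"
  by (simp add: sym2_def)

lemma sym2_carrier: "T \<in> carrier (sym2 n) \<Longrightarrow> T \<in> carrier_mat n n"
  by (simp add: sym2_def)

lemma tensor_act_zero [simp]:
  "A \<in> carrier_mat n n \<Longrightarrow> tensor_act A (0\<^sub>m n n) = 0\<^sub>m n n"
  "T \<in> carrier_mat n n \<Longrightarrow> tensor_act (0\<^sub>m n n) T = 0\<^sub>m n n"
  by (simp_all add: tensor_act_def)

lemma tensor_act_sym2:
  assumes "A \<in> carrier_mat n n" "T \<in> carrier (sym2 n)"
  shows "tensor_act A T \<in> carrier (sym2 n)"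
  using assms by (auto simp: sym2_def tensor_act_def transpose_add [of _ n n] transpose_mult [of _ n n _ n]
      comm_add_mat [of _ n n])

lemma sym2_smult: "S \<in> carrier (sym2 n) \<Longrightarrow> a \<cdot>\<^sub>m S \<in> carrier (sym2 n)"
  by (auto simp: sym2_def transpose_smult)

lemma sp_rep_carrier [simp]:
  "A \<in> carrier_mat n n \<Longrightarrow> S \<in> carrier_mat n n \<Longrightarrow> sp_rep n b A S \<in> carrier_mat (n + n) (n + n)"
  by (simp add: sp_rep_def)

lemma sp_rep_zero: "sp_rep n b (0\<^sub>m n n) (0\<^sub>m n n) = 0\<^sub>m (n + n) (n + n)"
  by (rule eq_matI) (auto simp: sp_rep_def simp del: index_mult_mat(1))

lemma sp_rep_add:
  assumes "A \<in> carrier_mat n n" "B \<in> carrier_mat n n" "S \<in> carrier_mat n n" "T \<in> carrier_mat n n"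
  shows "sp_rep n b (A + B) (S + T) = sp_rep n b A S + sp_rep n b B T"
proof -
  let ?W = "form_mat n b"
  have "A + B + (S + T) * ?W = (A + S * ?W) + (B + T * ?W)"
    using assms unfolding add_mult_distrib_mat [OF assms(3,4) form_mat_carrier(1)]
    by (intro eq_matI) (simp_all del: index_mult_mat(1))
  moreover have "- (A + B)\<^sup>T = - A\<^sup>T + - B\<^sup>T"
    using assms by (intro eq_matI) simp_all
  ultimately show ?thesis
    unfolding sp_rep_def using assms by (subst add_four_block_mat [of _ n n _ n _ n]) auto
qed

lemma sp_rep_smult:
  assumes "A \<in> carrier_mat n n" "S \<in> carrier_mat n n"
  shows "sp_rep n b (a \<cdot>\<^sub>m A) (a \<cdot>\<^sub>m S) = a \<cdot>\<^sub>m sp_rep n b A S"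
proof -
  let ?W = "form_mat n b"
  have "a \<cdot>\<^sub>m A + (a \<cdot>\<^sub>m S) * ?W = a \<cdot>\<^sub>m (A + S * ?W)"
    using assms unfolding mult_smult_assoc_mat [OF assms(2) form_mat_carrier(1)]
    by (intro eq_matI) (simp_all add: distrib_left del: index_mult_mat(1))
  moreover have "- (a \<cdot>\<^sub>m A)\<^sup>T = a \<cdot>\<^sub>m (- A\<^sup>T)"
    using assms by (intro eq_matI) simp_all
  ultimately show ?thesis
    unfolding sp_rep_def using assms by (subst smult_four_block_mat [of _ n n _ n _ n]) auto
qed

definition upper_right :: "nat \<Rightarrow> complex mat \<Rightarrow> complex mat" where
  "upper_right n M = mat n n (\<lambda>(r, s). M $$ (r, n + s))"

lemma upper_right_sp_rep:
  "A \<in> carrier_mat n n \<Longrightarrow> S \<in> carrier_mat n n \<Longrightarrow> upper_right n (sp_rep n b A S) = S"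
  by (rule eq_matI) (auto simp: upper_right_def sp_rep_def)

text \<open>The traces of A and of minus its transpose cancel. It serves to place the generators in
  \<open>sl_mat (n + n)\<close>.\<close>

lemma sp_rep_trace:
  assumes "A \<in> carrier_mat n n" "S \<in> carrier_mat n n" 
  shows "(\<Sum>i<n + n. sp_rep n b A S $$ (i, i)) = (\<Sum>i<n. (S * form_mat n b) $$ (i, i))"
proof -
  let ?f = "\<lambda>i. sp_rep n b A S $$ (i, i)"
  have "sum ?f {0..<n + n} = sum ?f {0..<n} + sum ?f {n..<n + n}"
    by (simp add: sum.atLeastLessThan_concat)
  also have "sum ?f {n..<n + n} = (\<Sum>i=0..<n. ?f (n + i))"
    using sum.shift_bounds_nat_ivl [of ?f 0 n n] by (simp add: add.commute)
  finally have "sum ?f {..<n + n} = (\<Sum>i<n. ?f i) + (\<Sum>i<n. ?f (n + i))"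
    by (simp add: lessThan_atLeast0)
  also have "\<dots> = (\<Sum>i<n. A $$ (i, i) + (S * form_mat n b) $$ (i, i)) + (\<Sum>i<n. - A $$ (i, i))"
    using assms by (intro arg_cong2 [where f = "(+)"] sum.cong) (auto simp: sp_rep_def
      simp del: index_mult_mat(1))
  finally show ?thesis by (simp add: sum.distrib sum_negf)
qed

section \<open>Images of the generators and verification of the relations\<close>

definition sp_gen_mat :: "nat \<Rightarrow> (nat \<Rightarrow> complex) \<Rightarrow> nat \<Rightarrow> complex mat" where
  "sp_gen_mat n b i = (if i < n then sp_rep n b (sl_gen_mat n b i) (0\<^sub>m n n)
     else sp_rep n b (0\<^sub>m n n) (esym n n n))"

lemma sp_gen_mat_closed: "sp_gen_mat n b ` {1..n} \<subseteq> carrier (sl_mat (n + n))"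
proof -
  \<comment> \<open>Only row n of this product can be nonzero, and its diagonal entry is
    \<Omega>_{nn} = 0.\<close>
  have "(\<Sum>i<n. (esym n n n * form_mat n b) $$ (i, i)) = 0" if "1 \<le> n"
    unfolding esym_diag_form [OF that order.refl]
    by (rule sum.neutral) (auto simp: unit_row_def form_coeff_def)
  then show ?thesis
    by (auto simp: sl_mat_def sp_gen_mat_def sp_rep_trace sl_gen_mat_unit_row
      simp del: index_mult_mat(1))
qed

lemma form_invariant_carrier: "form_invariant n b A \<Longrightarrow> A \<in> carrier_mat n n"
  by (simp add: form_invariant_def)

lemma sp_rep_bracket_sl:
  assumes "form_invariant n b A" "form_invariant n b B"
  shows "\<lbrace>sp_rep n b A (0\<^sub>m n n), sp_rep n b B (0\<^sub>m n n)\<rbrace>\<^bsub>sl_mat (n + n)\<^esub> =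
    sp_rep n b (\<lbrace>A, B\<rbrace>\<^bsub>sl_mat n\<^esub>) (0\<^sub>m n n)"
  using assms by (simp add: sl_mat_ops sp_rep_bracket form_invariant_carrier)

lemma sp_rep_bracket_left:
  assumes "form_invariant n b A" "T \<in> carrier (sym2 n)"
  shows "\<lbrace>sp_rep n b A (0\<^sub>m n n), sp_rep n b (0\<^sub>m n n) T\<rbrace>\<^bsub>sl_mat (n + n)\<^esub> =
    sp_rep n b (0\<^sub>m n n) (tensor_act A T)"
  using assms sym2_carrier [OF tensor_act_sym2 [OF _ assms(2), of A]]
  by (simp add: sl_mat_ops sp_rep_bracket form_invariant_carrier form_invariant_zero sym2_carrier)

lemma sp_rep_bracket_ideal:
  assumes "S \<in> carrier (sym2 n)" "T \<in> carrier (sym2 n)"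
  shows "\<lbrace>sp_rep n b (0\<^sub>m n n) S, sp_rep n b (0\<^sub>m n n) T\<rbrace>\<^bsub>sl_mat (n + n)\<^esub> =
    sp_rep n b (0\<^sub>m n n) (tensor_act (S * form_mat n b) T)"
proof -
  have "S * form_mat n b \<in> carrier_mat n n"
    by (intro mult_carrier_mat [of _ n n _ n] sym2_carrier assms form_mat_carrier)
  with assms sym2_carrier [OF tensor_act_sym2 [OF _ assms(2), of "S * form_mat n b"]] show ?thesis
  by (simp add: sl_mat_ops sp_rep_bracket form_invariant_zero sym2_carrier)
qed

text \<open>Terms in the first n - 1 generators stay block diagonal, so their relations are
  inherited from \<open>sl_gen_mat\<close>. Invariance of the form is carried along because brackets
  of \<open>sp_rep\<close> need it.\<close>

lemma sp_eval_sl_terms: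
  assumes "t \<in> lie_terms {1..n - 1}"
  shows "form_invariant n b (lie_eval (sl_mat n) (sl_gen_mat n b) t) \<and>
    lie_eval (sl_mat (n + n)) (sp_gen_mat n b) t =
      sp_rep n b (lie_eval (sl_mat n) (sl_gen_mat n b) t) (0\<^sub>m n n)"
  using assms
proof (induction t)
  case (Gen i)
  then show ?case by (auto simp: sp_gen_mat_def form_invariant_gen)
next
  case Zero
  then show ?case by (simp add: sl_mat_ops sp_rep_zero form_invariant_zero)
next
  case (Add s t)
  let ?A = "lie_eval (sl_mat n) (sl_gen_mat n b) s" and ?B = "lie_eval (sl_mat n) (sl_gen_mat n b) t"
  have "form_invariant n b ?A" "form_invariant n b ?B" using Add by auto
  with Add sp_rep_add [of ?A n ?B "0\<^sub>m n n" "0\<^sub>m n n" b] show ?case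
    by (simp add: sl_mat_ops form_invariant_add form_invariant_carrier [where b = b])
next
  case (Scale a t)
  let ?A = "lie_eval (sl_mat n) (sl_gen_mat n b) t"
  have "form_invariant n b ?A" using Scale by auto
  with Scale sp_rep_smult [of ?A n "0\<^sub>m n n" b a] show ?case
    by (simp add: sl_mat_ops form_invariant_smult form_invariant_carrier [where b = b])
next
  case (Br s t)
  then show ?case by (simp add: sp_rep_bracket_sl) (simp add: sl_mat_ops form_invariant_bracket)
qed

lemma sp_relations_cases:
  assumes "(s, t) \<in> sp_relations n b" "2 \<le> n"
  obtains (sl) "(s, t) \<in> sl_relations n b" "s \<in> lie_terms {1..n - 1}" "t \<in> lie_terms {1..n - 1}"
  | (far_left) i where "s = Br (Gen i) (Gen n)" "t = Zero" "1 \<le> i" "Suc i < n"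
  | (far_right) i where "s = Br (Gen n) (Gen i)" "t = Zero" "1 \<le> i" "Suc i < n"
  | (long) "s = Br (Gen n) (Br (Gen n) (Gen (n - 1)))" "t = Scale (- 2 * b (n - 1)) (Gen n)"
  | (cube) "s = Br (Gen (n - 1)) (Br (Gen (n - 1)) (Br (Gen (n - 1)) (Gen n)))" "t = Zero"
proof -
  consider (1) i j where "s = Br (Gen i) (Gen j)" "t = Zero" "i \<in> {1..n}" "j \<in> {1..n}" "\<bar>int i - int j\<bar> > 1"
    | (2) i j where "s = Br (Gen i) (Br (Gen i) (Gen j))" "t = Scale (- 2 * b (min i j)) (Gen i)"
        "i \<in> {1..n-1}" "j \<in> {1..n-1}" "\<bar>int i - int j\<bar> = 1"
    | (3) "s = Br (Gen n) (Br (Gen n) (Gen (n - 1)))" "t = Scale (- 2 * b (n - 1)) (Gen n)"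
    | (4) "s = Br (Gen (n - 1)) (Br (Gen (n - 1)) (Br (Gen (n - 1)) (Gen n)))" "t = Zero"
    using assms(1) unfolding sp_relations_def by auto
  then show thesis
  proof cases
    case 1
    consider "i < n" "j < n" | "i < n" "j = n" | "i = n" "j < n" using 1 by fastforce
    then show thesis
    proof cases
      case a: 1
      then show thesis using 1 by (intro sl) (auto simp: sl_relations_def)
    next
      case a: 2
      then show thesis using 1 by (intro far_left [of i]) auto
    next
      case a: 3
      then show thesis using 1 by (intro far_right [of j]) auto
    qed
  next
    case 2
    then show thesis by (intro sl) (auto simp: sl_relations_def)
  qed (auto intro: long cube)
qed

lemma sp_gen_mat_act:
  assumes "1 \<le> i" "i < n" "1 \<le> j" "j \<le> n" "1 \<le> k" "k \<le> n"
  shows "\<lbrace>sp_gen_mat n b i, sp_rep n b (0\<^sub>m n n) (a \<cdot>\<^sub>m esym n j k)\<rbrace>\<^bsub>sl_mat (n + n)\<^esub> =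
    sp_rep n b (0\<^sub>m n n) (a \<cdot>\<^sub>m (gen_row b i j \<cdot>\<^sub>m esym n i k + gen_row b i k \<cdot>\<^sub>m esym n j i))"
proof -
  have "\<lbrace>sp_gen_mat n b i, sp_rep n b (0\<^sub>m n n) (a \<cdot>\<^sub>m esym n j k)\<rbrace>\<^bsub>sl_mat (n + n)\<^esub> =
      sp_rep n b (0\<^sub>m n n) (tensor_act (sl_gen_mat n b i) (a \<cdot>\<^sub>m esym n j k))"
    using assms by (simp add: sp_gen_mat_def sp_rep_bracket_left form_invariant_gen sym2_smult)
  also have "tensor_act (sl_gen_mat n b i) (a \<cdot>\<^sub>m esym n j k) = a \<cdot>\<^sub>m tensor_act (sl_gen_mat n b i) (esym n j k)"
    by (rule tensor_act_smult [of _ n]) (simp_all add: sl_gen_mat_unit_row)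
  finally show ?thesis using assms by (simp add: sl_gen_mat_unit_row tensor_act_unit_row)
qed

text \<open>The same derivation rule as for the generators, with a row of \<Omega> as coefficients.
  It gives the relation of u_n here and later the relations among the e_i e_i.\<close>

lemma sp_gen_mat_top_act:
  assumes "1 \<le> j" "j \<le> n" "1 \<le> k" "k \<le> n" "1 \<le> i" "i \<le> n"
  shows "\<lbrace>sp_rep n b (0\<^sub>m n n) (esym n i i), sp_rep n b (0\<^sub>m n n) (a \<cdot>\<^sub>m esym n j k)\<rbrace>\<^bsub>sl_mat (n + n)\<^esub> =
    sp_rep n b (0\<^sub>m n n) (a \<cdot>\<^sub>m (form_coeff n b i j \<cdot>\<^sub>m esym n i k + form_coeff n b i k \<cdot>\<^sub>m esym n j i))"
proof -
  have "tensor_act (unit_row n i (form_coeff n b i)) (a \<cdot>\<^sub>m esym n j k) =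
      a \<cdot>\<^sub>m tensor_act (unit_row n i (form_coeff n b i)) (esym n j k)"
    by (rule tensor_act_smult [of _ n]) simp_all
  then show ?thesis
    using assms by (simp add: sp_rep_bracket_ideal sym2_smult esym_diag_form tensor_act_unit_row)
qed

lemma sp_gen_mat_relations:
  assumes "2 \<le> n" "(s, t) \<in> sp_relations n b"
  shows "lie_eval (sl_mat (n + n)) (sp_gen_mat n b) s = lie_eval (sl_mat (n + n)) (sp_gen_mat n b) t"
proof -
  interpret M: lie_algebra "sl_mat (n + n)" by (rule lie_algebra_sl_mat)
  let ?M = "sl_mat (n + n)" and ?G = "sp_gen_mat n b" and ?r = "sp_rep n b (0\<^sub>m n n)"
  define m where "m = n - 1"
  have m: "1 \<le> m" "m < n" "n = Suc m" using assms(1) by (auto simp: m_def)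
  have m': "n - Suc 0 = m" by (simp add: m_def)
  have G: "?G i \<in> carrier ?M" if "1 \<le> i" "i \<le> n" for i
    using sp_gen_mat_closed [of n b] that by auto
  have Gn: "?G n = ?r (esym n n n)" by (simp add: sp_gen_mat_def)
  have far: "\<lbrace>?G i, ?G n\<rbrace>\<^bsub>?M\<^esub> = \<zero>\<^bsub>?M\<^esub>" if "1 \<le> i" "Suc i < n" for i
    using that sp_gen_mat_act [of i n n n b 1] by (simp add: Gn sl_mat_ops(1) gen_row_def sp_rep_zero)
  have act1: "\<lbrace>?G m, ?G n\<rbrace>\<^bsub>?M\<^esub> = ?r (2 \<cdot>\<^sub>m esym n m n)"
  proof -
    have "1 \<cdot>\<^sub>m (1 \<cdot>\<^sub>m esym n m n + 1 \<cdot>\<^sub>m esym n m n) = 2 \<cdot>\<^sub>m esym n m n" by (rule eq_matI) auto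
    moreover have "gen_row b m n = 1" using m(3) by (simp add: gen_row_def)
    ultimately show ?thesis using m(1,2) sp_gen_mat_act [of m n n n b 1]
      by (simp add: Gn esym_commute [of n n m])
  qed
  have act2: "\<lbrace>?G m, ?r (2 \<cdot>\<^sub>m esym n m n)\<rbrace>\<^bsub>?M\<^esub> = ?r (2 \<cdot>\<^sub>m esym n m m)"
    using m sp_gen_mat_act [of m n m n b 2] by (simp add: gen_row_def)
  have act3: "\<lbrace>?G m, ?r (2 \<cdot>\<^sub>m esym n m m)\<rbrace>\<^bsub>?M\<^esub> = \<zero>\<^bsub>?M\<^esub>"
    using m sp_gen_mat_act [of m n m m b 2] by (simp add: gen_row_def sl_mat_ops(1) sp_rep_zero)
  \<comment> \<open>\<open>form_entry n b n\<close> is an empty product, so \<Omega>_{nm} = -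
    \<Omega>_{mn} = b_m for m = n - 1. This value produces the coefficient of the relation with two
    factors u_n.\<close>
  have "form_coeff n b n m = b m" "form_coeff n b n n = 0"
    using m form_entry_rec [of m n b] by (simp_all add: form_coeff_def form_entry_def)
  then have act4: "\<lbrace>?G n, ?r ((-2) \<cdot>\<^sub>m esym n m n)\<rbrace>\<^bsub>?M\<^esub> = ?r ((-2) \<cdot>\<^sub>m (b m \<cdot>\<^sub>m esym n n n))"
    using m(1,2) sp_gen_mat_top_act [of m n n n b "-2"] by (simp add: Gn)
  have sm: "a \<odot>\<^bsub>?M\<^esub> ?r T = ?r (a \<cdot>\<^sub>m T)" if "T \<in> carrier_mat n n" for a T
    using sp_rep_smult [of "0\<^sub>m n n" n T b a] that by (simp add: sl_mat_ops)
  show ?thesis using assms(2,1)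
  proof (cases rule: sp_relations_cases)
    case sl
    then show ?thesis
      using sp_eval_sl_terms [of s n b] sp_eval_sl_terms [of t n b] sl_gen_mat_relations [of s t n b] by simp
  next
    case (far_left i)
    then show ?thesis by (simp add: far)
  next
    case (far_right i)
    then show ?thesis using far [of i] G by (simp add: M.bracket_antisym [of "?G n" "?G i"])
  next
    case long
    have "\<lbrace>?G n, ?G m\<rbrace>\<^bsub>?M\<^esub> = ?r ((-2) \<cdot>\<^sub>m esym n m n)"
      using m(1,2) G by (simp add: M.bracket_antisym [of "?G n" "?G m"] act1 sm smult_smult_times)
    then show ?thesis using long act4 by (simp add: m' Gn sm smult_smult_times)
  next
    case cube
    then show ?thesis by (simp add: m' act1 act2 act3)
  qed
qed

section \<open>Structure of the symplectic Lie algebra\<close>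

lemma lie_semidirect_simps:
  "carrier (lie_semidirect G H d) = carrier G \<times> carrier H"
  "(x, a) \<oplus>\<^bsub>lie_semidirect G H d\<^esub> (z, c) = (x \<oplus>\<^bsub>G\<^esub> z, a \<oplus>\<^bsub>H\<^esub> c)"
  "r \<odot>\<^bsub>lie_semidirect G H d\<^esub> (x, a) = (r \<odot>\<^bsub>G\<^esub> x, r \<odot>\<^bsub>H\<^esub> a)"
  "\<lbrace>(x, a), (z, c)\<rbrace>\<^bsub>lie_semidirect G H d\<^esub> =
    (\<lbrace>x, z\<rbrace>\<^bsub>G\<^esub>, \<lbrace>a, c\<rbrace>\<^bsub>H\<^esub> \<oplus>\<^bsub>H\<^esub> d x c \<ominus>\<^bsub>H\<^esub> d z a)"
  by (simp_all add: lie_semidirect_def)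

lemma lie_hom_minus:
  assumes "lie_algebra L" "lie_algebra M" "h \<in> lie_hom L M" "x \<in> carrier L" "y \<in> carrier L"
  shows "h (x \<ominus>\<^bsub>L\<^esub> y) = h x \<ominus>\<^bsub>M\<^esub> h y"
proof -
  interpret L: lie_algebra L by fact
  interpret M: lie_algebra M by fact
  show ?thesis using assms(4,5)
    by (simp add: L.M.minus_eq M.M.minus_eq L.neg_eq_smult M.neg_eq_smult lie_homD [OF assms(3)])
qed

text \<open>Transport of structure: conjugating the action by \<phi> keeps all axioms, and the
  identity on G paired with the inverse of \<phi> identifies the two semidirect products.\<close>

lemma lie_derivation_action_transport:
  assumes "lie_derivation_action G H d" "lie_algebra H'" "\<phi> \<in> lie_iso H H'"
  defines "\<phi>i \<equiv> inv_into (carrier H) \<phi>"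
  defines "d' \<equiv> \<lambda>x y. \<phi> (d x (\<phi>i y))"
  shows "lie_derivation_action G H' d'"
    and "(\<lambda>(x, y). (x, \<phi>i y)) \<in> lie_iso (lie_semidirect G H' d') (lie_semidirect G H d)"
proof -
  interpret d: lie_derivation_action G H d by fact
  interpret H': lie_algebra H' by fact
  have phi: "\<phi> \<in> lie_hom H H'" and bij: "bij_betw \<phi> (carrier H) (carrier H')"
    using assms(3) by (auto simp: lie_iso_def)
  have "\<phi>i \<in> lie_iso H' H"
    unfolding \<phi>i_def by (rule lie_iso_inv_into [OF d.H.lie_algebra_axioms assms(3)])
  then have psi: "\<phi>i \<in> lie_hom H' H"
    by (simp add: lie_iso_def)
  have inv [simp]: "\<phi> (\<phi>i y) = y" if "y \<in> carrier H'" for y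
    using bij that by (simp add: \<phi>i_def bij_betw_def f_inv_into_f)
  have inv' [simp]: "\<phi>i (\<phi> a) = a" if "a \<in> carrier H" for a
    using bij that by (simp add: \<phi>i_def bij_betw_def inv_into_f_f)
  note hom = lie_homD [OF phi] lie_homD [OF psi]
  have dx: "d x a \<in> carrier H" "d x (r \<odot>\<^bsub>H\<^esub> a) = r \<odot>\<^bsub>H\<^esub> d x a"
    "c \<in> carrier H \<Longrightarrow> d x (a \<oplus>\<^bsub>H\<^esub> c) = d x a \<oplus>\<^bsub>H\<^esub> d x c"
    if "x \<in> carrier G" "a \<in> carrier H" for x a c r
    using d.act_linear [OF that(1)] that by (auto simp: LinearCombinations.module_hom_def)
  have vs: "vectorspace class_ring H'" by (rule H'.vectorspace_axioms)
  show "lie_derivation_action G H' d'"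
  proof (intro lie_derivation_action.intro lie_module.intro lie_module_axioms.intro
      lie_derivation_action_axioms.intro d.G.lie_algebra_axioms H'.lie_algebra_axioms vs)
    fix x assume "x \<in> carrier G"
    then show "d' x \<in> LinearCombinations.module_hom class_ring H' H'"
      by (auto simp: LinearCombinations.module_hom_def d'_def hom dx)
  next
    fix x z m assume "x \<in> carrier G" "z \<in> carrier G" "m \<in> carrier H'"
    then show "d' (\<lbrace>x, z\<rbrace>\<^bsub>G\<^esub>) m = d' x (d' z m) \<ominus>\<^bsub>H'\<^esub> d' z (d' x m)"
      by (simp add: d'_def hom dx d.act_bracket
        lie_hom_minus [OF d.H.lie_algebra_axioms H'.lie_algebra_axioms phi])
  next
    fix x a c assume "x \<in> carrier G" "a \<in> carrier H'" "c \<in> carrier H'"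
    then show "d' x (\<lbrace>a, c\<rbrace>\<^bsub>H'\<^esub>) = \<lbrace>d' x a, c\<rbrace>\<^bsub>H'\<^esub> \<oplus>\<^bsub>H'\<^esub> \<lbrace>a, d' x c\<rbrace>\<^bsub>H'\<^esub>"
      by (simp add: d'_def hom dx d.act_derivation)
  qed (simp_all add: d'_def hom dx d.act_add d.act_smult)
  have "(\<lambda>(x, y). (x, \<phi>i y)) \<in> lie_hom (lie_semidirect G H' d') (lie_semidirect G H d)"
    by (rule lie_homI)
      (auto simp: lie_semidirect_simps hom d'_def dx
        lie_hom_minus [OF H'.lie_algebra_axioms d.H.lie_algebra_axioms psi])
  moreover have "bij_betw (\<lambda>(x, y). (x, \<phi>i y)) (carrier G \<times> carrier H') (carrier G \<times> carrier H)"
    by (rule bij_betw_byWitness [where f' = "\<lambda>(x, a). (x, \<phi> a)"]) (auto simp: hom)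
  ultimately show "(\<lambda>(x, y). (x, \<phi>i y)) \<in> lie_iso (lie_semidirect G H' d') (lie_semidirect G H d)"
    by (simp add: lie_iso_def lie_semidirect_simps)
qed

text \<open>If P sends each Y_k to e_k e_k and each u_i to the expected operator, the recursion for
  \<open>sym_elt\<close> runs in parallel on both sides. It is used for \<open>rep\<close> and for
  its composite with \<open>theta\<close>.\<close>

lemma (in lie_algebra) sym_elt_rep:
  assumes P: "P \<in> lie_hom L (sl_mat (n + n))"
    and u: "\<And>i. 1 \<le> i \<Longrightarrow> i < n \<Longrightarrow> u i \<in> carrier L" and Y: "\<And>k. 1 \<le> k \<Longrightarrow> k \<le> n \<Longrightarrow> Y k \<in> carrier L"
    and h_far: "\<And>i j. i \<noteq> Suc j \<Longrightarrow> j \<noteq> Suc i \<Longrightarrow> h i j = 0"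
    and h_Suc: "\<And>i. 1 \<le> i \<Longrightarrow> i < n \<Longrightarrow> h i (Suc i) \<noteq> 0"
    and diag: "\<And>k. 1 \<le> k \<Longrightarrow> k \<le> n \<Longrightarrow> P (Y k) = sp_rep n b (0\<^sub>m n n) (esym n k k)"
    and act: "\<And>i j k. 1 \<le> i \<Longrightarrow> i < n \<Longrightarrow> 1 \<le> j \<Longrightarrow> j \<le> n \<Longrightarrow> 1 \<le> k \<Longrightarrow> k \<le> n \<Longrightarrow>
      \<lbrace>P (u i), sp_rep n b (0\<^sub>m n n) (1 \<cdot>\<^sub>m esym n j k)\<rbrace>\<^bsub>sl_mat (n + n)\<^esub> =
        sp_rep n b (0\<^sub>m n n) (1 \<cdot>\<^sub>m (h i j \<cdot>\<^sub>m esym n i k + h i k \<cdot>\<^sub>m esym n j i))"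
    and jk: "1 \<le> j" "j \<le> n" "1 \<le> k" "k \<le> n"
  shows "P (sym_elt h u Y j k) = sp_rep n b (0\<^sub>m n n) (esym n j k)"
proof -
  have col: "P (sym_col h u Y k d) = sp_rep n b (0\<^sub>m n n) (esym n (k - d) k)" if "d < k" "k \<le> n" for k d
    using that
  proof (induction d)
    case 0
    then show ?case by (simp add: diag)
  next
    case (Suc d)
    define i where "i = k - Suc d"
    have i: "1 \<le> i" "i < n" "k - d = Suc i" "Suc i \<le> n" "1 \<le> k" "k \<le> n" "d = 0 \<longleftrightarrow> k = Suc i"
      using Suc.prems by (auto simp: i_def)
    define c :: complex where "c = (if d = 0 then 2 else 1)"
    have c: "c * h i (Suc i) \<noteq> 0" using h_Suc [of i] i by (simp add: c_def)
    have [simp]: "sym_col h u Y k d \<in> carrier L" "u i \<in> carrier L"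
      using Suc.prems i by (auto intro!: u sym_col_closed [where n = n] Y)
    have e: "1 \<cdot>\<^sub>m (h i (Suc i) \<cdot>\<^sub>m esym n i k + h i k \<cdot>\<^sub>m esym n (Suc i) i) = (c * h i (Suc i)) \<cdot>\<^sub>m esym n i k"
    proof (cases "d = 0")
      case True
      then show ?thesis using i esym_commute [of n "Suc i" i] by (intro eq_matI) (auto simp: c_def)
    next
      case False
      then have "h i k = 0" using i Suc.prems by (intro h_far) (auto simp: i_def)
      then show ?thesis using False by (intro eq_matI) (auto simp: c_def)
    qed
    have "P (\<lbrace>u i, sym_col h u Y k d\<rbrace>) = sp_rep n b (0\<^sub>m n n) ((c * h i (Suc i)) \<cdot>\<^sub>m esym n i k)"
      using Suc i act [of i "Suc i" k] by (simp add: lie_homD [OF P] flip: e)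
    then have "P (sym_col h u Y k (Suc d)) =
        inverse (c * h i (Suc i)) \<cdot>\<^sub>m sp_rep n b (0\<^sub>m n n) ((c * h i (Suc i)) \<cdot>\<^sub>m esym n i k)"
      using i by (simp add: lie_homD [OF P] sl_mat_ops c_def i_def [symmetric]
        del: inverse_mult_distrib)
    also have "\<dots> = sp_rep n b (0\<^sub>m n n) (esym n i k)"
      using c sp_rep_smult [of "0\<^sub>m n n" n "(c * h i (Suc i)) \<cdot>\<^sub>m esym n i k" b "inverse (c * h i (Suc i))"]
      by (simp add: smult_smult_times del: inverse_mult_distrib)
    finally show ?case by (simp add: i_def)
  qed
  show ?thesis
    using col [of "max j k - min j k" "max j k"] jk
    by (cases "j \<le> k") (simp_all add: sym_elt_def max_def min_def esym_commute [of n k j])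
qed

lemma (in sp_elements) diag_rep:
  assumes P: "P \<in> lie_hom L (sl_mat (n + n))" "\<And>i. 1 \<le> i \<Longrightarrow> i \<le> n \<Longrightarrow> P (u i) = sp_gen_mat n b i"
    and k: "1 \<le> k" "k \<le> n"
  shows "P (diag k) = sp_rep n b (0\<^sub>m n n) (esym n k k)"
  using k(2,1)
proof (induction k rule: inc_induct)
  case base
  then show ?case using n_ge by (simp add: P(2) sp_gen_mat_def)
next
  case (step k)
  have k: "1 \<le> k" "k < n" using step by auto
  have [simp]: "u k \<in> carrier L" "diag (Suc k) \<in> carrier L" using k by auto
  have P1: "\<lbrace>P (u k), P (diag (Suc k))\<rbrace>\<^bsub>sl_mat (n + n)\<^esub> = sp_rep n b (0\<^sub>m n n) (2 \<cdot>\<^sub>m esym n k (Suc k))"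
  proof -
    have "1 \<cdot>\<^sub>m (1 \<cdot>\<^sub>m esym n k (Suc k) + 1 \<cdot>\<^sub>m esym n k (Suc k)) = 2 \<cdot>\<^sub>m esym n k (Suc k)"
      by (rule eq_matI) auto
    then show ?thesis using k step.IH sp_gen_mat_act [of k n "Suc k" "Suc k" b 1]
      by (simp add: P(2) gen_row_def esym_commute [of n "Suc k" k])
  qed
  have "\<lbrace>P (u k), sp_rep n b (0\<^sub>m n n) (2 \<cdot>\<^sub>m esym n k (Suc k))\<rbrace>\<^bsub>sl_mat (n + n)\<^esub> =
      sp_rep n b (0\<^sub>m n n) (2 \<cdot>\<^sub>m esym n k k)"
    using k sp_gen_mat_act [of k n k "Suc k" b 2] by (simp add: P(2) gen_row_def)
  then have "P (diag k) = inverse 2 \<cdot>\<^sub>m sp_rep n b (0\<^sub>m n n) (2 \<cdot>\<^sub>m esym n k k)"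
    using k by (simp add: diag_rec lie_homD [OF P(1)] P1 sl_mat_ops(3))
  also have "\<dots> = sp_rep n b (0\<^sub>m n n) (esym n k k)"
    by (simp add: smult_smult_times flip: sp_rep_smult)
  finally show ?case .
qed

text \<open>The rule \<open>u_y\<close> does not include u_n. As u_n commutes with every u_i for i <
  n - 1, closedness passes down the recursion; only e_{n-1} e_n and e_{n-1} e_{n-1}, which are
  reached through u_{n-1}, require the relations.\<close>

lemma (in sp_elements) bracket_top_closed:
  assumes "submodule class_ring S L"
    and y: "\<And>j k. 1 \<le> j \<Longrightarrow> j \<le> n \<Longrightarrow> 1 \<le> k \<Longrightarrow> k \<le> n \<Longrightarrow> sym_elt (gen_row b) u diag j k \<in> S"
    and closed: "\<And>i x. 1 \<le> i \<Longrightarrow> i < n \<Longrightarrow> x \<in> S \<Longrightarrow> \<lbrace>u i, x\<rbrace> \<in> S"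
    and jk: "1 \<le> j" "j \<le> n" "1 \<le> k" "k \<le> n"
  shows "\<lbrace>u n, sym_elt (gen_row b) u diag j k\<rbrace> \<in> S"
proof -
  let ?y = "sym_elt (gen_row b) u diag"
  note S = submoduleD [OF assms(1)]
  define m where "m = n - 1"
  have m: "1 \<le> m" "n = Suc m" "m < n" using n_ge by (auto simp: m_def)
  have Sm: "Suc m = n" and g: "gen_row b m n = 1" using m(2) by (simp_all add: gen_row_def)
  have un: "u n \<in> carrier L" "u n \<in> S" using n_ge y [of n n] by auto
  have um: "u m \<in> carrier L" using m by simp
  have comm_step: "\<lbrace>u n, \<lbrace>u i, x\<rbrace>\<rbrace> \<in> S" if "1 \<le> i" "i < m" "x \<in> S" "\<lbrace>u n, x\<rbrace> \<in> S" for i x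
  proof -
    have "\<lbrace>u n, u i\<rbrace> = \<zero>" using that m by (intro u_far) auto
    then have "\<lbrace>u n, \<lbrace>u i, x\<rbrace>\<rbrace> = \<lbrace>u i, \<lbrace>u n, x\<rbrace>\<rbrace>"
      using that m S(1) un by (intro bracket_commute) auto
    then show ?thesis using that closed m by simp
  qed
  have ymn: "?y m n \<in> carrier L" "?y m n \<in> S" using m y [of m n] S(1) by auto
  have descend: "\<lbrace>u m, u n\<rbrace> = 2 \<odot> ?y m n"
    using u_diag_below [of m] m(1,3) unfolding Sm by (simp add: g)
  \<comment> \<open>The bracket of u_{n-1} with u_n is 2 e_{n-1} e_n, so the relation with two
    factors u_n evaluates this bracket as b_{n-1} u_n.\<close>
  have top1: "\<lbrace>u n, ?y m n\<rbrace> \<in> S"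
  proof -
    have "2 \<odot> \<lbrace>u n, ?y m n\<rbrace> = \<lbrace>u n, \<lbrace>u m, u n\<rbrace>\<rbrace>"
      unfolding descend using ymn un by (simp add: bracket_smult_right)
    also have "\<dots> = (-1) \<odot> \<lbrace>u n, \<lbrace>u n, u m\<rbrace>\<rbrace>"
      using um un by (subst bracket_antisym) (simp_all add: bracket_smult_right)
    also have "\<dots> = 2 \<odot> (b m \<odot> u n)"
      using serre_lower [of m] m un by (simp add: smult_smult)
    finally have "\<lbrace>u n, ?y m n\<rbrace> = b m \<odot> u n" by (rule smult_cancel) (use un ymn in auto)
    then show ?thesis using un S by simp
  qed
  \<comment> \<open>In the Leibniz expansion the bracket of u_n with u_{n-1} is a multiple of
    \<open>?y m n\<close>, so the first summand is the bracket of an element with itself.\<close>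
  have top2: "\<lbrace>u n, diag m\<rbrace> \<in> S"
  proof -
    have "diag m = \<lbrace>u m, ?y m n\<rbrace>"
      using u_next_lower [of m] m(1,3) unfolding Sm by (simp add: g)
    then have "\<lbrace>u n, diag m\<rbrace> = \<lbrace>\<lbrace>u n, u m\<rbrace>, ?y m n\<rbrace> \<oplus> \<lbrace>u m, \<lbrace>u n, ?y m n\<rbrace>\<rbrace>"
      using bracket_leibniz [OF un(1) um ymn(1)] by simp
    also have "\<lbrace>u n, u m\<rbrace> = (-2) \<odot> ?y m n"
      using bracket_antisym [OF un(1) um] descend ymn by (simp add: smult_smult)
    also have "\<lbrace>(-2) \<odot> ?y m n, ?y m n\<rbrace> = \<zero>"
      using ymn by (simp add: bracket_smult_left bracket_self)
    finally show ?thesis using closed [of m] m top1 S by simp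
  qed
  have diag: "\<lbrace>u n, diag k\<rbrace> \<in> S" if k: "1 \<le> k" "k \<le> n" for k
  proof (cases "k = n")
    case True
    then show ?thesis using un S by (simp add: bracket_self)
  next
    case False
    then have "k \<le> m" using k m by simp
    then show ?thesis using k(1)
    proof (induction k rule: inc_induct)
      case base
      show ?case by (rule top2)
    next
      case (step k)
      have d: "diag (Suc k) \<in> S" using y [of "Suc k" "Suc k"] step m by simp
      have "\<lbrace>u n, \<lbrace>u k, \<lbrace>u k, diag (Suc k)\<rbrace>\<rbrace>\<rbrace> \<in> S"
        using step d m closed [of k] by (intro comm_step) auto
      moreover have "diag k = inverse 2 \<odot> \<lbrace>u k, \<lbrace>u k, diag (Suc k)\<rbrace>\<rbrace>"
        using step m(3) by (intro diag_rec) simp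
      moreover have "u k \<in> carrier L" "diag (Suc k) \<in> carrier L" using step m(3) d S(1) by auto
      ultimately show ?case using un(1) by (simp add: bracket_smult_right S(4))
    qed
  qed
  have low: "\<lbrace>u n, ?y j k\<rbrace> \<in> S" if low: "1 \<le> j" "j \<le> k" "k \<le> n" for j k
    using low(2,1)
  proof (induction j rule: inc_induct)
    case base
    then show ?case using diag low by simp
  next
    case (step j)
    show ?case
    proof (cases "j = m")
      case True
      then have "k = n" using step m that by auto
      with True top1 show ?thesis by simp
    next
      case False
      obtain c where c: "c \<noteq> 0" "\<lbrace>u j, ?y (Suc j) k\<rbrace> = c \<odot> ?y j k"
        using y_descend [of j k] step low by auto
      have yjk: "?y j k \<in> carrier L" "?y (Suc j) k \<in> S"
        using step low y [of j k] y [of "Suc j" k] S(1) by auto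
      have "\<lbrace>u n, \<lbrace>u j, ?y (Suc j) k\<rbrace>\<rbrace> \<in> S"
        using step False low m(2) yjk by (intro comm_step) auto
      then have "inverse c \<odot> (c \<odot> \<lbrace>u n, ?y j k\<rbrace>) \<in> S"
        unfolding c using un yjk S by (simp add: bracket_smult_right)
      then show ?thesis using c un yjk by (simp add: smult_smult)
    qed
  qed
  show ?thesis using low [of j k] low [of k j] jk
    by (cases "j \<le> k") (simp_all add: sym_elt_commute [of _ _ _ k j])
qed

lemma upper_right_add:
  assumes "M \<in> carrier_mat (n + n) (n + n)" "N \<in> carrier_mat (n + n) (n + n)"
  shows "upper_right n (M + N) = upper_right n M + upper_right n N"
  using assms by (intro eq_matI) (auto simp: upper_right_def)

lemma upper_right_smult:
  assumes "M \<in> carrier_mat (n + n) (n + n)"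
  shows "upper_right n (a \<cdot>\<^sub>m M) = a \<cdot>\<^sub>m upper_right n M"
  using assms by (intro eq_matI) (auto simp: upper_right_def)

lemma upper_right_carrier [simp]: "upper_right n M \<in> carrier_mat n n"
  by (simp add: upper_right_def)

lemma sl_mat_carrierD: "M \<in> carrier (sl_mat n) \<Longrightarrow> M \<in> carrier_mat n n"
  by (simp add: sl_mat_def)

lemma (in lie_algebra) sym_coordinates_rep:
  assumes P: "P \<in> lie_hom L (sl_mat (n + n))"
    and "\<And>j k. 1 \<le> j \<Longrightarrow> j \<le> n \<Longrightarrow> 1 \<le> k \<Longrightarrow> k \<le> n \<Longrightarrow> y j k \<in> carrier L"
    and "\<And>j k. y j k = y k j"
    and "\<And>j k. 1 \<le> j \<Longrightarrow> j \<le> n \<Longrightarrow> 1 \<le> k \<Longrightarrow> k \<le> n \<Longrightarrow> P (y j k) = sp_rep n b (0\<^sub>m n n) (esym n j k)"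
  shows "sym_coordinates L n y (\<lambda>x. upper_right n (P x))"
  by unfold_locales
    (use assms in \<open>auto simp: lie_homD [OF P] sl_mat_ops upper_right_sp_rep
      intro!: upper_right_add upper_right_smult sl_mat_carrierD lie_homD(1) [OF P]\<close>)

section \<open>The ideal generated by u_n as the span of the e_j e_k\<close>

locale sp_setting =
  fixes n :: nat and b :: "nat \<Rightarrow> complex"
  assumes n_ge_2: "2 \<le> n"
begin

abbreviation "SP \<equiv> sp_alg n b"
abbreviation "SL \<equiv> sl_alg n b"
abbreviation "g \<equiv> sp_gen n b"

lemma SP_lie: "lie_algebra SP" and SL_lie: "lie_algebra SL"
  by (simp_all add: sp_alg_def sl_alg_def lie_algebra_presented)

lemma g_pres: "g = lie_pres_gen {1..n} (sp_relations n b)"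
  by (simp add: fun_eq_iff sp_gen_def lie_pres_gen_def)

lemma sl_gen_pres: "sl_gen n b = lie_pres_gen {1..n - 1} (sl_relations n b)"
  by (simp add: fun_eq_iff sl_gen_def lie_pres_gen_def)

lemma g_relation:
  assumes "(s, t) \<in> sp_relations n b"
  shows "lie_eval SP g s = lie_eval SP g t"
proof -
  have "s \<in> lie_terms {1..n} \<and> t \<in> lie_terms {1..n}"
    using assms n_ge_2 by (auto simp: sp_relations_def)
  then show ?thesis
    unfolding sp_alg_def g_pres using lie_pres_gen_relation [OF assms] by blast
qed

lemma g_closed: "1 \<le> i \<Longrightarrow> i \<le> n \<Longrightarrow> g i \<in> carrier SP"
  by (simp add: g_pres sp_alg_def)

end

sublocale sp_setting \<subseteq> SP: lie_algebra SP
  by (rule SP_lie)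

sublocale sp_setting \<subseteq> SL: lie_algebra SL
  by (rule SL_lie)

sublocale sp_setting \<subseteq> E: sp_elements SP n b g
proof unfold_locales
  fix i j assume ij: "1 \<le> i" "i \<le> n" "1 \<le> j" "j \<le> n" "i \<noteq> Suc j" "j \<noteq> Suc i"
  show "\<lbrace>g i, g j\<rbrace>\<^bsub>SP\<^esub> = \<zero>\<^bsub>SP\<^esub>"
  proof (cases "i = j")
    case True
    then show ?thesis using ij g_closed by (simp add: SP.bracket_self)
  next
    case False
    then have "(Br (Gen i) (Gen j), Zero) \<in> sp_relations n b"
      using ij by (auto simp: sp_relations_def)
    from g_relation [OF this] show ?thesis by simp
  qed
next
  fix i assume i: "1 \<le> i" "Suc i < n"
  then have "(Br (Gen i) (Br (Gen i) (Gen (Suc i))), Scale (- 2 * b (min i (Suc i))) (Gen i))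
    \<in> sp_relations n b"
    unfolding sp_relations_def by fastforce
  from g_relation [OF this] show "\<lbrace>g i, \<lbrace>g i, g (Suc i)\<rbrace>\<^bsub>SP\<^esub>\<rbrace>\<^bsub>SP\<^esub> = (- 2 * b i) \<odot>\<^bsub>SP\<^esub> g i" by simp
next
  fix i assume i: "1 \<le> i" "Suc i \<le> n"
  have "(Br (Gen (Suc i)) (Br (Gen (Suc i)) (Gen i)), Scale (- 2 * b (min (Suc i) i)) (Gen (Suc i)))
    \<in> sp_relations n b"
  proof (cases "Suc i = n")
    case True
    then show ?thesis by (auto simp: sp_relations_def)
  next
    case False
    then show ?thesis using i unfolding sp_relations_def by fastforce
  qed
  from g_relation [OF this]
  show "\<lbrace>g (Suc i), \<lbrace>g (Suc i), g i\<rbrace>\<^bsub>SP\<^esub>\<rbrace>\<^bsub>SP\<^esub> = (- 2 * b i) \<odot>\<^bsub>SP\<^esub> g (Suc i)" by simp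
next
  have "(Br (Gen (n - 1)) (Br (Gen (n - 1)) (Br (Gen (n - 1)) (Gen n))), Zero) \<in> sp_relations n b"
    by (simp add: sp_relations_def)
  from g_relation [OF this]
  show "\<lbrace>g (n - 1), \<lbrace>g (n - 1), \<lbrace>g (n - 1), g n\<rbrace>\<^bsub>SP\<^esub>\<rbrace>\<^bsub>SP\<^esub>\<rbrace>\<^bsub>SP\<^esub> = \<zero>\<^bsub>SP\<^esub>" by simp
qed (use n_ge_2 g_closed in auto)

context sp_setting
begin

definition rep where "rep = lie_lift (sl_mat (n + n)) (sp_gen_mat n b)"

lemma rep_hom: "rep \<in> lie_hom SP (sl_mat (n + n))"
  unfolding rep_def sp_alg_def
  by (rule lie_algebra.lie_lift_hom [OF lie_algebra_sl_mat sp_gen_mat_closed sp_gen_mat_relations [OF n_ge_2]])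

lemma rep_class: "t \<in> lie_terms {1..n}
  \<Longrightarrow> rep (lie_class {1..n} (sp_relations n b) t) = lie_eval (sl_mat (n + n)) (sp_gen_mat n b) t"
  unfolding rep_def 
  by (rule lie_algebra.lie_lift_class [OF lie_algebra_sl_mat sp_gen_mat_closed sp_gen_mat_relations [OF n_ge_2]])

lemma rep_gen: "1 \<le> i \<Longrightarrow> i \<le> n \<Longrightarrow> rep (g i) = sp_gen_mat n b i"
  using rep_class [of "Gen i"] by (simp add: sp_gen_def)

abbreviation "y \<equiv> SP.sym_elt (gen_row b) g E.diag"

lemma rep_y:
  assumes "1 \<le> j" "j \<le> n" "1 \<le> k" "k \<le> n"
  shows "rep (y j k) = sp_rep n b (0\<^sub>m n n) (esym n j k)"
proof (rule SP.sym_elt_rep [OF rep_hom])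
  fix i j k assume "1 \<le> i" "i < n" "1 \<le> j" "j \<le> n" "1 \<le> k" "k \<le> n"
  then show "\<lbrace>rep (g i), sp_rep n b (0\<^sub>m n n) (1 \<cdot>\<^sub>m esym n j k)\<rbrace>\<^bsub>sl_mat (n + n)\<^esub> =
        sp_rep n b (0\<^sub>m n n) (1 \<cdot>\<^sub>m (gen_row b i j \<cdot>\<^sub>m esym n i k + gen_row b i k \<cdot>\<^sub>m esym n j i))"
    using sp_gen_mat_act [of i n j k b 1] by (simp add: rep_gen)
next
  fix k assume "1 \<le> k" "k \<le> n"
  then show "rep (E.diag k) = sp_rep n b (0\<^sub>m n n) (esym n k k)"
    by (intro E.diag_rep rep_hom rep_gen)
qed (use assms E.h_far E.h_Suc in \<open>auto simp: E.u_closed\<close>)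

end

sublocale sp_setting \<subseteq> C: sym_coordinates SP n y "\<lambda>x. upper_right n (rep x)"
  by (rule SP.sym_coordinates_rep [OF rep_hom _ _ rep_y])
    (auto simp: E.y_closed SP.sym_elt_commute)

context sp_setting
begin

abbreviation "\<psi> \<equiv> \<lambda>x. upper_right n (rep x)"
abbreviation "Z \<equiv> C.sym_span"
abbreviation "J \<equiv> SP\<lparr>carrier := Z\<rparr>"

text \<open>On Z the whole matrix is determined by its upper right block. Brackets inside Z can
  therefore be computed with matrices.\<close>

lemma rep_Z:
  assumes "a \<in> Z"
  shows "rep a = sp_rep n b (0\<^sub>m n n) (\<psi> a)"
proof -
  have "Z \<subseteq> {a \<in> carrier SP. rep a = sp_rep n b (0\<^sub>m n n) (\<psi> a)}"
  proof (rule C.sym_span_least, rule SP.submoduleI)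
    show "\<zero>\<^bsub>SP\<^esub> \<in> {a \<in> carrier SP. rep a = sp_rep n b (0\<^sub>m n n) (\<psi> a)}"
      by (simp add: C.coord_zero) (simp add: lie_hom_zero [OF SP_lie lie_algebra_sl_mat rep_hom] sl_mat_ops sp_rep_zero)
  next
    fix x z assume "x \<in> {a \<in> carrier SP. rep a = sp_rep n b (0\<^sub>m n n) (\<psi> a)}"
      "z \<in> {a \<in> carrier SP. rep a = sp_rep n b (0\<^sub>m n n) (\<psi> a)}"
    then show "x \<oplus>\<^bsub>SP\<^esub> z \<in> {a \<in> carrier SP. rep a = sp_rep n b (0\<^sub>m n n) (\<psi> a)}"
      using sp_rep_add [of "0\<^sub>m n n" n "0\<^sub>m n n" "\<psi> x" "\<psi> z" b]
      by (simp add: C.coord_add) (simp add: lie_homD [OF rep_hom] sl_mat_ops)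
  next
    fix x r assume "x \<in> {a \<in> carrier SP. rep a = sp_rep n b (0\<^sub>m n n) (\<psi> a)}"
    then show "r \<odot>\<^bsub>SP\<^esub> x \<in> {a \<in> carrier SP. rep a = sp_rep n b (0\<^sub>m n n) (\<psi> a)}"
      using sp_rep_smult [of "0\<^sub>m n n" n "\<psi> x" b r]
      by (simp add: C.coord_smult) (simp add: lie_homD [OF rep_hom] sl_mat_ops)
  qed (auto simp: rep_y upper_right_sp_rep)
  with assms show ?thesis by blast
qed

lemma Z_ideal: "lie_ideal Z SP"
  unfolding sp_alg_def
proof (rule lie_presented_idealI; fold sp_alg_def g_pres)
  show "submodule class_ring Z SP" by (rule C.sym_span_submodule)
  fix i x assume i: "i \<in> {1..n}" and x: "x \<in> Z"
  have low: "\<lbrace>g i, x\<rbrace>\<^bsub>SP\<^esub> \<in> Z" if "1 \<le> i" "i < n" "x \<in> Z" for i x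
  proof (rule C.bracket_sym_span [OF _ _ that(3)])
    show "g i \<in> carrier SP" using that by simp
    fix j k assume "1 \<le> j" "j \<le> n" "1 \<le> k" "k \<le> n"
    then show "\<lbrace>g i, y j k\<rbrace>\<^bsub>SP\<^esub> \<in> Z"
      using that by (simp add: E.u_y SP.submoduleD [OF C.sym_span_submodule] C.basis_in_sym_span)
  qed
  show "\<lbrace>g i, x\<rbrace>\<^bsub>SP\<^esub> \<in> Z"
  proof (cases "i = n")
    case True
    have "\<lbrace>g n, y j k\<rbrace>\<^bsub>SP\<^esub> \<in> Z" if "1 \<le> j" "j \<le> n" "1 \<le> k" "k \<le> n" for j k
      by (rule E.bracket_top_closed) (use that C.sym_span_submodule C.basis_in_sym_span low in auto)
    then show ?thesis unfolding True using n_ge_2 by (intro C.bracket_sym_span [OF _ _ x]) auto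
  next
    case False
    then show ?thesis using low i x by auto
  qed
qed

text \<open>Starting from u_n = e_n e_n, each \<open>y j k\<close> arises by brackets and division
  by nonzero scalars, and an ideal is closed under both.\<close>

lemma Z_least:
  assumes T: "lie_ideal T SP" and "g n \<in> T"
  shows "Z \<subseteq> T"
proof -
  have sub: "submodule class_ring T SP" and br: "\<And>x z. x \<in> carrier SP \<Longrightarrow> z \<in> T \<Longrightarrow> \<lbrace>x, z\<rbrace>\<^bsub>SP\<^esub> \<in> T"
    using T by (auto simp: lie_ideal_def)
  note T' = SP.submoduleD [OF sub]
  have diag: "E.diag k \<in> T" if "k \<le> n" "1 \<le> k" for k
    using that
  proof (induction k rule: inc_induct)
    case base
    then show ?case using assms by simp
  next
    case (step k)
    then show ?case by (simp add: E.diag_rec T' br)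
  qed
  have low: "y j k \<in> T" if low: "1 \<le> j" "j \<le> k" "k \<le> n" for j k
    using low(2,1)
  proof (induction j rule: inc_induct)
    case base
    then show ?case using diag low by simp
  next
    case (step j)
    obtain c where c: "c \<noteq> 0" "\<lbrace>g j, y (Suc j) k\<rbrace>\<^bsub>SP\<^esub> = c \<odot>\<^bsub>SP\<^esub> y j k"
      using E.y_descend [of j k] step low by auto
    have "\<lbrace>g j, y (Suc j) k\<rbrace>\<^bsub>SP\<^esub> \<in> T"
      using step low by (intro br) auto
    then have "inverse c \<odot>\<^bsub>SP\<^esub> (c \<odot>\<^bsub>SP\<^esub> y j k) \<in> T" unfolding c by (rule T'(4))
    then show ?case using c step low by (simp add: SP.smult_smult)
  qed
  show ?thesis
  proof (rule C.sym_span_least [OF sub])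
    fix j k assume "1 \<le> j" "j \<le> n" "1 \<le> k" "k \<le> n"
    then show "y j k \<in> T" using low [of j k] low [of k j]
      by (cases "j \<le> k") (simp_all add: SP.sym_elt_commute [of _ _ _ k j])
  qed
qed

lemma gn_Z: "g n \<in> Z"
  using C.basis_in_sym_span [of n n] n_ge_2 by simp

lemma J_eq: "lie_ideal_generated SP {g n} = J"
  using gn_Z Z_least by (intro SP.lie_ideal_generated_eq Z_ideal) auto

lemma J_lie: "lie_algebra J"
  by (intro SP.lie_algebra_restrict SP.lie_ideal_subalgebra Z_ideal)

lemma Z_carrier: "a \<in> Z \<Longrightarrow> a \<in> carrier SP"
  using SP.submoduleD(1) [OF C.sym_span_submodule] by blast

lemma Z_closed: "a \<in> Z \<Longrightarrow> c \<in> Z \<Longrightarrow> a \<oplus>\<^bsub>SP\<^esub> c \<in> Z" "a \<in> Z \<Longrightarrow> r \<odot>\<^bsub>SP\<^esub> a \<in> Z"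
  "x \<in> carrier SP \<Longrightarrow> a \<in> Z \<Longrightarrow> \<lbrace>x, a\<rbrace>\<^bsub>SP\<^esub> \<in> Z" "a \<in> Z \<Longrightarrow> x \<in> carrier SP \<Longrightarrow> \<lbrace>a, x\<rbrace>\<^bsub>SP\<^esub> \<in> Z" "\<zero>\<^bsub>SP\<^esub> \<in> Z"
  using Z_ideal SP.lie_ideal_bracket_right [OF Z_ideal] SP.submoduleD [OF C.sym_span_submodule]
  by (auto simp: lie_ideal_def)

section \<open>The splitting off of the first factor\<close>

lemma lie_terms_mono: "t \<in> lie_terms {1..n - 1} \<Longrightarrow> t \<in> lie_terms {1..n}"
  unfolding lie_terms_def by (auto elim!: subset_trans)

definition iota where "iota = lie_lift SP g"

lemma sl_relation_g: "(s, t) \<in> sl_relations n b \<Longrightarrow> lie_eval SP g s = lie_eval SP g t"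
  by (rule g_relation) (auto simp: sl_relations_def sp_relations_def)

lemma g_image: "g ` {1..n - 1} \<subseteq> carrier SP"
  by auto

lemma iota_hom: "iota \<in> lie_hom SL SP"
  unfolding iota_def sl_alg_def by (rule SP.lie_lift_hom [OF g_image sl_relation_g])

lemma iota_class:
  assumes "t \<in> lie_terms {1..n - 1}"
  shows "iota (lie_class {1..n - 1} (sl_relations n b) t) = lie_class {1..n} (sp_relations n b) t"
proof -
  have t: "t \<in> lie_terms {1..n}" using assms by (rule lie_terms_mono)
  show ?thesis
    using SP.lie_lift_class [OF g_image sl_relation_g assms] lie_eval_pres_gen [OF t, of "sp_relations n b"]
    by (simp add: iota_def sp_alg_def g_pres del: One_nat_def)
qed

lemma iota_gen: "1 \<le> i \<Longrightarrow> i < n \<Longrightarrow> iota (sl_gen n b i) = g i"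
  using iota_class [of "Gen i"] by (simp add: sl_gen_def sp_gen_def)

lemmas iota = lie_homD [OF iota_hom]

lemma rep_iota:
  assumes "x \<in> carrier SL"
  shows "form_invariant n b (sl_incl n b x) \<and> rep (iota x) = sp_rep n b (sl_incl n b x) (0\<^sub>m n n)"
proof -
  obtain t where t: "t \<in> lie_terms {1..n - 1}" "x = lie_class {1..n - 1} (sl_relations n b) t"
    using assms by (auto simp: sl_alg_def lie_presented_simps)
  have "t \<in> lie_terms {1..n}" using t(1) by (rule lie_terms_mono)
  moreover have "sl_incl n b x = lie_eval (sl_mat n) (sl_gen_mat n b) t"
    unfolding t(2) sl_incl_def
    by (rule lie_algebra.lie_lift_class [OF lie_algebra_sl_mat sl_gen_mat_closed sl_gen_mat_relations t(1)])
  ultimately show ?thesis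
    using sp_eval_sl_terms [OF t(1), of b] t by (simp add: iota_class rep_class del: One_nat_def)
qed

text \<open>The homomorphism that kills u_n and fixes the other generators. As a retraction of
  \<open>iota\<close> it gives injectivity of \<open>iota\<close> and uniqueness in the
  decomposition.\<close>

definition rho where "rho = lie_lift SL (\<lambda>i. if i < n then sl_gen n b i else \<zero>\<^bsub>SL\<^esub>)"

lemma sl_gen_closed: "1 \<le> i \<Longrightarrow> i < n \<Longrightarrow> sl_gen n b i \<in> carrier SL"
  by (simp add: sl_gen_pres sl_alg_def)

lemma rho_image: "(\<lambda>i. if i < n then sl_gen n b i else \<zero>\<^bsub>SL\<^esub>) ` {1..n} \<subseteq> carrier SL"
  by (auto intro: sl_gen_closed)

lemma rho_relation:
  assumes "(s, t) \<in> sp_relations n b"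
  shows "lie_eval SL (\<lambda>i. if i < n then sl_gen n b i else \<zero>\<^bsub>SL\<^esub>) s =
    lie_eval SL (\<lambda>i. if i < n then sl_gen n b i else \<zero>\<^bsub>SL\<^esub>) t"
proof -
  let ?r = "\<lambda>i. if i < n then sl_gen n b i else \<zero>\<^bsub>SL\<^esub>"
  have r: "?r i \<in> carrier SL" if "1 \<le> i" "i \<le> n" for i using rho_image that by auto
  have ev: "lie_eval SL ?r t = lie_eval SL (sl_gen n b) t" if "t \<in> lie_terms {1..n - 1}" for t
    using that by (induction t) auto
  have c: "sl_gen n b i \<in> carrier SL" if "1 \<le> i" "i < n" for i using r [of i] that by simp
  show ?thesis using assms n_ge_2
  proof (cases rule: sp_relations_cases)
    case sl
    then have "lie_eval SL (sl_gen n b) s = lie_eval SL (sl_gen n b) t"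
      unfolding sl_alg_def sl_gen_pres by (intro lie_pres_gen_relation)
    then show ?thesis using sl by (simp add: ev)
  qed (use c [of "n - 1"] c n_ge_2 in auto)
qed

lemma rho_hom: "rho \<in> lie_hom SP SL"
  unfolding rho_def sp_alg_def by (rule SL.lie_lift_hom [OF rho_image rho_relation])

lemmas rho = lie_homD [OF rho_hom]

lemma rho_gen: "1 \<le> i \<Longrightarrow> i \<le> n \<Longrightarrow> rho (g i) = (if i < n then sl_gen n b i else \<zero>\<^bsub>SL\<^esub>)"
  unfolding rho_def g_pres using SL.lie_lift_gen [OF rho_image rho_relation, where i = i] by simp

lemma rho_iota:
  assumes "x \<in> carrier SL"
  shows "rho (iota x) = x"
proof (rule lie_presented_hom_eqI [of SL "\<lambda>x. rho (iota x)" "{1..n - 1}" "sl_relations n b" "\<lambda>x. x"])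
  show "(\<lambda>x. rho (iota x)) \<in> lie_hom (lie_presented {1..n - 1} (sl_relations n b)) SL"
    using lie_hom_comp [OF iota_hom rho_hom] by (simp add: sl_alg_def)
  show "(\<lambda>x. x) \<in> lie_hom (lie_presented {1..n - 1} (sl_relations n b)) SL"
    by (rule lie_homI) (simp_all add: sl_alg_def)
  fix i assume "i \<in> {1..n - 1}"
    then have "1 \<le> i" "i < n" using n_ge_2 by auto
    then show "rho (iota (lie_pres_gen {1..n - 1} (sl_relations n b) i)) = lie_pres_gen {1..n - 1} (sl_relations n b) i"
      unfolding sl_gen_pres [symmetric] by (simp add: iota_gen rho_gen)
qed (use assms SL_lie in \<open>simp_all add: sl_alg_def\<close>)

text \<open>The kernel of \<open>rho\<close> is an ideal that contains u_n, hence contains the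
  smallest such ideal Z.\<close>

lemma rho_Z:
  assumes "a \<in> Z"
  shows "rho a = \<zero>\<^bsub>SL\<^esub>"
proof -
  have "lie_ideal {a \<in> carrier SP. rho a = \<zero>\<^bsub>SL\<^esub>} SP"
    unfolding lie_ideal_def
    by (intro conjI SP.submoduleI) (auto simp: rho lie_hom_zero [OF SP_lie SL_lie rho_hom])
  from Z_least [OF this] show ?thesis using assms n_ge_2 by (auto simp: rho_gen)
qed

lemma iota_iso: "iota \<in> lie_iso SL (lie_subalgebra_generated SP (g ` {1..n - 1}))"
proof -
  let ?S = "iota ` carrier SL"
  have gen: "sl_gen n b i \<in> carrier SL" if "i \<in> {1..n - 1}" for i
    using that by (simp add: sl_alg_def sl_gen_pres)
  have "?S \<subseteq> T" if T: "lie_subalgebra T SP" "g ` {1..n - 1} \<subseteq> T" for T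
  proof -
    have "carrier SL \<subseteq> {x \<in> carrier SL. iota x \<in> T}"
      unfolding sl_alg_def
    proof (rule lie_presented_generated; fold sl_alg_def sl_gen_pres)
      show "lie_subalgebra {x \<in> carrier SL. iota x \<in> T} SL"
        by (rule SL.lie_subalgebra_vimage [OF SP_lie iota_hom T(1)])
    qed (use T(2) gen in \<open>auto simp: iota_gen\<close>)
    then show ?thesis by auto
  qed
  moreover have "g ` {1..n - 1} \<subseteq> ?S"
  proof (clarify)
    fix i assume "i \<in> {1..n - 1}"
    then show "g i \<in> ?S" using gen [of i] iota_gen [of i]
      by (intro image_eqI [of _ _ "sl_gen n b i"]) auto
  qed
  ultimately have "lie_subalgebra_generated SP (g ` {1..n - 1}) = SP\<lparr>carrier := ?S\<rparr>"
    by (intro SP.lie_subalgebra_generated_eq SP.lie_subalgebra_image SL_lie iota_hom)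
  moreover have "inj_on iota (carrier SL)"
    by (rule inj_on_inverseI [where g = rho]) (rule rho_iota)
  moreover have "iota \<in> lie_hom SL (SP\<lparr>carrier := ?S\<rparr>)"
    by (rule lie_homI) (simp_all add: iota)
  ultimately show ?thesis by (simp add: lie_iso_def bij_betw_def)
qed

abbreviation "act \<equiv> \<lambda>x a. \<lbrace>iota x, a\<rbrace>\<^bsub>SP\<^esub>"

text \<open>Negatives in \<open>J\<close> are defined through its own carrier, so subtraction is
  first rewritten with operations that \<open>J\<close> shares with \<open>SP\<close>.\<close>

lemma J_minus: "a \<in> Z \<Longrightarrow> c \<in> Z \<Longrightarrow> a \<ominus>\<^bsub>J\<^esub> c = a \<oplus>\<^bsub>SP\<^esub> (-1) \<odot>\<^bsub>SP\<^esub> c"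
proof -
  interpret J: lie_algebra J by (rule J_lie)
  show "a \<in> Z \<Longrightarrow> c \<in> Z \<Longrightarrow> a \<ominus>\<^bsub>J\<^esub> c = a \<oplus>\<^bsub>SP\<^esub> (-1) \<odot>\<^bsub>SP\<^esub> c"
    by (simp add: J.M.minus_eq J.neg_eq_smult)
qed

text \<open>Both compatibility with brackets of the first factor and the derivation rule are
  instances of the Jacobi identity.\<close>

lemma derivation_action: "lie_derivation_action SL J act"
proof -
  interpret J: lie_algebra J by (rule J_lie)
  show ?thesis
  proof (intro lie_derivation_action.intro lie_module.intro lie_module_axioms.intro
      lie_derivation_action_axioms.intro SL_lie J_lie J.vectorspace_axioms)
    fix x assume "x \<in> carrier SL"
    then show "act x \<in> LinearCombinations.module_hom class_ring J J"
      by (auto simp: LinearCombinations.module_hom_def iota Z_closed Z_carrier SP.bracket_add_right SP.bracket_smult_right)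
  next
    fix x z a assume x: "x \<in> carrier SL" "z \<in> carrier SL" "a \<in> carrier J"
    then have [simp]: "iota x \<in> carrier SP" "iota z \<in> carrier SP" "a \<in> carrier SP"
      by (simp_all add: iota Z_carrier)
    show "act (\<lbrace>x, z\<rbrace>\<^bsub>SL\<^esub>) a = act x (act z a) \<ominus>\<^bsub>J\<^esub> act z (act x a)"
      using x by (simp add: iota J_minus Z_closed SP.bracket_leibniz [of "iota x" "iota z" a] SP.M.a_assoc
          SP.M.r_neg flip: SP.neg_eq_smult)
  next
    fix x a c assume x: "x \<in> carrier SL" "a \<in> carrier J" "c \<in> carrier J"
    then show "act x (\<lbrace>a, c\<rbrace>\<^bsub>J\<^esub>) = \<lbrace>act x a, c\<rbrace>\<^bsub>J\<^esub> \<oplus>\<^bsub>J\<^esub> \<lbrace>a, act x c\<rbrace>\<^bsub>J\<^esub>"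
      by (simp add: iota Z_carrier SP.bracket_leibniz [of "iota x" a c])
  qed (auto simp: iota Z_carrier SP.bracket_add_left SP.bracket_smult_left)
qed

text \<open>The sums form a subalgebra because Z is an ideal, and they contain all
  generators.\<close>

lemma SP_decomp:
  assumes "w \<in> carrier SP"
  shows "\<exists>x\<in>carrier SL. \<exists>a\<in>Z. w = iota x \<oplus>\<^bsub>SP\<^esub> a"
proof -
  let ?S = "{w. \<exists>x\<in>carrier SL. \<exists>a\<in>Z. w = iota x \<oplus>\<^bsub>SP\<^esub> a}"
  have 0: "iota \<zero>\<^bsub>SL\<^esub> = \<zero>\<^bsub>SP\<^esub>" by (rule lie_hom_zero [OF SL_lie SP_lie iota_hom])
  have SI: "iota x \<oplus>\<^bsub>SP\<^esub> a \<in> ?S" if "x \<in> carrier SL" "a \<in> Z" for x a using that by blast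
  have "carrier SP \<subseteq> ?S"
    unfolding sp_alg_def
  proof (rule lie_presented_generated; fold sp_alg_def g_pres)
    show "lie_subalgebra ?S SP" unfolding lie_subalgebra_def
    proof (intro conjI SP.submoduleI ballI)
      show "\<zero>\<^bsub>SP\<^esub> \<in> ?S" using SI [of "\<zero>\<^bsub>SL\<^esub>" "\<zero>\<^bsub>SP\<^esub>"] Z_closed by (simp add: 0)
      show "?S \<subseteq> carrier SP" using Z_carrier iota by auto
    next
      fix v w assume "v \<in> ?S" "w \<in> ?S"
      then obtain x a z c where v: "x \<in> carrier SL" "a \<in> Z" "v = iota x \<oplus>\<^bsub>SP\<^esub> a"
        and w: "z \<in> carrier SL" "c \<in> Z" "w = iota z \<oplus>\<^bsub>SP\<^esub> c" by blast
      have [simp]: "iota x \<in> carrier SP" "iota z \<in> carrier SP" "a \<in> carrier SP" "c \<in> carrier SP"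
        using v w by (simp_all add: iota Z_carrier)
      have "v \<oplus>\<^bsub>SP\<^esub> w = iota (x \<oplus>\<^bsub>SL\<^esub> z) \<oplus>\<^bsub>SP\<^esub> (a \<oplus>\<^bsub>SP\<^esub> c)"
        using v w by (simp add: iota SP.M.a_ac)
      then show "v \<oplus>\<^bsub>SP\<^esub> w \<in> ?S" using SI [of "x \<oplus>\<^bsub>SL\<^esub> z" "a \<oplus>\<^bsub>SP\<^esub> c"] v w by (simp add: Z_closed)
      have "\<lbrace>v, w\<rbrace>\<^bsub>SP\<^esub> = iota (\<lbrace>x, z\<rbrace>\<^bsub>SL\<^esub>) \<oplus>\<^bsub>SP\<^esub>
          (\<lbrace>iota x, c\<rbrace>\<^bsub>SP\<^esub> \<oplus>\<^bsub>SP\<^esub> (\<lbrace>a, iota z\<rbrace>\<^bsub>SP\<^esub> \<oplus>\<^bsub>SP\<^esub> \<lbrace>a, c\<rbrace>\<^bsub>SP\<^esub>))"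
        using v w by (simp add: iota SP.bracket_add_left SP.bracket_add_right SP.M.a_ac)
      moreover have "\<lbrace>iota x, c\<rbrace>\<^bsub>SP\<^esub> \<oplus>\<^bsub>SP\<^esub> (\<lbrace>a, iota z\<rbrace>\<^bsub>SP\<^esub> \<oplus>\<^bsub>SP\<^esub> \<lbrace>a, c\<rbrace>\<^bsub>SP\<^esub>) \<in> Z"
        using v w by (intro Z_closed) simp_all
      ultimately show "\<lbrace>v, w\<rbrace>\<^bsub>SP\<^esub> \<in> ?S" using SI v w by simp
    next
      fix r v assume "v \<in> ?S"
      then obtain x a where v: "x \<in> carrier SL" "a \<in> Z" "v = iota x \<oplus>\<^bsub>SP\<^esub> a" by blast
      then have "r \<odot>\<^bsub>SP\<^esub> v = iota (r \<odot>\<^bsub>SL\<^esub> x) \<oplus>\<^bsub>SP\<^esub> (r \<odot>\<^bsub>SP\<^esub> a)"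
        by (simp add: iota SP.smult_add_right Z_carrier)
      then show "r \<odot>\<^bsub>SP\<^esub> v \<in> ?S" using SI [of "r \<odot>\<^bsub>SL\<^esub> x" "r \<odot>\<^bsub>SP\<^esub> a"] v by (simp add: Z_closed)
    qed
  next
    fix i assume i: "i \<in> {1..n}"
    show "g i \<in> ?S"
    proof (cases "i < n")
      case True
      then have "sl_gen n b i \<in> carrier SL" using i by (auto simp: sl_alg_def sl_gen_pres)
      from SI [OF this Z_closed(5)] show ?thesis using True i by (simp add: iota_gen)
    next
      case False
      then have "i = n" using i by simp
      then show ?thesis using SI [of "\<zero>\<^bsub>SL\<^esub>" "g n"] gn_Z i by (simp add: 0)
    qed
  qed
  then show ?thesis using assms by blast
qed

lemma semidirect_iso: "(\<lambda>(x, a). iota x \<oplus>\<^bsub>SP\<^esub> a) \<in> lie_iso (lie_semidirect SL J act) SP"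
proof -
  have "(\<lambda>(x, a). iota x \<oplus>\<^bsub>SP\<^esub> a) \<in> lie_hom (lie_semidirect SL J act) SP"
  proof (rule lie_homI; clarsimp simp: lie_semidirect_simps iota Z_carrier)
    fix x a z c assume v: "x \<in> carrier SL" "a \<in> Z" "z \<in> carrier SL" "c \<in> Z"
    then have [simp]: "iota x \<in> carrier SP" "iota z \<in> carrier SP" "a \<in> carrier SP" "c \<in> carrier SP"
      by (simp_all add: iota Z_carrier)
    show "iota x \<oplus>\<^bsub>SP\<^esub> iota z \<oplus>\<^bsub>SP\<^esub> (a \<oplus>\<^bsub>SP\<^esub> c) = iota x \<oplus>\<^bsub>SP\<^esub> a \<oplus>\<^bsub>SP\<^esub> (iota z \<oplus>\<^bsub>SP\<^esub> c)"
      by (simp add: SP.M.a_ac)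
    have "\<lbrace>a, c\<rbrace>\<^bsub>SP\<^esub> \<oplus>\<^bsub>SP\<^esub> act x c \<ominus>\<^bsub>J\<^esub> act z a = \<lbrace>a, c\<rbrace>\<^bsub>SP\<^esub> \<oplus>\<^bsub>SP\<^esub> act x c \<oplus>\<^bsub>SP\<^esub> \<lbrace>a, iota z\<rbrace>\<^bsub>SP\<^esub>"
      using v by (simp add: J_minus Z_closed SP.bracket_antisym [of a "iota z"])
    then show "\<lbrace>iota x, iota z\<rbrace>\<^bsub>SP\<^esub> \<oplus>\<^bsub>SP\<^esub> (\<lbrace>a, c\<rbrace>\<^bsub>SP\<^esub> \<oplus>\<^bsub>SP\<^esub> act x c \<ominus>\<^bsub>J\<^esub> act z a) =
        \<lbrace>iota x \<oplus>\<^bsub>SP\<^esub> a, iota z \<oplus>\<^bsub>SP\<^esub> c\<rbrace>\<^bsub>SP\<^esub>"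
      by (simp add: SP.bracket_add_left SP.bracket_add_right SP.M.a_ac)
  next
    fix r x a assume "x \<in> carrier SL" "a \<in> Z"
    then show "r \<odot>\<^bsub>SP\<^esub> iota x \<oplus>\<^bsub>SP\<^esub> r \<odot>\<^bsub>SP\<^esub> a = r \<odot>\<^bsub>SP\<^esub> (iota x \<oplus>\<^bsub>SP\<^esub> a)"
      by (simp add: iota Z_carrier SP.smult_add_right)
  qed
  moreover have "bij_betw (\<lambda>(x, a). iota x \<oplus>\<^bsub>SP\<^esub> a) (carrier SL \<times> Z) (carrier SP)"
    unfolding bij_betw_def
  proof
    show "inj_on (\<lambda>(x, a). iota x \<oplus>\<^bsub>SP\<^esub> a) (carrier SL \<times> Z)"
    proof (rule inj_onI; clarify)
      fix x a z c assume v: "x \<in> carrier SL" "a \<in> Z" "z \<in> carrier SL" "c \<in> Z"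
        and eq: "iota x \<oplus>\<^bsub>SP\<^esub> a = iota z \<oplus>\<^bsub>SP\<^esub> c"
      \<comment> \<open>Applying \<open>rho\<close> removes the components in Z and recovers the
        first components.\<close>
      have "x = z"
        using arg_cong [OF eq, of rho] v by (simp add: iota rho Z_carrier rho_iota rho_Z)
      with eq v show "x = z \<and> a = c" by (simp add: iota Z_carrier)
    qed
    show "(\<lambda>(x, a). iota x \<oplus>\<^bsub>SP\<^esub> a) ` (carrier SL \<times> Z) = carrier SP"
      using SP_decomp by (force simp: iota Z_carrier)
  qed
  ultimately show ?thesis by (simp add: lie_iso_def lie_semidirect_simps)
qed

text \<open>Equivariance is read off in the matrix model: the bracket of a block diagonal matrix
  with one from Z has the tensor action as its upper right block.\<close>

lemma module_iso: "\<psi> \<in> lie_module_iso SL J act (sym2 n) (sym2_act n b)"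
proof -
  have J: "lie_module SL J act"
    using derivation_action by (simp add: lie_derivation_action_def)
  have "\<psi> (act x a) = sym2_act n b x (\<psi> a)" if "x \<in> carrier SL" "a \<in> Z" for x a
  proof -
    have S: "\<psi> a \<in> carrier (sym2 n)" using that by (simp add: C.sym_span_def)
    have "rep (act x a) = \<lbrace>sp_rep n b (sl_incl n b x) (0\<^sub>m n n), sp_rep n b (0\<^sub>m n n) (\<psi> a)\<rbrace>\<^bsub>sl_mat (n + n)\<^esub>"
      using that rep_iota [of x] rep_Z [of a] by (simp add: lie_homD [OF rep_hom] iota Z_carrier)
    also have "\<dots> = sp_rep n b (0\<^sub>m n n) (tensor_act (sl_incl n b x) (\<psi> a))"
      using rep_iota [OF that(1)] by (intro sp_rep_bracket_left S) simp
    finally show ?thesis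
      using tensor_act_sym2 [OF sl_incl_carrier [OF that(1)] S]
      by (simp add: upper_right_sp_rep sym2_carrier sym2_act_def)
  qed
  moreover have "\<psi> \<in> LinearCombinations.module_hom class_ring J (sym2 n)"
  proof -
    have "\<psi> a \<in> carrier (sym2 n)" if "a \<in> Z" for a using that by (simp add: C.sym_span_def)
    moreover have "S \<oplus>\<^bsub>sym2 n\<^esub> T = S + T" "r \<odot>\<^bsub>sym2 n\<^esub> S = r \<cdot>\<^sub>m S" for S T r
      by (simp_all add: sym2_def module_mat_simps)
    ultimately show ?thesis
      unfolding LinearCombinations.module_hom_def by (simp add: C.coord_add C.coord_smult Z_carrier)
  qed
  ultimately show ?thesis
    using C.coord_bij J lie_module_sym2 by (simp add: lie_module_iso_def)
qed

end

section \<open>Identification of the ideal with sl_{n+1}\<close>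

lemma (in lie_algebra) sym_elements_self:
  assumes u: "\<And>i. 1 \<le> i \<Longrightarrow> i \<le> n \<Longrightarrow> u i \<in> carrier L"
    and far: "\<And>i j. 1 \<le> i \<Longrightarrow> i \<le> n \<Longrightarrow> 1 \<le> j \<Longrightarrow> j \<le> n \<Longrightarrow> i \<noteq> Suc j \<Longrightarrow> j \<noteq> Suc i \<Longrightarrow> \<lbrace>u i, u j\<rbrace> = \<zero>"
    and serre: "\<And>i j. 1 \<le> i \<Longrightarrow> i \<le> n \<Longrightarrow> 1 \<le> j \<Longrightarrow> j \<le> n \<Longrightarrow> i = Suc j \<or> j = Suc i \<Longrightarrow>
      \<lbrace>u i, \<lbrace>u i, u j\<rbrace>\<rbrace> = (2 * (h i j * h i j)) \<odot> u i"
    and h_far: "\<And>i j. i \<noteq> Suc j \<Longrightarrow> j \<noteq> Suc i \<Longrightarrow> h i j = 0"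
    and h_antisym: "\<And>i j. h j i = - h i j"
    and h_Suc: "\<And>i. 1 \<le> i \<Longrightarrow> i < n \<Longrightarrow> h i (Suc i) \<noteq> 0"
  shows "sym_elements L n n h u (sym_elt h u u)"
proof (rule sym_elements_sym_elt)
  \<comment> \<open>Antisymmetry of h turns the coefficient 2 h_{ij}^2 of \<open>serre\<close> into
    the form -2 h_{ij} h_{ji} that the construction asks for.\<close>
  fix i j assume "1 \<le> i" "i \<le> n" "1 \<le> j" "j \<le> n" "i = Suc j \<or> j = Suc i"
  then show "\<lbrace>u i, \<lbrace>u i, u j\<rbrace>\<rbrace> = (- 2 * (h i j * h j i)) \<odot> u i"
    using serre [of i j] h_antisym [of i j] by simp
next
  fix k assume k: "1 \<le> k" "Suc k \<le> n"
  then have [simp]: "u k \<in> carrier L" "u (Suc k) \<in> carrier L" using u by auto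
  note anti = bracket_antisym [of "u k" "u (Suc k)"]
  show "h k (Suc k) \<odot> \<lbrace>u (Suc k), u k\<rbrace> = h (Suc k) k \<odot> \<lbrace>u k, u (Suc k)\<rbrace>"
    using anti h_antisym [of "Suc k" k] by (simp add: smult_smult)
  show "\<lbrace>u (Suc k), \<lbrace>u k, u (Suc k)\<rbrace>\<rbrace> = (2 * h k (Suc k) * h (Suc k) k) \<odot> u (Suc k)"
    using anti serre [of "Suc k" k] k h_antisym [of "Suc k" k]
      by (simp add: bracket_smult_right smult_smult mult.assoc)
next
  fix k assume "1 \<le> k" "k < n"
  then show "\<lbrace>u k, \<lbrace>u k, u (Suc k)\<rbrace>\<rbrace> = (2 * h k (Suc k) * h k (Suc k)) \<odot> u k"
    using serre [of k "Suc k"] by (simp add: mult.assoc)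
qed (use u far h_far h_Suc in auto)

context sp_setting
begin

text \<open>The sign and the square are forced by matching -2 b'_i with 2 \<Omega>_{i,i+1}^2, the
  Serre coefficient of the elements e_i e_i.\<close>

definition b' :: "nat \<Rightarrow> complex" where "b' i = - (form_entry n b i * form_entry n b i)"

abbreviation "SL' \<equiv> sl_alg (Suc n) b'"
abbreviation "g' \<equiv> sl_gen (Suc n) b'"

lemma SL'_lie: "lie_algebra SL'"
  by (simp add: sl_alg_def lie_algebra_presented)

lemma SL'_pres: "SL' = lie_presented {1..n} (sl_relations (Suc n) b')"
  and g'_pres: "g' = lie_pres_gen {1..n} (sl_relations (Suc n) b')"
  by (simp_all add: sl_alg_def fun_eq_iff sl_gen_def lie_pres_gen_def)

lemma rep_inj: "a \<in> Z \<Longrightarrow> c \<in> Z \<Longrightarrow> rep a = rep c \<Longrightarrow> a = c"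
  using C.coord_bij by (auto simp: bij_betw_def inj_on_def)

lemma diag_Z: "1 \<le> i \<Longrightarrow> i \<le> n \<Longrightarrow> E.diag i \<in> Z"
  using C.basis_in_sym_span [of i i] by simp

lemma rep_diag: "1 \<le> i \<Longrightarrow> i \<le> n \<Longrightarrow> rep (E.diag i) = sp_rep n b (0\<^sub>m n n) (esym n i i)"
  using rep_y [of i i] by simp

lemma rep_smult_diag: "1 \<le> i \<Longrightarrow> i \<le> n \<Longrightarrow> rep (r \<odot>\<^bsub>SP\<^esub> E.diag i) = sp_rep n b (0\<^sub>m n n) (r \<cdot>\<^sub>m esym n i i)"
  using sp_rep_smult [of "0\<^sub>m n n" n "esym n i i" b r]
  by (simp add: lie_homD [OF rep_hom] sl_mat_ops rep_diag)

lemma rep_zero: "rep \<zero>\<^bsub>SP\<^esub> = sp_rep n b (0\<^sub>m n n) (0\<^sub>m n n)"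
  by (simp add: lie_hom_zero [OF SP_lie lie_algebra_sl_mat rep_hom] sl_mat_ops sp_rep_zero)

lemma rep_diag_bracket:
  assumes "1 \<le> i" "i \<le> n" "1 \<le> j" "j \<le> n"
  shows "rep (\<lbrace>E.diag i, E.diag j\<rbrace>\<^bsub>SP\<^esub>) = sp_rep n b (0\<^sub>m n n) ((2 * form_coeff n b i j) \<cdot>\<^sub>m esym n i j)"
proof -
  have e: "1 \<cdot>\<^sub>m (c \<cdot>\<^sub>m esym n i j + c \<cdot>\<^sub>m esym n j i) = (2 * c) \<cdot>\<^sub>m esym n i j" for c
    unfolding esym_commute [of n j i] by (rule eq_matI) auto
  show ?thesis
    using assms sp_gen_mat_top_act [of j n j i b 1] e by (simp add: lie_homD [OF rep_hom] rep_diag)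
qed

lemma diag_bracket_far:
  assumes "1 \<le> i" "i \<le> n" "1 \<le> j" "j \<le> n" "i \<noteq> Suc j" "j \<noteq> Suc i"
  shows "\<lbrace>E.diag i, E.diag j\<rbrace>\<^bsub>SP\<^esub> = \<zero>\<^bsub>SP\<^esub>"
proof (rule rep_inj)
  have "form_coeff n b i j = 0" using assms by (simp add: form_coeff_def)
  then show "rep (\<lbrace>E.diag i, E.diag j\<rbrace>\<^bsub>SP\<^esub>) = rep \<zero>\<^bsub>SP\<^esub>"
    using assms by (simp add: rep_diag_bracket rep_zero)
qed (use assms in \<open>auto intro!: Z_closed diag_Z\<close>)

text \<open>By injectivity of \<open>rep\<close> on Z this is a matrix computation: the inner
  bracket is 2 \<Omega>_{ij} e_i e_j, and e_i e_i sends e_i e_j to \<Omega>_{ij} e_i e_i since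
  \<Omega>_{ii} = 0.\<close>

lemma diag_bracket_near:
  assumes "1 \<le> i" "i \<le> n" "1 \<le> j" "j \<le> n"
  shows "\<lbrace>E.diag i, \<lbrace>E.diag i, E.diag j\<rbrace>\<^bsub>SP\<^esub>\<rbrace>\<^bsub>SP\<^esub> =
    (2 * (form_coeff n b i j * form_coeff n b i j)) \<odot>\<^bsub>SP\<^esub> E.diag i"
proof (rule rep_inj)
  have 0: "form_coeff n b i i = 0" by (simp add: form_coeff_def)
  show "rep (\<lbrace>E.diag i, \<lbrace>E.diag i, E.diag j\<rbrace>\<^bsub>SP\<^esub>\<rbrace>\<^bsub>SP\<^esub>) =
      rep ((2 * (form_coeff n b i j * form_coeff n b i j)) \<odot>\<^bsub>SP\<^esub> E.diag i)"
    using assms rep_diag_bracket [OF assms] sp_gen_mat_top_act [of i n j i b "2 * form_coeff n b i j"]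
    by (simp add: lie_homD(4) [OF rep_hom] rep_diag rep_smult_diag 0 smult_smult_times mult.assoc)
qed (use assms in \<open>auto intro!: Z_closed diag_Z\<close>)

lemma form_coeff_near: "i = Suc j \<or> j = Suc i \<Longrightarrow>
  - 2 * b' (min i j) = 2 * (form_coeff n b i j * form_coeff n b i j)"
  by (auto simp: b'_def form_coeff_def)

lemma diag_relation:
  assumes "(s, t) \<in> sl_relations (Suc n) b'"
  shows "lie_eval SP E.diag s = lie_eval SP E.diag t"
proof -
  consider (far) i j where "s = Br (Gen i) (Gen j)" "t = Zero" "i \<in> {1..n}" "j \<in> {1..n}"
      "\<bar>int i - int j\<bar> > 1"
    | (near) i j where "s = Br (Gen i) (Br (Gen i) (Gen j))"
        "t = Scale (- 2 * b' (min i j)) (Gen i)" "i \<in> {1..n}" "j \<in> {1..n}" "\<bar>int i - int j\<bar> = 1"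
    using assms unfolding sl_relations_def by auto
  then show ?thesis
  proof cases
    case far
    then show ?thesis using diag_bracket_far [of i j] by auto
  next
    case near
    then have "i = Suc j \<or> j = Suc i" by linarith
    then show ?thesis using near(3,4) diag_bracket_near [of i j]
      by (simp only: near(1,2) lie_eval.simps form_coeff_near atLeastAtMost_iff)
  qed
qed

definition theta where "theta = lie_lift SP E.diag"

lemma diag_image: "E.diag ` {1..n} \<subseteq> carrier SP"
  by auto

lemma theta_hom: "theta \<in> lie_hom SL' SP"
  unfolding theta_def SL'_pres by (rule SP.lie_lift_hom [OF diag_image diag_relation])

lemma theta_gen: "1 \<le> i \<Longrightarrow> i \<le> n \<Longrightarrow> theta (g' i) = E.diag i"
  unfolding theta_def g'_pres using SP.lie_lift_gen [OF diag_image diag_relation, where i = i] by simp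

lemma g'_closed: "1 \<le> i \<Longrightarrow> i \<le> n \<Longrightarrow> g' i \<in> carrier SL'"
  unfolding g'_pres SL'_pres by simp

lemma theta_Z:
  assumes "x \<in> carrier SL'"
  shows "theta x \<in> Z"
proof -
  have "carrier SL' \<subseteq> {x \<in> carrier SL'. theta x \<in> Z}"
    unfolding SL'_pres
  proof (rule lie_presented_generated; fold SL'_pres g'_pres)
    show "lie_subalgebra {x \<in> carrier SL'. theta x \<in> Z} SL'"
      by (rule lie_algebra.lie_subalgebra_vimage
        [OF SL'_lie SP_lie theta_hom SP.lie_ideal_subalgebra [OF Z_ideal]])
  qed (auto simp: theta_gen diag_Z g'_closed)
  with assms show ?thesis by blast
qed

lemma g'_relation:
  assumes "(s, t) \<in> sl_relations (Suc n) b'"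
  shows "lie_eval SL' g' s = lie_eval SL' g' t"
proof -
  have "s \<in> lie_terms {1..n} \<and> t \<in> lie_terms {1..n}"
    using assms by (auto simp: sl_relations_def)
  then show ?thesis
    unfolding SL'_pres g'_pres using lie_pres_gen_relation [OF assms] by blast
qed

text \<open>Coordinates are compared on both sides: \<psi> is bijective on Z, and \<psi> after
  \<open>theta\<close> is bijective on \<open>SL'\<close> once the latter is known to be spanned by
  its elements \<open>?y j k\<close>.\<close>

lemma theta_iso:
  assumes nz: "\<forall>i\<in>{1..n - 1}. b i \<noteq> 0"
  shows "theta \<in> lie_iso SL' J"
proof -
  interpret SL': lie_algebra SL' by (rule SL'_lie)
  let ?h = "form_coeff n b"
  let ?y = "SL'.sym_elt ?h g' g'"
  \<comment> \<open>\<Omega>_{i,i+1} is the product of the -b_k for i \<le> k < n; here all b_k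
    being nonzero enters.\<close>
  have h_Suc: "?h i (Suc i) \<noteq> 0" if "1 \<le> i" "i < n" for i
    using that nz by (auto simp: form_coeff_def form_entry_def)
  have h_far: "?h i j = 0" if "i \<noteq> Suc j" "j \<noteq> Suc i" for i j
    using that by (simp add: form_coeff_def)
  have far: "\<lbrace>g' i, g' j\<rbrace>\<^bsub>SL'\<^esub> = \<zero>\<^bsub>SL'\<^esub>"
    if "1 \<le> i" "i \<le> n" "1 \<le> j" "j \<le> n" "i \<noteq> Suc j" "j \<noteq> Suc i" for i j
  proof (cases "i = j")
    case True
    show ?thesis unfolding True using that(3,4) by (intro SL'.bracket_self g'_closed)
  next
    case False
    then have "(Br (Gen i) (Gen j), Zero) \<in> sl_relations (Suc n) b'"
      using that by (auto simp: sl_relations_def)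
    from g'_relation [OF this] show ?thesis by simp
  qed
  have near: "\<lbrace>g' i, \<lbrace>g' i, g' j\<rbrace>\<^bsub>SL'\<^esub>\<rbrace>\<^bsub>SL'\<^esub> = (2 * (?h i j * ?h i j)) \<odot>\<^bsub>SL'\<^esub> g' i"
    if "1 \<le> i" "i \<le> n" "1 \<le> j" "j \<le> n" "i = Suc j \<or> j = Suc i" for i j
  proof -
    have "(Br (Gen i) (Br (Gen i) (Gen j)), Scale (- 2 * b' (min i j)) (Gen i))
      \<in> sl_relations (Suc n) b'"
      using that unfolding sl_relations_def by fastforce
    from g'_relation [OF this] show ?thesis by (simp only: lie_eval.simps form_coeff_near [OF that(5)])
  qed
  interpret E': sym_elements SL' n n ?h g' ?y
    by (rule SL'.sym_elements_self; (rule g'_closed far near h_far form_coeff_antisym h_Suc; assumption)?)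
  have rt: "(\<lambda>x. rep (theta x)) \<in> lie_hom SL' (sl_mat (n + n))"
    by (rule lie_hom_comp [OF theta_hom rep_hom])
  have rep_y': "rep (theta (?y j k)) = sp_rep n b (0\<^sub>m n n) (esym n j k)"
    if "1 \<le> j" "j \<le> n" "1 \<le> k" "k \<le> n" for j k
  proof (rule SL'.sym_elt_rep [OF rt])
    fix i j k assume "1 \<le> i" "i < n" "1 \<le> j" "j \<le> n" "1 \<le> k" "k \<le> n"
    then show "\<lbrace>rep (theta (g' i)), sp_rep n b (0\<^sub>m n n) (1 \<cdot>\<^sub>m esym n j k)\<rbrace>\<^bsub>sl_mat (n + n)\<^esub> =
        sp_rep n b (0\<^sub>m n n) (1 \<cdot>\<^sub>m (?h i j \<cdot>\<^sub>m esym n i k + ?h i k \<cdot>\<^sub>m esym n j i))"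
      using sp_gen_mat_top_act [of j n k i b 1] by (simp add: theta_gen rep_diag)
  qed (use that h_far h_Suc in \<open>auto simp: g'_closed theta_gen rep_diag\<close>)
  interpret C': sym_coordinates SL' n ?y "\<lambda>x. upper_right n (rep (theta x))"
    by (rule SL'.sym_coordinates_rep [OF rt E'.y_closed SL'.sym_elt_commute rep_y'])
  \<comment> \<open>All n generators now act by \<open>u_y\<close>, so the span is an ideal. It
    contains the generators as the elements \<open>?y i i\<close> and is therefore all of
    \<open>SL'\<close>.\<close>
  have "lie_ideal C'.sym_span SL'"
    unfolding SL'_pres
  proof (rule lie_presented_idealI; fold SL'_pres g'_pres)
    show "submodule class_ring C'.sym_span SL'" by (rule C'.sym_span_submodule)
    fix i x assume i: "i \<in> {1..n}" and x: "x \<in> C'.sym_span"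
    show "\<lbrace>g' i, x\<rbrace>\<^bsub>SL'\<^esub> \<in> C'.sym_span"
      by (rule C'.bracket_sym_span [OF _ _ x])
        (use i in \<open>auto simp: g'_closed E'.u_y SL'.submoduleD [OF C'.sym_span_submodule] C'.basis_in_sym_span\<close>)
  qed
  then have "carrier SL' \<subseteq> C'.sym_span"
    unfolding SL'_pres
  proof (intro lie_presented_generated; fold SL'_pres g'_pres)
    fix i assume "i \<in> {1..n}"
    then show "g' i \<in> C'.sym_span" using C'.basis_in_sym_span [of i i] by simp
  qed (rule SL'.lie_ideal_subalgebra)
  then have "C'.sym_span = carrier SL'" by (auto simp: C'.sym_span_def)
  then have bij: "bij_betw (\<lambda>x. \<psi> (theta x)) (carrier SL') (carrier (sym2 n))"
    using C'.coord_bij by simp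
  \<comment> \<open>Injectivity comes from the composite with \<psi>; surjectivity uses a preimage
    of the coordinates and injectivity of \<psi> on Z.\<close>
  have "bij_betw theta (carrier SL') Z"
    unfolding bij_betw_def
  proof
    show "inj_on theta (carrier SL')"
      using bij by (auto simp: bij_betw_def inj_on_def)
    show "theta ` carrier SL' = Z"
    proof (rule antisym)
      show "Z \<subseteq> theta ` carrier SL'"
      proof
        fix a assume a: "a \<in> Z"
        then have "\<psi> a \<in> (\<lambda>x. \<psi> (theta x)) ` carrier SL'"
          using C.coord_bij bij by (auto simp: bij_betw_def)
        then obtain x where x: "x \<in> carrier SL'" "\<psi> (theta x) = \<psi> a" by force
        then have "theta x = a" using a C.coord_bij theta_Z by (auto simp: bij_betw_def inj_on_def)
        with x show "a \<in> theta ` carrier SL'" by blast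
      qed
    qed (auto simp: theta_Z)
  qed
  moreover have "theta \<in> lie_hom SL' J"
    by (rule lie_homI) (simp_all add: theta_Z lie_homD [OF theta_hom])
  ultimately show ?thesis by (simp add: lie_iso_def)
qed

end

theorem theorem1p12:
  fixes n :: nat and b :: "nat \<Rightarrow> complex"
  assumes "n \<ge> 2"
  shows "let SP = sp_alg n b;
             SL = sl_alg n b;
             J = lie_ideal_generated SP {sp_gen n b n}
         in \<exists>\<iota>.
           \<iota> \<in> lie_iso SL (lie_subalgebra_generated SP (sp_gen n b ` {1..n-1})) \<and>
           (\<forall>i\<in>{1..n-1}. \<iota> (sl_gen n b i) = sp_gen n b i) \<and>
           lie_derivation_action SL J (\<lambda>x a. \<lbrace>\<iota> x, a\<rbrace>\<^bsub>SP\<^esub>) \<and>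
           (\<lambda>(x, a). \<iota> x \<oplus>\<^bsub>SP\<^esub> a)
             \<in> lie_iso (lie_semidirect SL J (\<lambda>x a. \<lbrace>\<iota> x, a\<rbrace>\<^bsub>SP\<^esub>)) SP \<and>
           (\<exists>\<psi>. \<psi> \<in> lie_module_iso SL J (\<lambda>x a. \<lbrace>\<iota> x, a\<rbrace>\<^bsub>SP\<^esub>) (sym2 n) (sym2_act n b)) \<and>
           ((\<forall>i\<in>{1..n-1}. b i \<noteq> 0) \<longrightarrow>
             (\<exists>b' \<phi>. let SL' = sl_alg (n + 1) b';
                        \<phi>inv = inv_into (carrier J) \<phi>;
                        d = (\<lambda>x y. \<phi> (\<lbrace>\<iota> x, \<phi>inv y\<rbrace>\<^bsub>SP\<^esub>))
                    in \<phi> \<in> lie_iso J SL' \<and>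
                       lie_derivation_action SL SL' d \<and>
                       (\<lambda>(x, y). \<iota> x \<oplus>\<^bsub>SP\<^esub> \<phi>inv y) \<in> lie_iso (lie_semidirect SL SL' d) SP))"
proof -
  interpret sp_setting n b by unfold_locales (rule assms)
  have gen: "\<forall>i\<in>{1..n-1}. iota (sl_gen n b i) = sp_gen n b i"
    using assms by (auto intro!: iota_gen)
  have long: "\<exists>b' \<phi>. let SL' = sl_alg (Suc n) b'; \<phi>inv = inv_into (carrier J) \<phi>;
        d = (\<lambda>x y. \<phi> (\<lbrace>iota x, \<phi>inv y\<rbrace>\<^bsub>SP\<^esub>))
      in \<phi> \<in> lie_iso J SL' \<and> lie_derivation_action SL SL' d \<and>
         (\<lambda>(x, y). iota x \<oplus>\<^bsub>SP\<^esub> \<phi>inv y) \<in> lie_iso (lie_semidirect SL SL' d) SP"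
    if "\<forall>i\<in>{1..n-1}. b i \<noteq> 0"
  proof -
    \<comment> \<open>The isomorphism is required to start from J, whereas \<open>theta\<close> is
      defined by generators of \<open>SL'\<close>, so its inverse is taken.\<close>
    define \<phi> where "\<phi> = inv_into (carrier SL') theta"
    have phi: "\<phi> \<in> lie_iso J SL'"
      unfolding \<phi>_def by (rule lie_iso_inv_into [OF SL'_lie theta_iso [OF that]])
    note transport = lie_derivation_action_transport [OF derivation_action SL'_lie phi]
    \<comment> \<open>The required map factors through the semidirect product with J, so transport
      along \<phi> is composed with the decomposition of \<open>SP\<close>.\<close>
    have "(\<lambda>(x, y). iota x \<oplus>\<^bsub>SP\<^esub> inv_into (carrier J) \<phi> y) =
        (\<lambda>p. (\<lambda>(x, a). iota x \<oplus>\<^bsub>SP\<^esub> a) ((\<lambda>(x, y). (x, inv_into (carrier J) \<phi> y)) p))"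
      by auto
    then have "(\<lambda>(x, y). iota x \<oplus>\<^bsub>SP\<^esub> inv_into (carrier J) \<phi> y) \<in>
        lie_iso (lie_semidirect SL SL' (\<lambda>x y. \<phi> (\<lbrace>iota x, inv_into (carrier J) \<phi> y\<rbrace>\<^bsub>SP\<^esub>))) SP"
      using lie_iso_comp [OF transport(2) semidirect_iso] by simp
    then show ?thesis unfolding Let_def using phi transport(1) by blast
  qed
  show ?thesis
    unfolding Let_def J_eq Suc_eq_plus1 [symmetric]
    using iota_iso gen derivation_action semidirect_iso module_iso long [unfolded Let_def] by blast
qed

end
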